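(* Let $k$ be a regular unitarily invariant CNP kernel on $\mathbb{B}_d$. Let $\mathcal D$ be a finite-dimensional Hilbert space, let $\mathcal M\subseteq H_k\otimes\mathcal D$ be a closed subspace invariant under $M_{z_i}\otimes I_{\mathcal D}$ for all $i=1,\dots,d$, let $\mathcal E$ be a Hilbert space, and let $\theta\in\mathrm{Mult}(H_k\otimes\mathcal E,H_k\otimes\mathcal D)$ be an inner multiplier with $\mathcal M=\theta(H_k\otimes\mathcal E)$. Then $$\sigma\big(\mathbf M_{\bm z}\otimes I_{\mathcal D},(H_k\otimes\mathcal D)/\mathcal M\big)\supset E_\theta\cup F_\theta,$$ where the left-hand side is the Taylor joint spectrum of the commuting tuple induced by $(M_{z_1}\otimes I_{\mathcal D},\dots,M_{z_d}\otimes I_{\mathcal D})$ on the quotient space $(H_k\otimes\mathcal D)/\mathcal M$.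
   Context: $\mathbb{B}_d$ is the open Euclidean unit ball of $\mathbb{C}^d$ and $\overline{\mathbb{B}}_d$ its closure. A regular unitarily invariant CNP kernel on $\mathbb{B}_d$ is a reproducing kernel $k(\bm z,\bm w)=\sum_{n=0}^\infty a_n\langle\bm z,\bm w\rangle^n$ on $\mathbb{B}_d$ with $a_0=1$, $a_n>0$ for all $n$, $\lim_{n\to\infty}a_n/a_{n+1}=1$, such that there are real numbers $b_n\ge 0$ ($n\ge1$) with $1-\frac{1}{k(\bm z,\bm w)}=\sum_{n=1}^\infty b_n\langle\bm z,\bm w\rangle^n$ for $\bm z,\bm w\in\mathbb{B}_d$ (equivalently $k$ is an irreducible complete Nevanlinna–Pick kernel). $H_k$ is the reproducing kernel Hilbert space of $k$, and $\mathbf M_{\bm z}=(M_{z_1},\dots,M_{z_d})$ is the tuple of multiplications by the coordinate functions on $H_k$ (bounded operators). For Hilbert spaces $\mathcal E,\mathcal D$, $\mathrm{Mult}(H_k\otimes\mathcal E,H_k\otimes\mathcal D)$ is the space of functions $\theta:\mathbb{B}_d\to\mathcal B(\mathcal E,\mathcal D)$ whose multiplication operator $M_\theta$ is bounded from $H_k\otimes\mathcal E$ to $H_k\otimes\mathcal D$ (viewed as spaces of vector-valued functions); $\theta(H_k\otimes\mathcal E)$ denotes the range of $M_\theta$. The multiplier $\theta$ is inner (in the sense of McCullough–Trent) if $M_\theta$ is a partial isometry. For an operator-valued function $\theta$ on $\mathbb{B}_d$, $E_\theta$ is the set of $\bm\lambda\in\overline{\mathbb{B}}_d$ such that $\lim_{\bm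 z\to\bm\lambda,\,\bm z\in\mathbb{B}_d}\theta(\bm z)$ exists (in operator norm) and is not surjective, and $F_\theta$ is the set of $\bm\lambda\in\overline{\mathbb{B}}_d$ such that this limit does not exist. *)

theory Defs
  imports "HOL-Analysis.Analysis" "HOL-Algebra.Module" "HOL-Algebra.AbelCoset"
begin

section \<open>Complex Hilbert spaces\<close>

class complex_vector = real_vector +
  fixes scaleC :: "complex \<Rightarrow> 'a \<Rightarrow> 'a" (infixr \<open>*\<^sub>C\<close> 75)
  assumes scaleR_scaleC: "r *\<^sub>R x = complex_of_real r *\<^sub>C x"
    and scaleC_add_right: "c *\<^sub>C (x + y) = c *\<^sub>C x + c *\<^sub>C y"
    and scaleC_add_left: "(b + c) *\<^sub>C x = b *\<^sub>C x + c *\<^sub>C x"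
    and scaleC_scaleC: "b *\<^sub>C c *\<^sub>C x = (b * c) *\<^sub>C x"

text \<open>The inner product is linear in its first argument. Positive definiteness is part of
  the last axiom, since the norm is one.\<close>

class complex_inner = complex_vector + real_normed_vector +
  fixes cinner :: "'a \<Rightarrow> 'a \<Rightarrow> complex"
  assumes cinner_commute: "cinner x y = cnj (cinner y x)"
    and cinner_add_left: "cinner (x + y) z = cinner x z + cinner y z"
    and cinner_scaleC_left: "cinner (c *\<^sub>C x) y = c * cinner x y"
    and cinner_self: "cinner x x = complex_of_real ((norm x)\<^sup>2)"

class chilbert_space = complex_inner + complete_space

instantiation complex :: chilbert_space
begin

definition scaleC_complex :: "complex \<Rightarrow> complex \<Rightarrow> complex" where
  "scaleC_complex c x = c * x"

definition cinner_complex :: "complex \<Rightarrow> complex \<Rightarrow> complex" where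
  "cinner_complex x y = x * cnj y"

instance
  by standard
    (simp_all add: scaleC_complex_def cinner_complex_def scaleR_conv_of_real algebra_simps
      complex_norm_square [symmetric])

end

instantiation vec :: (complex_vector, finite) complex_vector
begin

definition scaleC_vec :: "complex \<Rightarrow> 'a ^ 'b \<Rightarrow> 'a ^ 'b" where
  "scaleC_vec c x = (\<chi> i. c *\<^sub>C (x $ i))"

instance
  by standard
    (simp_all add: vec_eq_iff scaleC_vec_def scaleR_scaleC scaleC_add_right scaleC_add_left
      scaleC_scaleC)

end

instantiation vec :: (complex_inner, finite) complex_inner
begin

definition cinner_vec :: "'a ^ 'b \<Rightarrow> 'a ^ 'b \<Rightarrow> complex" where
  "cinner_vec x y = (\<Sum>i\<in>UNIV. cinner (x $ i) (y $ i))"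

instance
proof
  fix x y z :: "'a ^ 'b" and c :: complex
  show "cinner x y = cnj (cinner y x)"
    by (simp add: cinner_vec_def cinner_commute [symmetric])
  show "cinner (x + y) z = cinner x z + cinner y z"
    by (simp add: cinner_vec_def cinner_add_left sum.distrib)
  show "cinner (c *\<^sub>C x) y = c * cinner x y"
    by (simp add: cinner_vec_def scaleC_vec_def cinner_scaleC_left sum_distrib_left)
  show "cinner x x = complex_of_real ((norm x)\<^sup>2)"
    by (simp add: cinner_vec_def cinner_self norm_vec_def L2_set_def sum_nonneg)
qed

end

instance vec :: (chilbert_space, finite) chilbert_space ..

definition cfinite_dim :: "'a::complex_vector itself \<Rightarrow> bool" where
  "cfinite_dim _ \<longleftrightarrow> (\<exists>B::'a set. finite B \<and> (\<forall>x. \<exists>c. x = (\<Sum>b\<in>B. c b *\<^sub>C b)))"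


section \<open>Regular unitarily invariant complete Nevanlinna--Pick kernels\<close>

definition regular_uinv_cnp_kernel ::
    "(complex ^ 'n::finite \<Rightarrow> complex ^ 'n \<Rightarrow> complex) \<Rightarrow> bool" where
  "regular_uinv_cnp_kernel k \<longleftrightarrow>
    (\<exists>a::nat \<Rightarrow> real.
      a 0 = 1 \<and> (\<forall>n. a n > 0) \<and> (\<lambda>n. a n / a (Suc n)) \<longlonglongrightarrow> 1 \<and>
      (\<forall>z\<in>ball 0 1. \<forall>w\<in>ball 0 1. (\<lambda>n. complex_of_real (a n) * cinner z w ^ n) sums k z w)) \<and>
    (\<exists>b::nat \<Rightarrow> real.
      (\<forall>n\<ge>1. b n \<ge> 0) \<and>
      (\<forall>z\<in>ball 0 1. \<forall>w\<in>ball 0 1. k z w \<noteq> 0 \<and>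
        (\<lambda>n. complex_of_real (b (Suc n)) * cinner z w ^ Suc n) sums (1 - 1 / k z w)))"


section \<open>Vector-valued reproducing kernel Hilbert spaces\<close>

definition hnorm :: "('v \<Rightarrow> 'v \<Rightarrow> complex) \<Rightarrow> 'v \<Rightarrow> real" where
  "hnorm ip f = sqrt (Re (ip f f))"

definition fun_subspace :: "('x \<Rightarrow> 'e::complex_vector) set \<Rightarrow> bool" where
  "fun_subspace M \<longleftrightarrow>
    (\<lambda>_. 0) \<in> M \<and>
    (\<forall>f\<in>M. \<forall>g\<in>M. (\<lambda>x. f x + g x) \<in> M) \<and>
    (\<forall>c. \<forall>f\<in>M. (\<lambda>x. c *\<^sub>C f x) \<in> M)"

text \<open>The set \<open>H\<close> of functions \<open>S \<rightarrow> E\<close>, with inner product \<open>ip\<close>, is the reproducing kernel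
  Hilbert space with operator-valued kernel \<open>(z, w) \<mapsto> k z w \<cdot> I\<^sub>E\<close>, that is, \<open>H\<^sub>k \<otimes> E\<close> viewed
  as a space of \<open>E\<close>-valued functions. By the Moore--Aronszajn theorem \<open>H\<close>, and \<open>ip\<close> on \<open>H\<close>,
  are determined by \<open>S\<close> and \<open>k\<close>. A function on \<open>S\<close> is represented by its extension by \<open>0\<close>.\<close>

locale vv_rkhs =
  fixes S :: "'x set"
    and k :: "'x \<Rightarrow> 'x \<Rightarrow> complex"
    and H :: "('x \<Rightarrow> 'e::chilbert_space) set"
    and ip :: "('x \<Rightarrow> 'e) \<Rightarrow> ('x \<Rightarrow> 'e) \<Rightarrow> complex"
  assumes vanish_outside: "f \<in> H \<Longrightarrow> x \<notin> S \<Longrightarrow> f x = 0"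
    and subspace: "fun_subspace H"
    and ip_commute: "f \<in> H \<Longrightarrow> g \<in> H \<Longrightarrow> ip f g = cnj (ip g f)"
    and ip_add_left:
      "f \<in> H \<Longrightarrow> g \<in> H \<Longrightarrow> h \<in> H \<Longrightarrow> ip (\<lambda>x. f x + g x) h = ip f h + ip g h"
    and ip_scaleC_left: "f \<in> H \<Longrightarrow> g \<in> H \<Longrightarrow> ip (\<lambda>x. c *\<^sub>C f x) g = c * ip f g"
    and ip_nonneg: "f \<in> H \<Longrightarrow> Re (ip f f) \<ge> 0"
    and ip_definite: "f \<in> H \<Longrightarrow> ip f f = 0 \<Longrightarrow> f = (\<lambda>_. 0)"
    and complete:
      "(\<And>n. X n \<in> H) \<Longrightarrow>
       (\<And>\<epsilon>. \<epsilon> > 0 \<Longrightarrow> \<exists>N. \<forall>m\<ge>N. \<forall>n\<ge>N. hnorm ip (\<lambda>x. X m x - X n x) < \<epsilon>) \<Longrightarrow>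
       \<exists>f\<in>H. (\<lambda>n. hnorm ip (\<lambda>x. X n x - f x)) \<longlonglongrightarrow> 0"
    and kernel_mem: "w \<in> S \<Longrightarrow> (\<lambda>z. if z \<in> S then k z w *\<^sub>C e else 0) \<in> H"
    and reproducing:
      "f \<in> H \<Longrightarrow> w \<in> S \<Longrightarrow>
       ip f (\<lambda>z. if z \<in> S then k z w *\<^sub>C e else 0) = cinner (f w) e"

definition closed_fun_subspace ::
    "('x \<Rightarrow> 'e::complex_vector) set \<Rightarrow> (('x \<Rightarrow> 'e) \<Rightarrow> ('x \<Rightarrow> 'e) \<Rightarrow> complex) \<Rightarrow>
     ('x \<Rightarrow> 'e) set \<Rightarrow> bool" where
  "closed_fun_subspace H ip M \<longleftrightarrow>
    M \<subseteq> H \<and> fun_subspace M \<and>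
    (\<forall>X f. (\<forall>n. X n \<in> M) \<and> f \<in> H \<and> (\<lambda>n. hnorm ip (\<lambda>x. X n x - f x)) \<longlonglongrightarrow> 0 \<longrightarrow> f \<in> M)"


section \<open>Multipliers\<close>

definition coord_mult :: "'n \<Rightarrow> (complex ^ 'n \<Rightarrow> 'e::complex_vector) \<Rightarrow> complex ^ 'n \<Rightarrow> 'e" where
  "coord_mult i f = (\<lambda>z. (z $ i) *\<^sub>C f z)"

definition mult_op ::
    "('x \<Rightarrow> 'e::real_normed_vector \<Rightarrow>\<^sub>L 'd::real_normed_vector) \<Rightarrow> ('x \<Rightarrow> 'e) \<Rightarrow> 'x \<Rightarrow> 'd" where
  "mult_op \<theta> f = (\<lambda>z. blinfun_apply (\<theta> z) (f z))"

text \<open>Elements of \<open>'e \<Rightarrow>\<^sub>L 'd\<close> are only real-linear, so complex homogeneity is required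
  separately.\<close>

definition multiplier ::
    "'x set \<Rightarrow>
     ('x \<Rightarrow> 'e::complex_inner) set \<Rightarrow> (('x \<Rightarrow> 'e) \<Rightarrow> ('x \<Rightarrow> 'e) \<Rightarrow> complex) \<Rightarrow>
     ('x \<Rightarrow> 'd::complex_inner) set \<Rightarrow> (('x \<Rightarrow> 'd) \<Rightarrow> ('x \<Rightarrow> 'd) \<Rightarrow> complex) \<Rightarrow>
     ('x \<Rightarrow> 'e \<Rightarrow>\<^sub>L 'd) \<Rightarrow> bool" where
  "multiplier S HE ipE HD ipD \<theta> \<longleftrightarrow>
    (\<forall>z\<in>S. \<forall>c x. blinfun_apply (\<theta> z) (c *\<^sub>C x) = c *\<^sub>C blinfun_apply (\<theta> z) x) \<and>
    (\<forall>f\<in>HE. mult_op \<theta> f \<in> HD) \<and>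
    (\<exists>C. \<forall>f\<in>HE. hnorm ipD (mult_op \<theta> f) \<le> C * hnorm ipE f)"

definition partial_isometry ::
    "('x \<Rightarrow> 'e::zero) set \<Rightarrow> (('x \<Rightarrow> 'e) \<Rightarrow> ('x \<Rightarrow> 'e) \<Rightarrow> complex) \<Rightarrow>
     (('x \<Rightarrow> 'd::zero) \<Rightarrow> ('x \<Rightarrow> 'd) \<Rightarrow> complex) \<Rightarrow>
     (('x \<Rightarrow> 'e) \<Rightarrow> 'x \<Rightarrow> 'd) \<Rightarrow> bool" where
  "partial_isometry HE ipE ipD A \<longleftrightarrow>
    (\<forall>f\<in>HE. (\<forall>g\<in>HE. A g = (\<lambda>_. 0) \<longrightarrow> ipE f g = 0) \<longrightarrow> hnorm ipD (A f) = hnorm ipE f)"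

definition inner_multiplier ::
    "'x set \<Rightarrow>
     ('x \<Rightarrow> 'e::complex_inner) set \<Rightarrow> (('x \<Rightarrow> 'e) \<Rightarrow> ('x \<Rightarrow> 'e) \<Rightarrow> complex) \<Rightarrow>
     ('x \<Rightarrow> 'd::complex_inner) set \<Rightarrow> (('x \<Rightarrow> 'd) \<Rightarrow> ('x \<Rightarrow> 'd) \<Rightarrow> complex) \<Rightarrow>
     ('x \<Rightarrow> 'e \<Rightarrow>\<^sub>L 'd) \<Rightarrow> bool" where
  "inner_multiplier S HE ipE HD ipD \<theta> \<longleftrightarrow>
    multiplier S HE ipE HD ipD \<theta> \<and> partial_isometry HE ipE ipD (mult_op \<theta>)"

definition E_set ::
    "(complex ^ 'n::finite \<Rightarrow> 'e::real_normed_vector \<Rightarrow>\<^sub>L 'd::real_normed_vector) \<Rightarrow>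
     (complex ^ 'n) set" where
  "E_set \<theta> = {\<zeta>\<in>cball 0 1. \<exists>L. (\<theta> \<longlongrightarrow> L) (at \<zeta> within ball 0 1) \<and> \<not> surj (blinfun_apply L)}"

definition F_set ::
    "(complex ^ 'n::finite \<Rightarrow> 'e::real_normed_vector \<Rightarrow>\<^sub>L 'd::real_normed_vector) \<Rightarrow>
     (complex ^ 'n) set" where
  "F_set \<theta> = {\<zeta>\<in>cball 0 1. \<not> (\<exists>L. (\<theta> \<longlongrightarrow> L) (at \<zeta> within ball 0 1))}"


section \<open>The Taylor joint spectrum\<close>

text \<open>Complex vector spaces with explicit carrier are instances of the record \<open>module\<close>, whose
  ring multiplication and unit play no role.

  A function \<open>x\<close> from subsets of the index set to \<open>V\<close> stands for the element
  \<open>\<Sum>\<^sub>I x\<^sub>I \<otimes> e\<^sub>I\<close> of \<open>V \<otimes> \<Lambda>(\<complex>\<^sup>n)\<close>, where \<open>e\<^sub>I\<close> is the wedge product of the basis vectors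
  \<open>e\<^sub>i\<close>, \<open>i \<in> I\<close>, in increasing order. Then \<open>koszul V T\<close> is
  \<open>x \<otimes> \<omega> \<mapsto> \<Sum>\<^sub>i T\<^sub>i x \<otimes> (e\<^sub>i \<and> \<omega>)\<close>. It is homogeneous of degree 1, so that equality of its
  kernel and range is exactness of the Koszul complex in all degrees.\<close>

definition koszul ::
    "(complex, 'v, 'm) module_scheme \<Rightarrow> ('n::{finite,linorder} \<Rightarrow> 'v \<Rightarrow> 'v) \<Rightarrow>
     ('n set \<Rightarrow> 'v) \<Rightarrow> 'n set \<Rightarrow> 'v" where
  "koszul V T x = (\<lambda>I. \<Oplus>\<^bsub>V\<^esub>i\<in>I. (- 1) ^ card {j\<in>I. j < i} \<odot>\<^bsub>V\<^esub> T i (x (I - {i})))"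

definition taylor_nonsingular ::
    "(complex, 'v, 'm) module_scheme \<Rightarrow> ('n::{finite,linorder} \<Rightarrow> 'v \<Rightarrow> 'v) \<Rightarrow> bool" where
  "taylor_nonsingular V T \<longleftrightarrow>
    {x \<in> UNIV \<rightarrow> carrier V. koszul V T x = (\<lambda>_. \<zero>\<^bsub>V\<^esub>)} = koszul V T ` (UNIV \<rightarrow> carrier V)"

definition taylor_spectrum ::
    "(complex, 'v, 'm) module_scheme \<Rightarrow> ('n::{finite,linorder} \<Rightarrow> 'v \<Rightarrow> 'v) \<Rightarrow>
     (complex ^ 'n::{finite,linorder}) set" where
  "taylor_spectrum V T =
    {\<zeta>. \<not> taylor_nonsingular V (\<lambda>i v. T i v \<ominus>\<^bsub>V\<^esub> (\<zeta> $ i) \<odot>\<^bsub>V\<^esub> v)}"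

definition fun_module :: "('x \<Rightarrow> 'e::complex_vector) set \<Rightarrow> (complex, 'x \<Rightarrow> 'e) module" where
  "fun_module H =
    \<lparr>carrier = H, mult = undefined, one = undefined, zero = (\<lambda>_. 0),
     add = (\<lambda>f g x. f x + g x), smult = (\<lambda>c f x. c *\<^sub>C f x)\<rparr>"

definition quot_module ::
    "(complex, 'v, 'm) module_scheme \<Rightarrow> 'v set \<Rightarrow> (complex, 'v set) module" where
  "quot_module V M =
    \<lparr>carrier = a_rcosets\<^bsub>V\<^esub> M, mult = undefined, one = undefined, zero = M,
     add = set_add V, smult = (\<lambda>c A. \<Union>v\<in>A. M +>\<^bsub>V\<^esub> (c \<odot>\<^bsub>V\<^esub> v))\<rparr>"

text \<open>If \<open>T\<close> is linear and maps \<open>M\<close> into itself, the union is that of a single coset.\<close>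

definition quot_map ::
    "(complex, 'v, 'm) module_scheme \<Rightarrow> 'v set \<Rightarrow> ('v \<Rightarrow> 'v) \<Rightarrow> 'v set \<Rightarrow> 'v set" where
  "quot_map V M T A = (\<Union>v\<in>A. M +>\<^bsub>V\<^esub> T v)"

end

theory Submission
  imports Defs "HOL-Library.Function_Algebras"
begin

text \<open>Write \<open>\<phi> = 1 - 1/k\<close>, \<open>g\<^sub>w\<close> for the projection of \<open>k\<^sub>w d\<close> to \<open>M\<^sup>\<bottom>\<close>, and \<open>N\<^sub>w\<close> for multiplication by
  \<open>1/k(\<cdot>,w)\<close>. Let \<open>\<lambda>\<close> be outside the spectrum. Exactness of the Koszul complex in top degree says that
  the row \<open>(M\<^sub>z\<^sub>i - \<lambda>\<^sub>i)\<^sub>i\<close> is onto modulo \<open>M\<close>, so its adjoint is bounded below on \<open>M\<^sup>\<bottom>\<close>, also for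
  \<open>w\<close> near \<open>\<lambda>\<close> in place of \<open>\<lambda>\<close>. The complete Pick property gives
  \<open>b\<^sub>1 \<Sum>\<^sub>i \<parallel>(M\<^sub>z\<^sub>i - w\<^sub>i)\<^sup>* x\<parallel>\<^sup>2 \<le> 2 Re \<langle>N\<^sub>w x, x\<rangle>\<close>, and \<open>N\<^sub>w g\<^sub>w\<close> is the constant \<open>d\<close> modulo \<open>M\<close>; hence
  \<open>g\<^sub>w\<close> stays bounded as \<open>w\<close> approaches \<open>\<lambda>\<close>. As \<open>\<theta>\<close> is inner,
  \<open>\<langle>\<theta>(w)\<^sup>* d, \<theta>(z)\<^sup>* d\<rangle> = \<parallel>d\<parallel>\<^sup>2 - (1 - \<phi>(z,w)) \<langle>g\<^sub>w, g\<^sub>z\<rangle>\<close>. Since \<open>\<phi>\<close> extends continuously to the closed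
  ball, this makes \<open>\<theta>\<close> Cauchy at \<open>\<lambda>\<close>. The same lower bound, applied to \<open>g\<^sub>z\<close>, bounds
  \<open>\<theta>(z)\<^sup>*\<close> below near \<open>\<lambda>\<close>, so the limit is onto.\<close>

section \<open>Complex vector spaces\<close>

\<comment> \<open>\<open>k w w\<close> may blow up at the boundary, so the norm of
  \<open>k\<^sub>w d\<close> gives no bound on \<open>g\<^sub>w\<close>. The way out is a
  competition of degrees: coercivity and the adjoint bound make \<open>|g\<^sub>w|\<^sup>2\<close>
  at most a multiple of \<open>Re \<langle>N\<^sub>w g\<^sub>w, g\<^sub>w\<rangle>\<close>. This
  equals \<open>Re \<langle>d, g\<^sub>w\<rangle>\<close>, which is only linear in
  \<open>g\<^sub>w\<close>.

  Convergence of \<open>g\<^sub>w\<close> is never shown.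

  For the lower bound on \<open>\<theta>(z)\<^sup>*\<close>, the adjoints of
  \<open>M\<^sub>z\<^sub>i - z\<^sub>i\<close> annihilate \<open>k\<^sub>z d\<close>. So they agree
  up to sign on \<open>g\<^sub>z\<close> and on the projection of \<open>k\<^sub>z d\<close> to
  \<open>M\<close>, whose squared norm is \<open>k(z,z) |\<theta>(z)\<^sup>* d|\<^sup>2\<close>; the
  factor \<open>k(z,z)\<close> cancels in the end.

  The operator inequalities are proved on finite sums of kernel functions, where adjoints of
  multiplications act on coefficients and positivity becomes positivity of scalar kernels.\<close>
subclass (in chilbert_space) banach ..

lemma scaleC_one [simp]: "1 *\<^sub>C x = (x :: 'a::complex_vector)"
  using scaleR_scaleC[of 1 x] by simp

lemma scaleC_zero_left [simp]: "0 *\<^sub>C x = (0 :: 'a::complex_vector)"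
  using scaleC_add_left[of 0 0 x] by simp

lemma scaleC_zero_right [simp]: "c *\<^sub>C 0 = (0 :: 'a::complex_vector)"
  using scaleC_add_right[of c 0 0] by simp

lemma scaleC_minus_one: "(- 1) *\<^sub>C x = - (x :: 'a::complex_vector)"
  using scaleC_add_left[of 1 "- 1" x] by (simp add: add_eq_0_iff)

lemma scaleC_minus_right: "c *\<^sub>C (- x) = - (c *\<^sub>C (x :: 'a::complex_vector))"
  by (metis scaleC_minus_one scaleC_scaleC mult.commute)

lemma scaleC_diff_right: "c *\<^sub>C (x - y) = c *\<^sub>C x - c *\<^sub>C (y :: 'a::complex_vector)"
  using scaleC_add_right[of c x "- y"] by (simp add: scaleC_minus_right)

lemma scaleC_minus_left: "(- c) *\<^sub>C x = - (c *\<^sub>C (x :: 'a::complex_vector))"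
  by (metis mult_minus1 scaleC_minus_one scaleC_scaleC)

lemma scaleC_diff_left: "(b - c) *\<^sub>C x = b *\<^sub>C x - c *\<^sub>C (x :: 'a::complex_vector)"
  using scaleC_add_left[of b "- c" x] by (simp add: scaleC_minus_left)

text \<open>With this instance \<open>fun_subspace\<close> becomes \<open>csubspace\<close>, and the
  spaces of functions can be handled as abstract vector spaces.\<close>

instantiation "fun" :: (type, complex_vector) complex_vector
begin

definition scaleR_fun :: "real \<Rightarrow> ('a \<Rightarrow> 'b) \<Rightarrow> 'a \<Rightarrow> 'b" where
  "scaleR_fun r f = (\<lambda>x. r *\<^sub>R f x)"

definition scaleC_fun :: "complex \<Rightarrow> ('a \<Rightarrow> 'b) \<Rightarrow> 'a \<Rightarrow> 'b" where
  "scaleC_fun c f = (\<lambda>x. c *\<^sub>C f x)"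

instance
  by standard
    (simp_all add: fun_eq_iff scaleR_fun_def scaleC_fun_def scaleR_add_right scaleR_add_left
      scaleR_scaleC scaleC_add_right scaleC_add_left scaleC_scaleC)

end

lemma scaleC_fun_apply [simp]: "(c *\<^sub>C f) x = c *\<^sub>C f x"
  by (simp add: scaleC_fun_def)

definition csubspace :: "'v::complex_vector set \<Rightarrow> bool" where
  "csubspace M \<longleftrightarrow> 0 \<in> M \<and> (\<forall>f\<in>M. \<forall>g\<in>M. f + g \<in> M) \<and> (\<forall>c. \<forall>f\<in>M. c *\<^sub>C f \<in> M)"

lemma fun_subspace_csubspace: "fun_subspace M = csubspace M"
  by (simp add: fun_subspace_def csubspace_def zero_fun_def plus_fun_def scaleC_fun_def)

lemma csubspace_0: "csubspace M \<Longrightarrow> 0 \<in> M"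
  and csubspace_add: "csubspace M \<Longrightarrow> f \<in> M \<Longrightarrow> g \<in> M \<Longrightarrow> f + g \<in> M"
  and csubspace_scaleC: "csubspace M \<Longrightarrow> f \<in> M \<Longrightarrow> c *\<^sub>C f \<in> M"
  by (simp_all add: csubspace_def)

lemma csubspace_minus: "csubspace M \<Longrightarrow> f \<in> M \<Longrightarrow> - f \<in> M"
  using csubspace_scaleC[of M f "- 1"] by (simp add: scaleC_minus_one)

lemma csubspace_diff: "csubspace M \<Longrightarrow> f \<in> M \<Longrightarrow> g \<in> M \<Longrightarrow> f - g \<in> M"
  using csubspace_add[of M f "- g"] csubspace_minus[of M g] by simp

lemma csubspace_sum: "csubspace M \<Longrightarrow> (\<And>i. i \<in> I \<Longrightarrow> f i \<in> M) \<Longrightarrow> sum f I \<in> M"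
  by (induction I rule: infinite_finite_induct) (auto simp: csubspace_0 csubspace_add)


section \<open>Hilbert spaces on a carrier set\<close>

text \<open>The carrier is a set because \<open>H\<^sub>k \<otimes> E\<close> is a set of functions
  on which alone \<open>ip\<close> is meaningful. With carrier \<open>UNIV\<close> the same results
  serve the coefficient spaces.\<close>

locale chilbert_on =
  fixes H :: "'v::complex_vector set" and ip :: "'v \<Rightarrow> 'v \<Rightarrow> complex"
  assumes csub: "csubspace H"
    and ip_commute: "f \<in> H \<Longrightarrow> g \<in> H \<Longrightarrow> ip f g = cnj (ip g f)"
    and ip_add_left: "f \<in> H \<Longrightarrow> g \<in> H \<Longrightarrow> h \<in> H \<Longrightarrow> ip (f + g) h = ip f h + ip g h"
    and ip_scaleC_left: "f \<in> H \<Longrightarrow> g \<in> H \<Longrightarrow> ip (c *\<^sub>C f) g = c * ip f g"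
    and ip_nonneg: "f \<in> H \<Longrightarrow> Re (ip f f) \<ge> 0"
    and ip_definite: "f \<in> H \<Longrightarrow> ip f f = 0 \<Longrightarrow> f = 0"
    and complete: "(\<And>n. X n \<in> H) \<Longrightarrow>
       (\<And>\<epsilon>. \<epsilon> > 0 \<Longrightarrow> \<exists>N. \<forall>m\<ge>N. \<forall>n\<ge>N. hnorm ip (X m - X n) < \<epsilon>) \<Longrightarrow>
       \<exists>f\<in>H. (\<lambda>n. hnorm ip (X n - f)) \<longlonglongrightarrow> 0"
begin

lemmas H0 [simp] = csubspace_0 [OF csub]
  and Hadd [simp] = csubspace_add [OF csub]
  and Hscale [simp] = csubspace_scaleC [OF csub]
  and Hminus [simp] = csubspace_minus [OF csub]
  and Hdiff [simp] = csubspace_diff [OF csub]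
  and Hsum = csubspace_sum [OF csub]

lemma ip_add_right: "f \<in> H \<Longrightarrow> g \<in> H \<Longrightarrow> h \<in> H \<Longrightarrow> ip h (f + g) = ip h f + ip h g"
  by (metis Hadd complex_cnj_add ip_add_left ip_commute)

lemma ip_scaleC_right: "f \<in> H \<Longrightarrow> g \<in> H \<Longrightarrow> ip f (c *\<^sub>C g) = cnj c * ip f g"
  by (metis Hscale complex_cnj_mult ip_scaleC_left ip_commute)

lemma ip_zero_left [simp]: "g \<in> H \<Longrightarrow> ip 0 g = 0"
  using ip_scaleC_left[of 0 g 0] by simp

lemma ip_zero_right [simp]: "g \<in> H \<Longrightarrow> ip g 0 = 0"
  using ip_scaleC_right[of g 0 0] by simp

lemma ip_minus_left: "f \<in> H \<Longrightarrow> g \<in> H \<Longrightarrow> ip (- f) g = - ip f g"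
  using ip_scaleC_left[of f g "- 1"] by (simp add: scaleC_minus_one)

lemma ip_minus_right: "f \<in> H \<Longrightarrow> g \<in> H \<Longrightarrow> ip f (- g) = - ip f g"
  using ip_scaleC_right[of f g "- 1"] by (simp add: scaleC_minus_one)

lemma ip_diff_left: "f \<in> H \<Longrightarrow> g \<in> H \<Longrightarrow> h \<in> H \<Longrightarrow> ip (f - g) h = ip f h - ip g h"
  using ip_add_left[of f "- g" h] by (simp add: ip_minus_left)

lemma ip_diff_right: "f \<in> H \<Longrightarrow> g \<in> H \<Longrightarrow> h \<in> H \<Longrightarrow> ip h (f - g) = ip h f - ip h g"
  using ip_add_right[of f "- g" h] by (simp add: ip_minus_right)

lemma ip_sum_left:
  "finite I \<Longrightarrow> (\<And>i. i \<in> I \<Longrightarrow> f i \<in> H) \<Longrightarrow> g \<in> H \<Longrightarrow> ip (sum f I) g = (\<Sum>i\<in>I. ip (f i) g)"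
  by (induction I rule: finite_induct) (auto simp: ip_add_left Hsum)

lemmas ip_simps = ip_add_left ip_add_right ip_scaleC_left ip_scaleC_right ip_minus_left
  ip_minus_right ip_diff_left ip_diff_right

section \<open>Norm, Cauchy-Schwarz inequality and continuity of the inner product\<close>

abbreviation nrm :: "'v \<Rightarrow> real" where "nrm \<equiv> hnorm ip"

lemma ip_self: "f \<in> H \<Longrightarrow> ip f f = complex_of_real ((nrm f)\<^sup>2)"
proof -
  assume f: "f \<in> H"
  have "Im (ip f f) = 0"
    using ip_commute[OF f f] by (metis Reals_cnj_iff complex_is_Real_iff)
  then show ?thesis
    using ip_nonneg[OF f] by (simp add: hnorm_def complex_eq_iff)
qed

lemma nrm_nonneg [simp]: "f \<in> H \<Longrightarrow> nrm f \<ge> 0"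
  by (simp add: hnorm_def ip_nonneg)

lemma nrm_zero [simp]: "nrm 0 = 0"
  using ip_zero_left[OF H0] by (simp add: hnorm_def)

lemma nrm_eq_0: "f \<in> H \<Longrightarrow> nrm f = 0 \<longleftrightarrow> f = 0"
  using ip_self[of f] ip_definite[of f] by auto

lemma nrm_scaleC: "f \<in> H \<Longrightarrow> nrm (c *\<^sub>C f) = cmod c * nrm f"
proof -
  assume f: "f \<in> H"
  have "complex_of_real ((nrm (c *\<^sub>C f))\<^sup>2) = ip (c *\<^sub>C f) (c *\<^sub>C f)"
    using f by (simp add: ip_self)
  also have "\<dots> = (c * cnj c) * ip f f"
    using f by (simp add: ip_simps)
  also have "\<dots> = complex_of_real ((cmod c * nrm f)\<^sup>2)"
    using f by (simp add: ip_self power_mult_distrib complex_norm_square [symmetric])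
  finally have "(nrm (c *\<^sub>C f))\<^sup>2 = (cmod c * nrm f)\<^sup>2"
    by (metis of_real_eq_iff)
  then show ?thesis using f by simp
qed

lemma nrm_minus: "f \<in> H \<Longrightarrow> nrm (- f) = nrm f"
  using nrm_scaleC[of f "- 1"] by (simp add: scaleC_minus_one)

lemma nrm_diff_commute: "f \<in> H \<Longrightarrow> g \<in> H \<Longrightarrow> nrm (f - g) = nrm (g - f)"
  using nrm_minus[of "f - g"] by simp

lemma nrm_add_sq:
  "f \<in> H \<Longrightarrow> g \<in> H \<Longrightarrow> (nrm (f + g))\<^sup>2 = (nrm f)\<^sup>2 + (nrm g)\<^sup>2 + 2 * Re (ip f g)"
proof -
  assume f: "f \<in> H" and g: "g \<in> H"
  have "complex_of_real ((nrm (f + g))\<^sup>2) =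
    complex_of_real ((nrm f)\<^sup>2) + complex_of_real ((nrm g)\<^sup>2) + (ip f g + ip g f)"
    using f g ip_self[of "f + g"] ip_self[of f] ip_self[of g]
    by (simp add: ip_simps algebra_simps)
  from arg_cong[OF this, of Re] show ?thesis
    using ip_commute[OF g f] by simp
qed

lemma nrm_diff_sq:
  "f \<in> H \<Longrightarrow> g \<in> H \<Longrightarrow> (nrm (f - g))\<^sup>2 = (nrm f)\<^sup>2 + (nrm g)\<^sup>2 - 2 * Re (ip f g)"
  using nrm_add_sq[of f "- g"] by (simp add: nrm_minus ip_simps)

lemma Re_ip_le:
  assumes f: "f \<in> H" and g: "g \<in> H" shows "Re (ip f g) \<le> nrm f * nrm g"
proof (cases "nrm f = 0 \<or> nrm g = 0")
  case True
  then show ?thesis using f g by (auto simp: nrm_eq_0)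
next
  case False
  then have pos: "nrm f > 0" "nrm g > 0"
    using f g by (metis nrm_nonneg order_le_imp_less_or_eq)+
  let ?a = "complex_of_real (nrm g)" and ?b = "complex_of_real (nrm f)"
  have "0 \<le> (nrm (?a *\<^sub>C f - ?b *\<^sub>C g))\<^sup>2" by simp
  also have "\<dots> = 2 * (nrm f)\<^sup>2 * (nrm g)\<^sup>2 - 2 * (nrm f * nrm g * Re (ip f g))"
    using f g by (subst nrm_diff_sq) (simp_all add: nrm_scaleC ip_simps power_mult_distrib)
  finally have "nrm f * nrm g * Re (ip f g) \<le> nrm f * nrm g * (nrm f * nrm g)"
    by (simp add: power2_eq_square algebra_simps)
  then show ?thesis using pos by (simp add: mult_le_cancel_left_pos)
qed

lemma cauchy_schwarz:
  assumes f: "f \<in> H" and g: "g \<in> H" shows "cmod (ip f g) \<le> nrm f * nrm g"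
proof (cases "ip f g = 0")
  case True
  then show ?thesis using f g by simp
next
  case False
  \<comment> \<open>This unimodular factor rotates the inner product onto the positive real
    axis.\<close>
  define u where "u = cnj (sgn (ip f g))"
  have "cmod (ip f g) = Re (ip (u *\<^sub>C f) g)"
    using f g False
    by (simp add: ip_simps u_def sgn_eq complex_norm_square [symmetric] power2_eq_square
        mult.commute[of "cnj _"] flip: of_real_mult)
  also have "\<dots> \<le> nrm (u *\<^sub>C f) * nrm g"
    using f g by (intro Re_ip_le) auto
  also have "nrm (u *\<^sub>C f) = nrm f"
    using f False by (simp add: nrm_scaleC u_def norm_sgn)
  finally show ?thesis .
qed

lemma nrm_triangle:
  assumes f: "f \<in> H" and g: "g \<in> H" shows "nrm (f + g) \<le> nrm f + nrm g"
proof (rule power2_le_imp_le)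
  show "(nrm (f + g))\<^sup>2 \<le> (nrm f + nrm g)\<^sup>2"
    using Re_ip_le[OF f g] f g by (simp add: nrm_add_sq power2_sum)
qed (use f g in simp)

lemma nrm_triangle_diff:
  assumes "f \<in> H" "g \<in> H" "h \<in> H" shows "nrm (f - h) \<le> nrm (f - g) + nrm (g - h)"
  using nrm_triangle[of "f - g" "g - h"] assms by simp

lemma nrm_diff_ge:
  assumes "f \<in> H" "g \<in> H" shows "\<bar>nrm f - nrm g\<bar> \<le> nrm (f - g)"
  using nrm_triangle[of "f - g" g] nrm_triangle[of "g - f" f] nrm_diff_commute[of f g] assms
  by simp

lemma ip_tendsto_right:
  assumes "\<And>n. X n \<in> H" "x \<in> H" "y \<in> H" "(\<lambda>n. nrm (X n - x)) \<longlonglongrightarrow> 0"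
  shows "(\<lambda>n. ip y (X n)) \<longlonglongrightarrow> ip y x"
proof (rule LIM_zero_cancel, rule Lim_null_comparison)
  show "\<forall>\<^sub>F n in sequentially. cmod (ip y (X n) - ip y x) \<le> nrm y * nrm (X n - x)"
    using cauchy_schwarz[of y "X _ - x"] assms by (simp add: ip_simps)
  show "(\<lambda>n. nrm y * nrm (X n - x)) \<longlonglongrightarrow> 0"
    using tendsto_mult_right_zero[OF assms(4)] by simp
qed

lemma ip_tendsto_left:
  assumes "\<And>n. X n \<in> H" "x \<in> H" "y \<in> H" "(\<lambda>n. nrm (X n - x)) \<longlonglongrightarrow> 0"
  shows "(\<lambda>n. ip (X n) y) \<longlonglongrightarrow> ip x y"
  using tendsto_cnj[OF ip_tendsto_right[OF assms]] assms
  by (simp add: ip_commute[of _ y])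

lemma nrm_tendsto:
  assumes "\<And>n. X n \<in> H" "x \<in> H" "(\<lambda>n. nrm (X n - x)) \<longlonglongrightarrow> 0"
  shows "(\<lambda>n. nrm (X n)) \<longlonglongrightarrow> nrm x"
  by (rule LIM_zero_cancel, rule Lim_null_comparison[OF _ assms(3)])
    (use nrm_diff_ge assms in auto)

lemma ip_tendsto:
  assumes X: "\<And>n. X n \<in> H" "x \<in> H" "(\<lambda>n. nrm (X n - x)) \<longlonglongrightarrow> 0"
    and Y: "\<And>n. Y n \<in> H" "y \<in> H" "(\<lambda>n. nrm (Y n - y)) \<longlonglongrightarrow> 0"
  shows "(\<lambda>n. ip (X n) (Y n)) \<longlonglongrightarrow> ip x y"
proof (rule LIM_zero_cancel, rule Lim_null_comparison)
  show "\<forall>\<^sub>F n in sequentially. cmod (ip (X n) (Y n) - ip x y) \<le>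
      nrm (X n) * nrm (Y n - y) + nrm (X n - x) * nrm y"
  proof (rule always_eventually, rule allI)
    fix n
    have "ip (X n) (Y n) - ip x y = ip (X n) (Y n - y) + ip (X n - x) y"
      using X Y by (simp add: ip_simps)
    then show "cmod (ip (X n) (Y n) - ip x y) \<le> nrm (X n) * nrm (Y n - y) + nrm (X n - x) * nrm y"
      using cauchy_schwarz[of "X n" "Y n - y"] cauchy_schwarz[of "X n - x" y] X Y
        norm_triangle_ineq[of "ip (X n) (Y n - y)" "ip (X n - x) y"] by simp
  qed
  have "(\<lambda>n. nrm (X n) * nrm (Y n - y) + nrm (X n - x) * nrm y) \<longlonglongrightarrow> nrm x * 0 + 0 * nrm y"
    using X Y by (intro tendsto_intros nrm_tendsto)
  then show "(\<lambda>n. nrm (X n) * nrm (Y n - y) + nrm (X n - x) * nrm y) \<longlonglongrightarrow> 0" by simp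
qed

text \<open>The functional is given by its graph \<open>G\<close> and need not be defined on all of \<open>H\<close>: the
  Riesz representation, the orthogonal projection and density arguments are all instances.\<close>

lemma riesz_graph:
  fixes G :: "('v \<times> complex) set"
  assumes G0: "(0, 0) \<in> G"
    and Gadd: "\<And>y l y' l'. (y, l) \<in> G \<Longrightarrow> (y', l') \<in> G \<Longrightarrow> (y + y', l + l') \<in> G"
    and Gscale: "\<And>c y l. (y, l) \<in> G \<Longrightarrow> (c *\<^sub>C y, c * l) \<in> G"
    and GH: "\<And>y l. (y, l) \<in> G \<Longrightarrow> y \<in> H"
    and bound: "\<And>y l. (y, l) \<in> G \<Longrightarrow> cmod l \<le> C * nrm y" and C: "C \<ge> 0"
  obtains x Y where "x \<in> H" "nrm x \<le> C" "\<And>n. Y n \<in> fst ` G" "(\<lambda>n. nrm (Y n - x)) \<longlonglongrightarrow> 0"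
    "\<And>y l. (y, l) \<in> G \<Longrightarrow> l = ip y x"
proof -
  \<comment> \<open>If \<open>l = ip y x\<close>, this is
    \<open>|y - x|\<^sup>2 - |x|\<^sup>2\<close>, so almost minimisers of \<open>J\<close> approach
    the representing vector.\<close>
  define J where "J = (\<lambda>(y, l). (nrm y)\<^sup>2 - 2 * Re l)"
  have "J p \<ge> - C\<^sup>2" if "p \<in> G" for p
  proof -
    obtain y l where p: "p = (y, l)" by force
    have "Re l \<le> C * nrm y"
      using bound[of y l] that complex_Re_le_cmod[of l] by (simp add: p)
    moreover have "0 \<le> (nrm y - C)\<^sup>2" by simp
    ultimately show ?thesis by (simp add: J_def p power2_eq_square algebra_simps)
  qed
  then have bdd: "bdd_below (J ` G)" by (intro bdd_belowI2[of _ "- C\<^sup>2"])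
  define m where "m = Inf (J ` G)"
  have mle: "m \<le> J p" if "p \<in> G" for p
    unfolding m_def using bdd that by (intro cInf_lower) auto
  have "\<exists>p\<in>G. J p < m + 1 / Suc n" for n
  proof -
    have "Inf (J ` G) < m + 1 / Suc n" by (simp add: m_def)
    then show ?thesis using bdd G0 by (subst (asm) cInf_less_iff) auto
  qed
  then obtain P where P: "P n \<in> G" "J (P n) < m + 1 / Suc n" for n by metis
  define Y where "Y n = fst (P n)" for n
  define L where "L n = snd (P n)" for n
  have YG: "(Y n, L n) \<in> G" for n using P by (simp add: Y_def L_def)
  have YH: "Y n \<in> H" for n using GH YG by blast
  have JY: "(nrm (Y n))\<^sup>2 - 2 * Re (L n) < m + 1 / Suc n" for n
    using P(2)[of n] by (simp add: J_def Y_def L_def split_beta)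
  have est: "(nrm (Y i - Y j))\<^sup>2 \<le> 2 / Suc i + 2 / Suc j" for i j
  proof -
    \<comment> \<open>At the midpoint \<open>J\<close> is still at least \<open>m\<close>. By the
      parallelogram law, two almost minimisers are then close to each other.\<close>
    have "((1/2) *\<^sub>C (Y i + Y j), (1/2) * (L i + L j)) \<in> G"
      using YG Gadd Gscale by blast
    from mle[OF this] have "4 * m \<le> (nrm (Y i + Y j))\<^sup>2 - 4 * Re (L i) - 4 * Re (L j)"
      using YH by (simp add: J_def nrm_scaleC field_simps)
    moreover have "(nrm (Y i + Y j))\<^sup>2 + (nrm (Y i - Y j))\<^sup>2 = 2 * (nrm (Y i))\<^sup>2 + 2 * (nrm (Y j))\<^sup>2"
      using YH by (simp add: nrm_add_sq nrm_diff_sq)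
    ultimately show ?thesis using JY[of i] JY[of j] by simp
  qed
  have "\<exists>N. \<forall>i\<ge>N. \<forall>j\<ge>N. nrm (Y i - Y j) < e" if e: "e > 0" for e
  proof -
    obtain N where N: "1 / Suc N < e\<^sup>2 / 4"
      using e reals_Archimedean[of "e\<^sup>2 / 4"] by (auto simp: inverse_eq_divide)
    have "nrm (Y i - Y j) < e" if "i \<ge> N" "j \<ge> N" for i j
    proof (rule power2_less_imp_less)
      have "2 / real (Suc i) \<le> 2 / Suc N" "2 / real (Suc j) \<le> 2 / Suc N"
        using that by (auto intro!: divide_left_mono)
      moreover have "2 / Suc N < e\<^sup>2 / 2" using N by simp
      ultimately show "(nrm (Y i - Y j))\<^sup>2 < e\<^sup>2"
        using est[of i j] by linarith
    qed (use e in simp)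
    then show ?thesis by blast
  qed
  then obtain x where x: "x \<in> H" "(\<lambda>n. nrm (Y n - x)) \<longlonglongrightarrow> 0"
    using complete[of Y] YH by blast
  have rep: "l = ip y x" if yl: "(y, l) \<in> G" for y l
  proof -
    have y: "y \<in> H" using GH yl .
    \<comment> \<open>Moving \<open>Y n\<close> along \<open>c *\<^sub>C y\<close> lowers
      \<open>J\<close> by less than \<open>1 / Suc n\<close>; this variational inequality survives
      the limit.\<close>
    have main: "2 * Re (c * (l - ip y x)) \<le> (cmod c * nrm y)\<^sup>2" for c
    proof (rule LIMSEQ_le_const2)
      have "(\<lambda>n. 2 * Re (c * (l - ip y (Y n))) - 1 / Suc n) \<longlonglongrightarrow> 2 * Re (c * (l - ip y x)) - 0"
        using ip_tendsto_right[OF YH x(1) y x(2)] LIMSEQ_inverse_real_of_nat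
        unfolding inverse_eq_divide by (intro tendsto_intros)
      then show "(\<lambda>n. 2 * Re (c * (l - ip y (Y n))) - 1 / Suc n) \<longlonglongrightarrow> 2 * Re (c * (l - ip y x))"
        by simp
      show "\<exists>N. \<forall>n\<ge>N. 2 * Re (c * (l - ip y (Y n))) - 1 / Suc n \<le> (cmod c * nrm y)\<^sup>2"
      proof (intro exI allI impI)
        fix n
        have "(Y n + c *\<^sub>C y, L n + c * l) \<in> G"
          using YG yl Gadd Gscale by blast
        from mle[OF this]
        have "m \<le> (nrm (Y n))\<^sup>2 + (cmod c * nrm y)\<^sup>2 + 2 * Re (cnj c * ip (Y n) y)
            - 2 * Re (L n + c * l)"
          using YH y by (simp add: J_def nrm_add_sq nrm_scaleC ip_simps)
        moreover have "cnj c * ip (Y n) y = cnj (c * ip y (Y n))"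
          using YH[of n] y by (simp add: ip_commute[of "Y n" y])
        ultimately show "2 * Re (c * (l - ip y (Y n))) - 1 / Suc n \<le> (cmod c * nrm y)\<^sup>2"
          using JY[of n] by (simp add: algebra_simps)
      qed
    qed
    define a where "a = l - ip y x"
    \<comment> \<open>With \<open>c = t * cnj a\<close> the left side of \<open>main\<close> is
      \<open>2 * t * |a|\<^sup>2\<close>. This \<open>t\<close> is small enough to keep the right
      side below \<open>t * |a|\<^sup>2\<close>, which forces \<open>a = 0\<close>.\<close>
    define t where "t = 1 / (1 + (nrm y)\<^sup>2)"
    have t: "t > 0" "t * (nrm y)\<^sup>2 \<le> 1"
      by (auto simp: t_def divide_simps add_pos_nonneg intro: add_pos_nonneg)
    have E: "complex_of_real t * cnj a * (l - ip y x) = complex_of_real (t * (cmod a)\<^sup>2)"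
      using complex_norm_square[of a] unfolding a_def [symmetric] by (simp add: mult_ac)
    then have "2 * (t * (cmod a)\<^sup>2) \<le> (t * cmod a * nrm y)\<^sup>2"
      using main[of "complex_of_real t * cnj a"] t unfolding E by (simp add: norm_mult)
    also have "\<dots> = (t * (nrm y)\<^sup>2) * (t * (cmod a)\<^sup>2)"
      by (simp add: power2_eq_square)
    also have "\<dots> \<le> 1 * (t * (cmod a)\<^sup>2)"
      using t by (intro mult_right_mono) auto
    finally have "t * (cmod a)\<^sup>2 \<le> 0" by simp
    then have "a = 0" using t by (simp add: mult_le_0_iff)
    then show ?thesis by (simp add: a_def)
  qed
  \<comment> \<open>The bound \<open>C\<close> holds at each \<open>Y n\<close>; letting
    \<open>Y n\<close> tend to \<open>x\<close> turns it into a bound on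
    \<open>nrm x\<close>.\<close>
  have "cmod (ip (Y n) x) \<le> C * nrm (Y n)" for n
    using bound[OF YG[of n]] rep[OF YG[of n]] by simp
  then have "cmod (ip x x) \<le> C * nrm x"
    using ip_tendsto_left[OF YH x(1) x(1) x(2)] nrm_tendsto[OF YH x]
    by (intro LIMSEQ_le[OF tendsto_norm tendsto_mult_left]) auto
  then have "nrm x * nrm x \<le> C * nrm x"
    using x by (simp add: ip_self norm_power norm_mult power2_eq_square)
  then have xC: "nrm x \<le> C"
    using C nrm_nonneg[OF x(1)] by (cases "nrm x = 0") (auto simp: mult_le_cancel_right)
  show thesis
    by (rule that[of x Y]) (use x xC rep YG in \<open>force+\<close>)
qed

section \<open>Closed subspaces, orthogonal projection and uniform boundedness\<close>

definition closed_in :: "'v set \<Rightarrow> bool" where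
  "closed_in M \<longleftrightarrow> M \<subseteq> H \<and> csubspace M \<and>
    (\<forall>X f. (\<forall>n. X n \<in> M) \<and> f \<in> H \<and> (\<lambda>n. nrm (X n - f)) \<longlonglongrightarrow> 0 \<longrightarrow> f \<in> M)"

text \<open>The functional \<open>ip _ h\<close> is represented on \<open>M\<close> alone. Its
  representing vector is a limit of elements of \<open>M\<close>, hence lies in \<open>M\<close>,
  and it is the projection.\<close>

lemma projection:
  assumes M: "closed_in M" and h: "h \<in> H"
  obtains p where "p \<in> M" "\<And>m. m \<in> M \<Longrightarrow> ip m (h - p) = 0"
proof -
  have MH: "M \<subseteq> H" and Ms: "csubspace M" using M by (auto simp: closed_in_def)
  define G where "G = (\<lambda>y. (y, ip y h)) ` M"
  obtain x Y where x: "x \<in> H" "nrm x \<le> nrm h" "\<And>n. Y n \<in> fst ` G" "(\<lambda>n. nrm (Y n - x)) \<longlonglongrightarrow> 0"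
    "\<And>y l. (y, l) \<in> G \<Longrightarrow> l = ip y x"
  proof (rule riesz_graph[of G "nrm h"])
    show "cmod l \<le> nrm h * nrm y" if "(y, l) \<in> G" for y l
      using that cauchy_schwarz[of y h] MH h by (auto simp: G_def mult.commute)
    show "(0, 0) \<in> G"
      using Ms h by (auto simp: G_def csubspace_0 intro!: image_eqI[of _ _ 0])
  qed (use Ms MH h in \<open>auto simp: G_def csubspace_def ip_simps subset_iff\<close>)
  have "x \<in> M"
  proof -
    have "Y n \<in> M" for n using x(3)[of n] by (auto simp: G_def)
    then show ?thesis using M x(1,4) unfolding closed_in_def by blast
  qed
  moreover have "ip m (h - x) = 0" if "m \<in> M" for m
    using x(1) x(5)[of m "ip m h"] that MH h by (auto simp: G_def ip_simps subset_iff)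
  ultimately show thesis using that by blast
qed

text \<open>A gliding hump. Given \<open>x n\<close> of norm above \<open>4 ^ n\<close>, the n-th
  step has length \<open>1 / (3 * 3 ^ n)\<close> and goes along or against \<open>x n\<close>. The
  steps add up to a vector whose inner products with the \<open>x n\<close> grow at least like
  \<open>(4/3) ^ n\<close>.\<close>

lemma uniform_boundedness:
  assumes XH: "X \<subseteq> H" and bdd: "\<And>h. h \<in> H \<Longrightarrow> \<exists>B. \<forall>x\<in>X. cmod (ip h x) \<le> B"
  shows "\<exists>C. \<forall>x\<in>X. nrm x \<le> C"
proof (rule ccontr)
  assume "\<not> ?thesis"
  then have "\<forall>n. \<exists>x\<in>X. nrm x > 4 ^ n" by (meson not_le)
  then obtain x where x: "x n \<in> X" "nrm (x n) > 4 ^ n" for n by metis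
  have xH: "x n \<in> H" for n using x XH by blast
  define s where "s n = 3 * 3 ^ n * nrm (x n)" for n
  have nx: "nrm (x n) > 0" for n using x(2)[of n] by (meson less_trans zero_less_numeral zero_less_power)
  have "\<exists>h. \<forall>n. h n \<in> H \<and> nrm (h (Suc n) - h n) \<le> 1 / (3 * 3 ^ n) \<and>
      nrm (x n) / (3 * 3 ^ n) \<le> cmod (ip (h (Suc n)) (x n))"
  proof (rule dependent_nat_choice[of "\<lambda>_ h. h \<in> H" "\<lambda>n h h'. nrm (h' - h) \<le> 1 / (3 * 3 ^ n) \<and>
      nrm (x n) / (3 * 3 ^ n) \<le> cmod (ip h' (x n))"])
    show "\<exists>h. h \<in> H" using H0 by blast
  next
    fix h n assume h: "h \<in> H"
    define u where "u = complex_of_real (1 / s n) *\<^sub>C x n"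
    have u: "u \<in> H" "nrm u = 1 / (3 * 3 ^ n)"
      using xH nx[of n] by (auto simp: u_def nrm_scaleC s_def norm_divide norm_mult norm_power)
    have iu: "cmod (ip u (x n)) = nrm (x n) / (3 * 3 ^ n)"
      using xH nx[of n]
      by (simp add: u_def ip_simps ip_self s_def norm_divide norm_mult norm_power power2_eq_square)
    let ?a = "ip h (x n)" and ?b = "ip u (x n)"
    \<comment> \<open>The two candidates differ by \<open>2 * ?b\<close>, so at least one sign
      leaves an inner product as large as that of the step itself.\<close>
    have "cmod ?b \<le> cmod (?a + ?b) \<or> cmod ?b \<le> cmod (?a - ?b)"
    proof (rule ccontr)
      assume "\<not> ?thesis"
      then have "cmod ((?a + ?b) - (?a - ?b)) < 2 * cmod ?b"
        using norm_triangle_ineq4[of "?a + ?b" "?a - ?b"] by linarith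
      then show False by (simp add: norm_mult flip: mult_2)
    qed
    then show "\<exists>h'. h' \<in> H \<and> nrm (h' - h) \<le> 1 / (3 * 3 ^ n) \<and>
        nrm (x n) / (3 * 3 ^ n) \<le> cmod (ip h' (x n))"
    proof
      assume "cmod ?b \<le> cmod (?a + ?b)"
      then show ?thesis using h u iu xH[of n]
        by (intro exI[of _ "h + u"]) (simp add: ip_simps)
    next
      assume "cmod ?b \<le> cmod (?a - ?b)"
      then show ?thesis using h u iu xH[of n]
        by (intro exI[of _ "h - u"]) (simp add: ip_simps nrm_minus)
    qed
  qed
  then obtain h where h: "h n \<in> H" "nrm (h (Suc n) - h n) \<le> 1 / (3 * 3 ^ n)"
    "nrm (x n) / (3 * 3 ^ n) \<le> cmod (ip (h (Suc n)) (x n))" for n by blast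
  have tail: "nrm (h (n + j) - h n) \<le> (1 - 1 / 3 ^ j) / (2 * 3 ^ n)" for n j
  proof (induction j)
    case 0
    then show ?case by simp
  next
    case (Suc j)
    have "nrm (h (n + Suc j) - h n) \<le> nrm (h (Suc (n + j)) - h (n + j)) + nrm (h (n + j) - h n)"
      using nrm_triangle_diff[of "h (Suc (n + j))" "h (n + j)" "h n"] h(1) by simp
    also have "\<dots> \<le> 1 / (3 * 3 ^ (n + j)) + (1 - 1 / 3 ^ j) / (2 * 3 ^ n)"
      using h(2)[of "n + j"] Suc.IH by linarith
    also have "\<dots> = (1 - 1 / 3 ^ Suc j) / (2 * 3 ^ n)"
      by (simp add: field_simps power_add)
    finally show ?case .
  qed
  have tail': "nrm (h m - h n) \<le> 1 / (2 * 3 ^ n)" if "m \<ge> n" for m n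
  proof -
    have "(1 - 1 / 3 ^ (m - n)) / (2 * 3 ^ n) \<le> 1 / (2 * 3 ^ n :: real)"
      by (intro divide_right_mono) auto
    then show ?thesis using tail[of n "m - n"] that by simp
  qed
  have "\<exists>N. \<forall>m\<ge>N. \<forall>n\<ge>N. nrm (h m - h n) < e" if e: "e > 0" for e
  proof -
    obtain N where "(1 / 3 :: real) ^ N < e"
      using real_arch_pow_inv[of e "1/3"] e by auto
    then have N: "1 / 3 ^ N < e" by (simp add: power_one_over)
    have "nrm (h m - h n) < e" if "m \<ge> N" "n \<ge> N" for m n
    proof -
      have "nrm (h m - h n) \<le> nrm (h m - h N) + nrm (h n - h N)"
        using nrm_triangle_diff[of "h m" "h N" "h n"] nrm_diff_commute[of "h N" "h n"] h(1) by simp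
      also have "\<dots> \<le> 1 / (2 * 3 ^ N) + 1 / (2 * 3 ^ N)"
        using tail' that by (intro add_mono) auto
      finally show ?thesis using N by simp
    qed
    then show ?thesis by blast
  qed
  then obtain f where f: "f \<in> H" "(\<lambda>n. nrm (h n - f)) \<longlonglongrightarrow> 0"
    using complete[of h] h(1) by blast
  have near: "nrm (f - h n) \<le> 1 / (2 * 3 ^ n)" for n
  proof -
    have "(\<lambda>m. nrm (h m - h n)) \<longlonglongrightarrow> nrm (f - h n)"
      using f h(1) by (intro nrm_tendsto) auto
    then show ?thesis
      using tail'[of n] by (intro LIMSEQ_le_const2) auto
  qed
  obtain B where B: "\<And>y. y \<in> X \<Longrightarrow> cmod (ip f y) \<le> B" using bdd[OF f(1)] by blast
  \<comment> \<open>All steps after the n-th together change the inner product with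
    \<open>x n\<close> by at most half of what step n secured.\<close>
  have "(4 / 3) ^ n \<le> 6 * B" for n :: nat
  proof -
    have "nrm (x n) / (3 * 3 ^ n) \<le> cmod (ip (h (Suc n)) (x n))" by (rule h)
    also have "\<dots> \<le> cmod (ip f (x n)) + cmod (ip (f - h (Suc n)) (x n))"
      using norm_triangle_ineq4[of "ip f (x n)" "ip (f - h (Suc n)) (x n)"] f h xH
      by (simp add: ip_simps)
    also have "\<dots> \<le> B + nrm (x n) / (6 * 3 ^ n)"
    proof (intro add_mono)
      show "cmod (ip f (x n)) \<le> B" using B x by blast
      have "cmod (ip (f - h (Suc n)) (x n)) \<le> nrm (f - h (Suc n)) * nrm (x n)"
        using f h xH by (intro cauchy_schwarz) auto
      also have "\<dots> \<le> 1 / (2 * 3 ^ Suc n) * nrm (x n)"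
        using near[of "Suc n"] xH by (intro mult_right_mono) auto
      finally show "cmod (ip (f - h (Suc n)) (x n)) \<le> nrm (x n) / (6 * 3 ^ n)" by simp
    qed
    finally have "nrm (x n) / (6 * 3 ^ n) \<le> B" by (simp add: field_simps)
    then have "nrm (x n) \<le> 6 * B * 3 ^ n" by (simp add: field_simps)
    then have "4 ^ n \<le> 6 * B * 3 ^ n" using x(2)[of n] by linarith
    then show ?thesis by (simp add: field_simps)
  qed
  moreover obtain n where "(4 / 3 :: real) ^ n > 6 * B"
    using real_arch_pow[of "4/3" "6 * B"] by auto
  ultimately show False by (meson not_le)
qed

end

text \<open>Makes Cauchy-Schwarz and \<open>riesz_graph\<close> available in the coefficient spaces,
  where the adjoint of the limit operator is constructed.\<close>

lemma chilbert_on_UNIV: "chilbert_on (UNIV :: 'a::chilbert_space set) cinner"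
  and hnorm_cinner: "hnorm cinner (x :: 'a) = norm x"
proof -
  have hn: "hnorm cinner x = norm x" for x :: 'a
    by (simp add: hnorm_def cinner_self)
  show "hnorm cinner (x :: 'a) = norm x" by (rule hn)
  show "chilbert_on (UNIV :: 'a set) cinner"
  proof
    fix X :: "nat \<Rightarrow> 'a"
    assume "\<And>\<epsilon>. \<epsilon> > 0 \<Longrightarrow> \<exists>N. \<forall>m\<ge>N. \<forall>n\<ge>N. hnorm cinner (X m - X n) < \<epsilon>"
    then have "Cauchy X" by (auto simp: Cauchy_def hn dist_norm)
    then obtain f where "X \<longlonglongrightarrow> f" using Cauchy_convergent convergent_def by blast
    then show "\<exists>f\<in>UNIV. (\<lambda>n. hnorm cinner (X n - f)) \<longlonglongrightarrow> 0"
      by (auto simp: hn tendsto_norm_zero_iff intro: LIM_zero)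
  qed (auto simp: cinner_add_left cinner_scaleC_left cinner_self csubspace_def
      intro: cinner_commute)
qed


section \<open>Kernel functions and quadratic forms\<close>

lemma cinner_scaleC_right: "cinner x (c *\<^sub>C y) = cnj c * cinner x y"
  by (metis cinner_commute cinner_scaleC_left complex_cnj_mult)

lemma cinner_zero_left [simp]: "cinner 0 x = 0"
  using cinner_scaleC_left[of 0 0 x] by simp

lemma cinner_zero_right [simp]: "cinner x 0 = 0"
  using cinner_commute[of x 0] by simp

lemma cinner_add_right: "cinner x (y + z) = cinner x y + cinner x z"
  by (metis cinner_add_left cinner_commute complex_cnj_add)

lemma cinner_sum_list_left: "cinner (\<Sum>y\<leftarrow>ys. f y) d = (\<Sum>y\<leftarrow>ys. cinner (f y) d)"
  by (induction ys) (simp_all add: cinner_add_left)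

lemma cinner_sum_list_right: "cinner d (\<Sum>y\<leftarrow>ys. f y) = (\<Sum>y\<leftarrow>ys. cinner d (f y))"
  by (induction ys) (simp_all add: cinner_add_right)

lemma cinner_ext:
  assumes "\<And>e. cinner x e = cinner y e" shows "x = (y :: 'a::chilbert_space)"
proof -
  interpret chilbert_on "UNIV :: 'a set" cinner by (rule chilbert_on_UNIV)
  have "cinner (x - y) (x - y) = 0" using assms by (simp add: ip_diff_left)
  then show ?thesis using ip_definite[of "x - y"] by simp
qed

lemma sum_list_fun_apply: "sum_list fs x = (\<Sum>f\<leftarrow>fs. f x)"
  by (induction fs) auto

lemma scaleC_sum_list: "c *\<^sub>C sum_list xs = (\<Sum>x\<leftarrow>xs. c *\<^sub>C (x :: 'a::complex_vector))"
  by (induction xs) (auto simp: scaleC_add_right)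

lemma tendsto_sum_list:
  fixes g :: "'a \<Rightarrow> 'b::topological_monoid_add"
  assumes "\<And>x. x \<in> set xs \<Longrightarrow> ((\<lambda>n. f n x) \<longlongrightarrow> g x) F"
  shows "((\<lambda>n. \<Sum>x\<leftarrow>xs. f n x) \<longlongrightarrow> (\<Sum>x\<leftarrow>xs. g x)) F"
  using assms
proof (induction xs)
  case (Cons a xs)
  then show ?case by (simp add: tendsto_add)
qed simp

definition pmul :: "('x \<Rightarrow> complex) \<Rightarrow> ('x \<Rightarrow> 'e::complex_vector) \<Rightarrow> 'x \<Rightarrow> 'e" where
  "pmul p f = (\<lambda>z. p z *\<^sub>C f z)"

lemma pmul_apply [simp]: "pmul p f z = p z *\<^sub>C f z"
  by (simp add: pmul_def)

lemma pmul_diff: "pmul p (f - g) = pmul p f - pmul p g"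
  by (simp add: fun_eq_iff scaleC_diff_right)

text \<open>Gram kernels of maps \<Psi> into a finite-dimensional space, with \<open>fs\<close>
  listing the coordinates of \<Psi>. Kernels given by power series are reached as pointwise limits
  of these.\<close>

definition finite_rank_psd :: "('x \<Rightarrow> 'x \<Rightarrow> complex) \<Rightarrow> bool" where
  "finite_rank_psd L \<longleftrightarrow> (\<exists>fs. \<forall>u z. L u z = (\<Sum>f\<leftarrow>fs. f u * cnj (f z)))"

lemma finite_rank_psdI: "(\<And>u z. L u z = (\<Sum>f\<leftarrow>fs. f u * cnj (f z))) \<Longrightarrow> finite_rank_psd L"
  by (auto simp: finite_rank_psd_def)

lemma finite_rank_psd_0: "finite_rank_psd (\<lambda>u z. 0)"
  by (rule finite_rank_psdI[of _ "[]"]) simp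

lemma finite_rank_psd_1: "finite_rank_psd (\<lambda>u z. 1)"
  by (rule finite_rank_psdI[of _ "[\<lambda>_. 1]"]) simp

lemma finite_rank_psd_prod: "finite_rank_psd (\<lambda>u z. p u * cnj (p z))"
  by (rule finite_rank_psdI[of _ "[p]"]) simp

lemma finite_rank_psd_add:
  assumes "finite_rank_psd L" "finite_rank_psd L'"
  shows "finite_rank_psd (\<lambda>u z. L u z + L' u z)"
proof -
  obtain fs gs where "\<forall>u z. L u z = (\<Sum>f\<leftarrow>fs. f u * cnj (f z))"
    "\<forall>u z. L' u z = (\<Sum>f\<leftarrow>gs. f u * cnj (f z))"
    using assms by (auto simp: finite_rank_psd_def)
  then show ?thesis by (intro finite_rank_psdI[of _ "fs @ gs"]) simp
qed

lemma finite_rank_psd_sum: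
  assumes "\<And>i. i \<in> I \<Longrightarrow> finite_rank_psd (L i)"
  shows "finite_rank_psd (\<lambda>u z. \<Sum>i\<in>I. L i u z)"
  using assms
  by (induction I rule: infinite_finite_induct)
    (auto intro: finite_rank_psd_0 finite_rank_psd_add)

text \<open>Schur's product theorem: the pairwise products of the coordinates are coordinates for
  the product kernel.\<close>

lemma finite_rank_psd_mult:
  assumes "finite_rank_psd L" "finite_rank_psd L'"
  shows "finite_rank_psd (\<lambda>u z. L u z * L' u z)"
proof -
  obtain fs gs where L: "\<forall>u z. L u z = (\<Sum>f\<leftarrow>fs. f u * cnj (f z))"
    "\<forall>u z. L' u z = (\<Sum>f\<leftarrow>gs. f u * cnj (f z))"
    using assms by (auto simp: finite_rank_psd_def)
  have *: "(\<Sum>f\<leftarrow>map (\<lambda>g u. h u * g u) gs. f u * cnj (f z)) =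
      h u * cnj (h z) * (\<Sum>g\<leftarrow>gs. g u * cnj (g z))" for h u z
    by (induction gs) (auto simp: algebra_simps)
  have "(\<Sum>f\<leftarrow>concat (map (\<lambda>h. map (\<lambda>g u. h u * g u) gs) fs). f u * cnj (f z)) =
      (\<Sum>f\<leftarrow>fs. f u * cnj (f z)) * (\<Sum>g\<leftarrow>gs. g u * cnj (g z))" for u z
    by (induction fs) (use * in \<open>auto simp: algebra_simps\<close>)
  then show ?thesis
    unfolding L[rule_format] by (rule finite_rank_psdI[OF sym])
qed

lemma finite_rank_psd_power:
  "finite_rank_psd L \<Longrightarrow> finite_rank_psd (\<lambda>u z. L u z ^ n)"
  by (induction n) (auto intro: finite_rank_psd_1 finite_rank_psd_mult)

lemma finite_rank_psd_scale:
  assumes "finite_rank_psd L" "(c::real) \<ge> 0"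
  shows "finite_rank_psd (\<lambda>u z. complex_of_real c * L u z)"
proof -
  have "finite_rank_psd (\<lambda>u z. complex_of_real (sqrt c) * cnj (complex_of_real (sqrt c)))"
    by (rule finite_rank_psd_prod)
  then show ?thesis
    using finite_rank_psd_mult[OF _ assms(1)] assms(2) by (auto simp flip: of_real_mult)
qed

lemma finite_rank_psd_cinner: "finite_rank_psd (\<lambda>u z :: complex ^ 'n::finite. cinner u z)"
  unfolding cinner_vec_def cinner_complex_def
  by (intro finite_rank_psd_sum finite_rank_psd_prod)

text \<open>If \<open>L\<close> is the Gram kernel of \<Psi>, this is the Gram kernel of
  \<open>\<Psi> u - \<Psi> w\<close>.\<close>

lemma finite_rank_psd_center:
  assumes "finite_rank_psd L"
  shows "finite_rank_psd (\<lambda>u z. L u z - L u w - L w z + L w w)"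
proof -
  obtain fs where L: "\<forall>u z. L u z = (\<Sum>f\<leftarrow>fs. f u * cnj (f z))"
    using assms by (auto simp: finite_rank_psd_def)
  have "(\<Sum>f\<leftarrow>fs. f u * cnj (f z)) - (\<Sum>f\<leftarrow>fs. f u * cnj (f w)) - (\<Sum>f\<leftarrow>fs. f w * cnj (f z))
      + (\<Sum>f\<leftarrow>fs. f w * cnj (f w)) =
      (\<Sum>f\<leftarrow>map (\<lambda>f u. f u - f w) fs. f u * cnj (f z))" for u z
    by (induction fs) (auto simp: algebra_simps)
  then show ?thesis unfolding L[rule_format] by (rule finite_rank_psdI)
qed

text \<open>The Gram matrix of the vectors \<open>\<Psi> u - \<langle>\<Psi> u, \<Psi> w\<rangle> \<Psi> w\<close>, if \<open>L\<close> is that of \<open>\<Psi>\<close>.\<close>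

lemma finite_rank_psd_project:
  assumes "finite_rank_psd L"
  shows "finite_rank_psd (\<lambda>u z. L u z - (2 - L w w) * (L u w * cnj (L z w)))"
proof -
  obtain fs where L: "\<forall>u z. L u z = (\<Sum>f\<leftarrow>fs. f u * cnj (f z))"
    using assms by (auto simp: finite_rank_psd_def)
  define F where "F u f = f u - f w * L u w" for u f
  have expand: "(\<Sum>f\<leftarrow>fs. (f u - f w * P) * cnj (f z - f w * Q)) =
      (\<Sum>f\<leftarrow>fs. f u * cnj (f z)) - cnj Q * (\<Sum>f\<leftarrow>fs. f u * cnj (f w))
      - P * (\<Sum>f\<leftarrow>fs. f w * cnj (f z)) + P * cnj Q * (\<Sum>f\<leftarrow>fs. f w * cnj (f w))" for u z P Q
    by (induction fs) (auto simp: algebra_simps)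
  have L': "L w z = cnj (L z w)" for z
    unfolding L[rule_format] by (induction fs) (auto simp: mult.commute)
  have alg: "X - c * P - P * c + P * c * D = X - (2 - D) * (P * c)" for X c P D :: complex
    by (simp add: algebra_simps)
  have "(\<Sum>f\<leftarrow>map (\<lambda>f u. F u f) fs. f u * cnj (f z)) = (\<Sum>f\<leftarrow>fs. F u f * cnj (F z f))" for u z
    by (simp only: map_map o_def)
  also have "(\<Sum>f\<leftarrow>fs. F u f * cnj (F z f)) = L u z - (2 - L w w) * (L u w * cnj (L z w))" for u z
    unfolding F_def expand L[rule_format, symmetric] L'[of z] by (rule alg)
  finally show ?thesis by (rule finite_rank_psdI[OF sym])
qed


section \<open>Finite sums of kernel functions, membership and multiplication in a reproducing
  kernel space\<close>

context vv_rkhs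
begin

sublocale hs?: chilbert_on H ip
proof
  show "csubspace H" using subspace by (simp add: fun_subspace_csubspace)
  show "ip (f + g) h = ip f h + ip g h" if "f \<in> H" "g \<in> H" "h \<in> H" for f g h
    using ip_add_left that by (simp add: plus_fun_def)
  show "ip (c *\<^sub>C f) g = c * ip f g" if "f \<in> H" "g \<in> H" for f g c
    using ip_scaleC_left that by (simp add: scaleC_fun_def)
  show "f = 0" if "f \<in> H" "ip f f = 0" for f
    using ip_definite that by (simp add: zero_fun_def)
  show "\<exists>f\<in>H. (\<lambda>n. hnorm ip (X n - f)) \<longlonglongrightarrow> 0" if "\<And>n. X n \<in> H"
    "\<And>\<epsilon>. \<epsilon> > 0 \<Longrightarrow> \<exists>N. \<forall>m\<ge>N. \<forall>n\<ge>N. hnorm ip (X m - X n) < \<epsilon>" for X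
    using complete that by (simp add: fun_diff_def)
qed (fact ip_commute ip_nonneg)+

lemma closed_in_iff: "closed_fun_subspace H ip M \<longleftrightarrow> closed_in M"
  by (simp add: closed_fun_subspace_def closed_in_def fun_subspace_csubspace fun_diff_def)

definition kf :: "'x \<Rightarrow> 'e \<Rightarrow> 'x \<Rightarrow> 'e" where
  "kf z e = (\<lambda>u. if u \<in> S then k u z *\<^sub>C e else 0)"

lemma kf_in [simp]: "z \<in> S \<Longrightarrow> kf z e \<in> H"
  unfolding kf_def by (rule kernel_mem)

lemma ip_kf: "f \<in> H \<Longrightarrow> z \<in> S \<Longrightarrow> ip f (kf z e) = cinner (f z) e"
  unfolding kf_def by (rule reproducing)

lemma kf_apply: "u \<in> S \<Longrightarrow> kf z e u = k u z *\<^sub>C e"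
  by (simp add: kf_def)

lemma kf_scaleC: "kf z (c *\<^sub>C e) = c *\<^sub>C kf z e"
  by (simp add: kf_def fun_eq_iff scaleC_scaleC mult.commute)

lemma nrm_kf_sq: "z \<in> S \<Longrightarrow> complex_of_real ((nrm (kf z e))\<^sup>2) = k z z * cinner e e"
  using ip_kf[of "kf z e" z e] by (simp add: ip_self kf_apply cinner_scaleC_left)

text \<open>Points may repeat in a list, so addition of vectors is concatenation and coefficients
  never have to be merged.\<close>

definition klist :: "('x \<times> 'e) list \<Rightarrow> 'x \<Rightarrow> 'e" where
  "klist xs = (\<Sum>q\<leftarrow>xs. kf (fst q) (snd q))"

definition on_S :: "('x \<times> 'e) list \<Rightarrow> bool" where
  "on_S xs \<longleftrightarrow> fst ` set xs \<subseteq> S"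

text \<open>The adjoint of multiplication by \<open>p\<close> sends \<open>kf z e\<close> to
  \<open>kf z (cnj (p z) *\<^sub>C e)\<close>. On lists this makes sense before \<open>p\<close> is
  known to be a multiplier.\<close>

definition kmul :: "('x \<Rightarrow> complex) \<Rightarrow> ('x \<times> 'e) list \<Rightarrow> ('x \<times> 'e) list" where
  "kmul p xs = map (\<lambda>q. (fst q, cnj (p (fst q)) *\<^sub>C snd q)) xs"

lemma on_S_kmul [simp]: "on_S (kmul p xs) \<longleftrightarrow> on_S xs"
  by (simp add: on_S_def kmul_def image_image)

lemma on_S_append [simp]: "on_S (xs @ ys) \<longleftrightarrow> on_S xs \<and> on_S ys"
  by (auto simp: on_S_def)

lemma klist_Nil [simp]: "klist [] = 0"
  by (simp add: klist_def zero_fun_def)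

lemma on_S_Nil [simp]: "on_S []"
  by (simp add: on_S_def)

lemma klist_in [simp]: "on_S xs \<Longrightarrow> klist xs \<in> H"
  unfolding klist_def on_S_def by (induction xs) auto

lemma klist_append: "klist (xs @ ys) = klist xs + klist ys"
  by (simp add: klist_def)

lemma klist_kmul_const: "klist (kmul (\<lambda>_. c) xs) = cnj c *\<^sub>C klist xs"
  by (simp add: klist_def kmul_def o_def kf_scaleC scaleC_sum_list)

lemma ip_klist: "f \<in> H \<Longrightarrow> on_S xs \<Longrightarrow> ip f (klist xs) = (\<Sum>q\<leftarrow>xs. cinner (f (fst q)) (snd q))"
proof (induction xs)
  case Nil
  then show ?case by (simp only: klist_Nil ip_zero_right list.map sum_list.Nil)
next
  case (Cons q xs)
  have "klist (q # xs) = kf (fst q) (snd q) + klist xs" by (simp add: klist_def)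
  moreover have "on_S xs" "fst q \<in> S" using Cons.prems by (auto simp: on_S_def)
  ultimately show ?case
    using Cons by (simp only: ip_add_right ip_kf kf_in klist_in list.map sum_list.Cons)
qed

lemma fun_eqI: "f \<in> H \<Longrightarrow> g \<in> H \<Longrightarrow> (\<And>z e. z \<in> S \<Longrightarrow> cinner (f z) e = cinner (g z) e) \<Longrightarrow> f = g"
  by (metis cinner_ext ext vanish_outside)

text \<open>Representing \<open>ip _ f\<close> on the span of the kernel functions yields a limit of
  such sums. It has the same inner products with kernel functions as \<open>f\<close>, hence equals
  \<open>f\<close>.\<close>

lemma klist_dense:
  assumes f: "f \<in> H"
  obtains Xs where "\<And>n. on_S (Xs n)" "(\<lambda>n. nrm (klist (Xs n) - f)) \<longlonglongrightarrow> 0"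
proof -
  define G where "G = (\<lambda>xs. (klist xs, ip (klist xs) f)) ` {xs. on_S xs}"
  obtain x Y where x: "x \<in> H" "\<And>n. Y n \<in> fst ` G" "(\<lambda>n. nrm (Y n - x)) \<longlonglongrightarrow> 0"
    "\<And>y l. (y, l) \<in> G \<Longrightarrow> l = ip y x"
  proof (rule riesz_graph[of G "nrm f"])
    show "(0, 0) \<in> G"
      using f by (auto simp: G_def intro!: image_eqI[of _ _ "[]"])
    show "(y + y', l + l') \<in> G" if "(y, l) \<in> G" "(y', l') \<in> G" for y l y' l'
    proof -
      obtain xs ys where "on_S xs" "on_S ys" "y = klist xs" "y' = klist ys"
        "l = ip (klist xs) f" "l' = ip (klist ys) f" using \<open>(y, l) \<in> G\<close> \<open>(y', l') \<in> G\<close> by (auto simp: G_def)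
      then show ?thesis
        using f by (auto simp: G_def klist_append ip_add_left intro!: image_eqI[of _ _ "xs @ ys"])
    qed
    show "(c *\<^sub>C y, c * l) \<in> G" if "(y, l) \<in> G" for c y l
    proof -
      obtain xs where "on_S xs" "y = klist xs" "l = ip (klist xs) f"
        using \<open>(y, l) \<in> G\<close> by (auto simp: G_def)
      then show ?thesis
        using f by (auto simp: G_def klist_kmul_const ip_scaleC_left
            intro!: image_eqI[of _ _ "kmul (\<lambda>_. cnj c) xs"])
    qed
    show "cmod l \<le> nrm f * nrm y" if "(y, l) \<in> G" for y l
      using that cauchy_schwarz[of y f] f by (auto simp: G_def mult.commute)
  qed (use f in \<open>auto simp: G_def\<close>)
  have "x = f"
  proof (rule fun_eqI)
    fix z e assume z: "z \<in> S"
    have "ip (klist [(z, e)]) f = ip (klist [(z, e)]) x"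
      using z by (intro x(4)) (auto simp: G_def on_S_def intro!: image_eqI[of _ _ "[(z, e)]"])
    then have "ip x (kf z e) = ip f (kf z e)"
      using z f x(1) by (simp add: klist_def ip_commute[of _ "kf z e"])
    then show "cinner (x z) e = cinner (f z) e" using z f x(1) by (simp add: ip_kf)
  qed (use f x in auto)
  moreover have "\<forall>n. \<exists>xs. on_S xs \<and> Y n = klist xs" using x(2) by (fastforce simp: G_def)
  then obtain Xs where "\<And>n. on_S (Xs n) \<and> Y n = klist (Xs n)" by metis
  ultimately show thesis using that[of Xs] x(3) by simp
qed

text \<open>The inner product with \<open>F\<close> is a bounded functional on the span of the
  kernel functions, and its Riesz vector is \<open>F\<close>. Several lists may give the same
  vector; the bound alone makes the linear graph single-valued, so well-definedness needs no
  separate argument.\<close>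

lemma membership:
  assumes F: "\<And>z. z \<notin> S \<Longrightarrow> F z = 0" and C: "C \<ge> 0"
    and bound: "\<And>xs. on_S xs \<Longrightarrow> cmod (\<Sum>q\<leftarrow>xs. cinner (F (fst q)) (snd q)) \<le> C * nrm (klist xs)"
  shows "F \<in> H" "nrm F \<le> C"
proof -
  \<comment> \<open>The conjugate makes \<open>l\<close> linear in the vector, as \<open>F\<close>
    is to appear in the second argument of \<open>ip\<close>.\<close>
  define l where "l xs = cnj (\<Sum>q\<leftarrow>xs. cinner (F (fst q)) (snd q))" for xs
  define G where "G = (\<lambda>xs. (klist xs, l xs)) ` {xs. on_S xs}"
  have l_append: "l (xs @ ys) = l xs + l ys" for xs ys by (simp add: l_def)
  have l_kmul: "l (kmul (\<lambda>_. cnj c) xs) = c * l xs" for c xs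
    unfolding l_def kmul_def by (induction xs) (auto simp: cinner_scaleC_right algebra_simps)
  obtain x where x: "x \<in> H" "nrm x \<le> C" "\<And>y l. (y, l) \<in> G \<Longrightarrow> l = ip y x"
  proof (rule riesz_graph[of G C])
    show "(0, 0) \<in> G"
      by (auto simp: G_def l_def intro!: image_eqI[of _ _ "[]"])
    show "(y + y', m + m') \<in> G" if "(y, m) \<in> G" "(y', m') \<in> G" for y m y' m'
    proof -
      obtain xs ys where "on_S xs" "on_S ys" "y = klist xs" "y' = klist ys" "m = l xs" "m' = l ys"
        using \<open>(y, m) \<in> G\<close> \<open>(y', m') \<in> G\<close> by (auto simp: G_def)
      then show ?thesis
        by (auto simp: G_def klist_append l_append intro!: image_eqI[of _ _ "xs @ ys"])
    qed
    show "(c *\<^sub>C y, c * m) \<in> G" if "(y, m) \<in> G" for c y m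
    proof -
      obtain xs where "on_S xs" "y = klist xs" "m = l xs"
        using \<open>(y, m) \<in> G\<close> by (auto simp: G_def)
      then show ?thesis
        by (auto simp: G_def klist_kmul_const l_kmul intro!: image_eqI[of _ _ "kmul (\<lambda>_. cnj c) xs"])
    qed
  qed (use C bound in \<open>auto simp: G_def l_def\<close>)
  have "F z = x z" for z
  proof (cases "z \<in> S")
    case True
    have "cinner (F z) e = cinner (x z) e" for e
    proof -
      have "l [(z, e)] = ip (klist [(z, e)]) x"
        using True by (intro x(3)) (auto simp: G_def on_S_def intro!: image_eqI[of _ _ "[(z, e)]"])
      then have "cnj (cinner (F z) e) = cnj (ip x (kf z e))"
        using True x(1) by (simp add: klist_def l_def ip_commute[of "kf z e"])
      then show ?thesis using True x(1) by (simp add: ip_kf)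
    qed
    then show ?thesis by (rule cinner_ext)
  qed (use F vanish_outside x in auto)
  then have "F = x" by auto
  then show "F \<in> H" "nrm F \<le> C" using x by auto
qed

lemma ip_pmul_klist:
  assumes "f \<in> H" "pmul p f \<in> H" "on_S xs"
  shows "ip (pmul p f) (klist xs) = ip f (klist (kmul p xs))"
proof -
  have "(\<Sum>q\<leftarrow>xs. cinner (pmul p f (fst q)) (snd q)) =
      (\<Sum>q\<leftarrow>kmul p xs. cinner (f (fst q)) (snd q))"
    unfolding kmul_def by (induction xs) (simp_all add: cinner_scaleC_left cinner_scaleC_right)
  then show ?thesis using assms by (simp add: ip_klist)
qed

text \<open>A bound for the prospective adjoint on kernel sums bounds the functional that
  \<open>pmul p f\<close> defines, and \<open>membership\<close> applies.\<close>

lemma pmul_bounded: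
  assumes C: "C \<ge> 0" and bound: "\<And>xs. on_S xs \<Longrightarrow> nrm (klist (kmul p xs)) \<le> C * nrm (klist xs)"
    and f: "f \<in> H"
  shows "pmul p f \<in> H" "nrm (pmul p f) \<le> C * nrm f"
proof -
  have *: "cmod (\<Sum>q\<leftarrow>xs. cinner (pmul p f (fst q)) (snd q)) \<le> (C * nrm f) * nrm (klist xs)"
    if xs: "on_S xs" for xs
  proof -
    have "(\<Sum>q\<leftarrow>xs. cinner (pmul p f (fst q)) (snd q)) = ip f (klist (kmul p xs))"
    proof -
      have "(\<Sum>q\<leftarrow>xs. cinner (pmul p f (fst q)) (snd q)) =
          (\<Sum>q\<leftarrow>kmul p xs. cinner (f (fst q)) (snd q))"
        unfolding kmul_def by (induction xs) (simp_all add: cinner_scaleC_left cinner_scaleC_right)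
      then show ?thesis using f xs by (simp add: ip_klist)
    qed
    also have "cmod \<dots> \<le> nrm f * nrm (klist (kmul p xs))"
      using f xs by (intro cauchy_schwarz) auto
    also have "\<dots> \<le> nrm f * (C * nrm (klist xs))"
      using bound xs f by (intro mult_left_mono) auto
    finally show ?thesis by (simp add: mult_ac)
  qed
  have "pmul p f z = 0" if "z \<notin> S" for z using f that by (simp add: vanish_outside)
  note m = membership[of "pmul p f", OF this _ *]
  show "pmul p f \<in> H" using C f by (intro m(1)) auto
  show "nrm (pmul p f) \<le> C * nrm f" using C f by (intro m(2)) auto
qed

text \<open>The form of the kernel \<open>L u z * k u z\<close> at the points and coefficients of
  \<open>xs\<close>. For \<open>L u z = r u * cnj (p z)\<close> it is the inner product of the
  adjoints of multiplication by \<open>p\<close> and by \<open>r\<close>, applied to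
  \<open>klist xs\<close>. Inequalities between such operators thus become positivity of
  kernels.\<close>

definition qform :: "('x \<Rightarrow> 'x \<Rightarrow> complex) \<Rightarrow> ('x \<times> 'e) list \<Rightarrow> complex" where
  "qform L xs = (\<Sum>q\<leftarrow>xs. \<Sum>r\<leftarrow>xs. L (fst q) (fst r) * k (fst q) (fst r) * cinner (snd r) (snd q))"

lemma ip_kmul:
  assumes "on_S xs"
  shows "ip (klist (kmul p xs)) (klist (kmul r xs)) = qform (\<lambda>u z. r u * cnj (p z)) xs"
proof -
  have kl: "klist (kmul p xs) u = (\<Sum>r\<leftarrow>xs. (k u (fst r) * cnj (p (fst r))) *\<^sub>C snd r)"
    if "u \<in> S" for u
    unfolding klist_def sum_list_fun_apply kmul_def using that
    by (simp add: o_def kf_apply scaleC_scaleC)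
  have "ip (klist (kmul p xs)) (klist (kmul r xs)) =
      (\<Sum>q\<leftarrow>xs. cinner (klist (kmul p xs) (fst q)) (cnj (r (fst q)) *\<^sub>C snd q))"
    using assms by (simp add: ip_klist) (simp add: kmul_def o_def)
  also have "\<dots> = qform (\<lambda>u z. r u * cnj (p z)) xs"
    unfolding qform_def
  proof (intro arg_cong[of _ _ sum_list] map_cong refl)
    fix q assume "q \<in> set xs"
    then have "fst q \<in> S" using assms by (auto simp: on_S_def)
    then show "cinner (klist (kmul p xs) (fst q)) (cnj (r (fst q)) *\<^sub>C snd q) =
        (\<Sum>s\<leftarrow>xs. r (fst q) * cnj (p (fst s)) * k (fst q) (fst s) * cinner (snd s) (snd q))"
      by (simp add: kl cinner_sum_list_left cinner_scaleC_left cinner_scaleC_right sum_list_const_mult [symmetric] mult_ac)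
  qed
  finally show ?thesis .
qed

lemma kmul_1 [simp]: "kmul (\<lambda>_. 1) xs = xs"
  by (simp add: kmul_def)

lemma nrm_kmul_sq:
  "on_S xs \<Longrightarrow> (nrm (klist (kmul p xs)))\<^sup>2 = Re (qform (\<lambda>u z. p u * cnj (p z)) xs)"
  by (metis Re_complex_of_real ip_kmul ip_self klist_in on_S_kmul)

lemma nrm_klist_sq: "on_S xs \<Longrightarrow> (nrm (klist xs))\<^sup>2 = Re (qform (\<lambda>u z. 1) xs)"
  using nrm_kmul_sq[of xs "\<lambda>_. 1"] by simp

lemma qform_add: "qform (\<lambda>u z. L u z + L' u z) xs = qform L xs + qform L' xs"
  by (simp add: qform_def sum_list_addf distrib_right)

lemma qform_cmult: "qform (\<lambda>u z. c * L u z) xs = c * qform L xs"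
  by (simp add: qform_def sum_list_const_mult mult.assoc)

lemma qform_diff: "qform (\<lambda>u z. L u z - L' u z) xs = qform L xs - qform L' xs"
  using qform_add[of L "\<lambda>u z. (- 1) * L' u z"] unfolding qform_cmult by simp

lemma qform_sum: "finite I \<Longrightarrow> qform (\<lambda>u z. \<Sum>i\<in>I. L i u z) xs = (\<Sum>i\<in>I. qform (L i) xs)"
proof (induction I rule: finite_induct)
  case empty
  show ?case using qform_cmult[of 0 "\<lambda>_ _. 0"] by simp
qed (simp add: qform_add)

lemma qform_sum_list: "qform (\<lambda>u z. \<Sum>f\<leftarrow>fs. L f u z) xs = (\<Sum>f\<leftarrow>fs. qform (L f) xs)"
proof (induction fs)
  case Nil
  show ?case using qform_cmult[of 0 "\<lambda>_ _. 0"] by simp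
qed (simp add: qform_add)

lemma qform_cong:
  "on_S xs \<Longrightarrow> (\<And>u z. u \<in> S \<Longrightarrow> z \<in> S \<Longrightarrow> L u z = L' u z) \<Longrightarrow> qform L xs = qform L' xs"
  unfolding qform_def on_S_def
  by (intro arg_cong[of _ _ sum_list] map_cong refl) (auto simp: image_subset_iff)

lemma qform_tendsto:
  assumes "on_S xs" "\<And>u z. u \<in> S \<Longrightarrow> z \<in> S \<Longrightarrow> ((\<lambda>n. L n u z) \<longlongrightarrow> L' u z) F"
  shows "((\<lambda>n. qform (L n) xs) \<longlongrightarrow> qform L' xs) F"
proof -
  have "fst q \<in> S" if "q \<in> set xs" for q using assms(1) that by (auto simp: on_S_def)
  then show ?thesis
    unfolding qform_def by (intro tendsto_sum_list tendsto_mult tendsto_const assms(2))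
qed

lemma qform_psd:
  assumes "finite_rank_psd L" "on_S xs" shows "Re (qform L xs) \<ge> 0"
proof -
  obtain fs where L: "\<And>u z. L u z = (\<Sum>f\<leftarrow>fs. f u * cnj (f z))"
    using assms by (auto simp: finite_rank_psd_def)
  have "L = (\<lambda>u z. \<Sum>f\<leftarrow>fs. f u * cnj (f z))" using L by blast
  then have "qform L xs = (\<Sum>f\<leftarrow>fs. qform (\<lambda>u z. f u * cnj (f z)) xs)"
    using qform_sum_list[of "\<lambda>f u z. f u * cnj (f z)" fs xs] by simp
  also have "Re \<dots> \<ge> 0"
    by (induction fs) (auto simp: nrm_kmul_sq[OF assms(2), symmetric])
  finally show ?thesis .
qed

end


section \<open>Kernels on the ball\<close>

lemma cinner_le_norm: "cmod (cinner x y) \<le> norm x * norm (y :: 'a::chilbert_space)"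
proof -
  interpret chilbert_on "UNIV :: 'a set" cinner by (rule chilbert_on_UNIV)
  show ?thesis using cauchy_schwarz[of x y] by (simp add: hnorm_cinner)
qed

lemma cinner_diff_left: "cinner (x - y) z = cinner x z - cinner y (z :: 'a::chilbert_space)"
  using cinner_add_left[of "x - y" y z] by simp

lemma cinner_diff_right: "cinner x (y - z) = cinner x y - cinner x (z :: 'a::chilbert_space)"
  using cinner_add_right[of x "y - z" z] by simp

lemma cmod_cinner_less_1:
  fixes z w :: "'a::chilbert_space"
  assumes "z \<in> ball 0 1" "w \<in> ball 0 1" shows "cmod (cinner z w) < 1"
proof -
  have "cmod (cinner z w) \<le> norm z * norm w" by (rule cinner_le_norm)
  also have "\<dots> \<le> norm z * 1" using assms by (intro mult_left_mono) auto
  finally show ?thesis using assms by simp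
qed

text \<open>By \<open>b_1\<close> the kernel \<open>1 - 1/k\<close> dominates a positive multiple of
  \<open>cinner\<close>, which gives control of the coordinates; \<open>k_diag\<close> puts its
  diagonal values into \<open>[0, 1)\<close>.\<close>

locale cnp_kernel =
  fixes k :: "complex ^ 'n::finite \<Rightarrow> complex ^ 'n \<Rightarrow> complex" and b :: "nat \<Rightarrow> real"
  assumes b_nonneg: "b (Suc n) \<ge> 0"
    and b_1: "b (Suc 0) > 0"
    and k_nz: "z \<in> ball 0 1 \<Longrightarrow> w \<in> ball 0 1 \<Longrightarrow> k z w \<noteq> 0"
    and b_sums: "z \<in> ball 0 1 \<Longrightarrow> w \<in> ball 0 1 \<Longrightarrow>
      (\<lambda>n. complex_of_real (b (Suc n)) * cinner z w ^ Suc n) sums (1 - 1 / k z w)"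
    and k_diag: "w \<in> ball 0 1 \<Longrightarrow> \<exists>r\<ge>1. k w w = complex_of_real r"

text \<open>The point is that \<open>b 1\<close> is positive. On the diagonal, with
  \<open>x = |w|\<^sup>2\<close>, the value of \<open>1 - 1/k\<close> is at least
  \<open>a 1 * x / (1 + a 1 * x)\<close>, of first order in \<open>x\<close>. Without a linear term
  the b-series would be of order \<open>x\<^sup>2\<close>.\<close>

lemma regular_cnp_kernel:
  fixes k :: "complex ^ 'n::finite \<Rightarrow> complex ^ 'n \<Rightarrow> complex"
  assumes "regular_uinv_cnp_kernel k"
  obtains b where "cnp_kernel k b"
proof -
  obtain a :: "nat \<Rightarrow> real" where a: "a 0 = 1" "\<And>n. a n > 0"
    "\<And>z w. z \<in> ball 0 1 \<Longrightarrow> w \<in> ball 0 1 \<Longrightarrow> (\<lambda>n. complex_of_real (a n) * cinner z w ^ n) sums k z w"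
    using assms unfolding regular_uinv_cnp_kernel_def by blast
  obtain b :: "nat \<Rightarrow> real" where b: "\<And>n. n \<ge> 1 \<Longrightarrow> b n \<ge> 0"
    "\<And>z w. z \<in> ball 0 1 \<Longrightarrow> w \<in> ball 0 1 \<Longrightarrow> k z w \<noteq> 0"
    "\<And>z w. z \<in> ball 0 1 \<Longrightarrow> w \<in> ball 0 1 \<Longrightarrow>
      (\<lambda>n. complex_of_real (b (Suc n)) * cinner z w ^ Suc n) sums (1 - 1 / k z w)"
    using assms unfolding regular_uinv_cnp_kernel_def by blast
  have diag: "\<exists>r. k w w = complex_of_real r \<and> r \<ge> 1 + a 1 * (norm w)\<^sup>2" if w: "w \<in> ball 0 1" for w
  proof -
    have s: "(\<lambda>n. complex_of_real (a n * ((norm w)\<^sup>2) ^ n)) sums k w w"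
      using a(3)[OF w w] by (simp add: cinner_self)
    then have "summable (\<lambda>n. a n * ((norm w)\<^sup>2) ^ n)"
      using sums_summable summable_of_real_iff by blast
    then obtain r where r: "(\<lambda>n. a n * ((norm w)\<^sup>2) ^ n) sums r" by blast
    then have "k w w = complex_of_real r" using s sums_of_real sums_unique2 by blast
    moreover have "(\<Sum>n<2. a n * ((norm w)\<^sup>2) ^ n) \<le> r"
      using r a(2) by (intro sum_le_suminf[OF sums_summable[OF r], unfolded sums_unique[OF r, symmetric]])
        (auto simp: less_imp_le)
    then have "1 + a 1 * (norm w)\<^sup>2 \<le> r" by (simp add: a(1) eval_nat_numeral)
    ultimately show ?thesis by blast
  qed
  have "b 1 \<noteq> 0"
  proof
    assume b1: "b 1 = 0"
    have key: "a 1 \<le> 4 * x * (1 + a 1)" if x: "0 < x" "x \<le> 1/2" for x :: real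
    proof -
      have real_b: "(\<lambda>n. b (Suc n) * y ^ Suc n) sums (1 - 1 / r)"
        if "k w w = complex_of_real r" "(norm w)\<^sup>2 = y" "w \<in> ball 0 1" for w y r
      proof -
        have "(\<lambda>n. complex_of_real (b (Suc n) * y ^ Suc n)) sums complex_of_real (1 - 1 / r)"
          using b(3)[OF that(3,3)] that(1,2) by (simp add: cinner_self)
        then show ?thesis by (simp only: sums_of_real_iff)
      qed
      have "0 \<le> sqrt (x::real)" "0 \<le> sqrt (1/2::real)" using x by auto
      then obtain w v :: "complex ^ 'n" where wv: "norm w = sqrt x" "norm v = sqrt (1/2)"
        using vector_choose_size by metis
      have wb: "w \<in> ball 0 1" "v \<in> ball 0 1"
        using wv x by auto
      obtain r where r: "k w w = complex_of_real r" "r \<ge> 1 + a 1 * x"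
        using diag[OF wb(1)] wv x by auto
      obtain t where t: "k v v = complex_of_real t" "t \<ge> 1 + a 1 * (1/2)"
        using diag[OF wb(2)] wv by auto
      have s1: "(\<lambda>n. b (Suc n) * x ^ Suc n) sums (1 - 1 / r)"
        using wv x by (intro real_b[OF r(1) _ wb(1)]) simp
      have s2: "(\<lambda>n. b (Suc n) * (1/2) ^ Suc n) sums (1 - 1 / t)"
        using wv by (intro real_b[OF t(1) _ wb(2)]) simp
      \<comment> \<open>Comparison with the value at \<open>|v|\<^sup>2 = 1/2\<close>: the term
        \<open>n = 0\<close> vanishes by assumption, and every other term contains
        \<open>x\<^sup>2\<close>.\<close>
      have "b (Suc n) * x ^ Suc n \<le> 4 * x\<^sup>2 * (b (Suc n) * (1/2) ^ Suc n)" for n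
      proof (cases n)
        case 0
        then show ?thesis using b1 by simp
      next
        case (Suc m)
        have "b (Suc n) * (x\<^sup>2 * x ^ m) \<le> b (Suc n) * (x\<^sup>2 * (1/2) ^ m)"
          using x b(1)[of "Suc n"] by (intro mult_left_mono power_mono) auto
        then show ?thesis by (simp add: Suc power2_eq_square mult_ac)
      qed
      then have "1 - 1 / r \<le> 4 * x\<^sup>2 * (1 - 1 / t)"
        using sums_le[OF _ s1 sums_mult[OF s2, of "4 * x\<^sup>2"]] by simp
      also have "\<dots> \<le> 4 * x\<^sup>2 * 1"
        using t a(2)[of 1] by (intro mult_left_mono) (auto intro!: divide_nonneg_nonneg)
      finally have "1 - 1 / r \<le> 4 * x\<^sup>2" by simp
      moreover have pos: "1 + a 1 * x > 0" using x a(2)[of 1] by (simp add: add_pos_pos)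
      moreover have "1 / r \<le> 1 / (1 + a 1 * x)"
        using r pos by (intro divide_left_mono mult_pos_pos) auto
      ultimately have "1 - 1 / (1 + a 1 * x) \<le> 4 * x\<^sup>2" by linarith
      then have "a 1 * x \<le> 4 * x\<^sup>2 * (1 + a 1 * x)"
        using pos by (simp add: field_simps)
      then have "x * a 1 \<le> x * (4 * x * (1 + a 1 * x))" by (simp add: power2_eq_square mult_ac)
      then have "a 1 \<le> 4 * x * (1 + a 1 * x)" using x by (simp add: mult_le_cancel_left_pos)
      also have "\<dots> \<le> 4 * x * (1 + a 1 * 1)"
        using x a(2)[of 1] by (intro mult_left_mono add_left_mono) auto
      finally show ?thesis by simp
    qed
    \<comment> \<open>Small enough that \<open>4 * x * (1 + a 1)\<close> is at most
      \<open>a 1 / 2\<close>, contrary to \<open>key\<close>.\<close>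
    define x where "x = min (1/2) (a 1 / (8 * (1 + a 1)))"
    have a1: "a 1 > 0" by (rule a)
    have "x > 0" using a1 by (simp add: x_def)
    moreover have "4 * x * (1 + a 1) \<le> 4 * (a 1 / (8 * (1 + a 1))) * (1 + a 1)"
      using a1 by (intro mult_right_mono mult_left_mono) (auto simp: x_def)
    moreover have "\<dots> = a 1 / 2" using a1 by (simp add: field_simps)
    ultimately show False using key[of x] a1 by (simp add: x_def)
  qed
  then have "cnp_kernel k b"
  proof unfold_locales
    show "\<exists>r\<ge>1. k w w = complex_of_real r" if w: "w \<in> ball 0 1" for w
    proof -
      obtain r where "k w w = complex_of_real r" "r \<ge> 1 + a 1 * (norm w)\<^sup>2" using diag[OF w] by blast
      moreover have "a 1 * (norm w)\<^sup>2 \<ge> 0" using a(2)[of 1] by simp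
      ultimately show ?thesis by (intro exI[of _ r]) auto
    qed
    show "b (Suc 0) > 0" using \<open>b 1 \<noteq> 0\<close> b(1)[of 1] by simp
  qed (use b in auto)
  then show thesis using that by blast
qed

context cnp_kernel
begin

definition \<phi> :: "complex ^ 'n \<Rightarrow> complex ^ 'n \<Rightarrow> complex" where "\<phi> z w = 1 - 1 / k z w"

text \<open>\<phi> depends on \<open>cinner z w\<close> only. As a function on the closed disc it
  can be evaluated at boundary points, where nothing is assumed about \<open>k\<close>.\<close>

definition \<Phi> :: "complex \<Rightarrow> complex" where
  "\<Phi> x = (\<Sum>n. complex_of_real (b (Suc n)) * x ^ Suc n)"

lemma \<phi>_sums:
  "z \<in> ball 0 1 \<Longrightarrow> w \<in> ball 0 1 \<Longrightarrow> (\<lambda>n. complex_of_real (b (Suc n)) * cinner z w ^ Suc n) sums \<phi> z w"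
  unfolding \<phi>_def by (rule b_sums)

lemma \<phi>_eq_\<Phi>: "z \<in> ball 0 1 \<Longrightarrow> w \<in> ball 0 1 \<Longrightarrow> \<phi> z w = \<Phi> (cinner z w)"
  using \<phi>_sums[of z w] unfolding \<Phi>_def by (rule sums_unique)

lemma inverse_k: "1 / k z w = 1 - \<phi> z w"
  by (simp add: \<phi>_def)

lemma \<phi>_commute: "z \<in> ball 0 1 \<Longrightarrow> w \<in> ball 0 1 \<Longrightarrow> \<phi> w z = cnj (\<phi> z w)"
proof -
  assume zw: "z \<in> ball 0 1" "w \<in> ball 0 1"
  have "(\<lambda>n. cnj (complex_of_real (b (Suc n)) * cinner z w ^ Suc n)) sums cnj (\<phi> z w)"
    using \<phi>_sums[OF zw] by (simp only: sums_cnj)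
  then have "(\<lambda>n. complex_of_real (b (Suc n)) * cinner w z ^ Suc n) sums cnj (\<phi> z w)"
    by (simp add: cinner_commute[of w z])
  then show ?thesis using \<phi>_sums[OF zw(2,1)] sums_unique2 by blast
qed

lemma k_commute: "z \<in> ball 0 1 \<Longrightarrow> w \<in> ball 0 1 \<Longrightarrow> k w z = cnj (k z w)"
  using \<phi>_commute[of z w] by (simp add: \<phi>_def)

lemma \<phi>_0: "z \<in> ball 0 1 \<Longrightarrow> \<phi> z 0 = 0"
  using \<phi>_sums[of z 0] sums_unique2[OF sums_zero] by fastforce

lemma k_0: "z \<in> ball 0 1 \<Longrightarrow> k z 0 = 1"
  using \<phi>_0[of z] k_nz[of z 0] by (simp add: \<phi>_def field_simps)

lemma \<phi>_diag:
  assumes "w \<in> ball 0 1" obtains r where "0 \<le> r" "r < 1" "\<phi> w w = complex_of_real r"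
proof -
  obtain r where "r \<ge> 1" "k w w = complex_of_real r" using k_diag[OF assms] by blast
  then show thesis using that[of "1 - 1 / r"] by (simp add: \<phi>_def)
qed

text \<open>The terms are nonnegative, so partial sums of the series for \<open>\<phi> w w\<close>
  stay below 1; then \<open>|w|\<close> tends to 1.\<close>

lemma sum_b_le_1: "(\<Sum>n<N. b (Suc n)) \<le> 1"
proof (rule tendsto_upperbound)
  show "((\<lambda>x. \<Sum>n<N. b (Suc n) * x ^ Suc n) \<longlongrightarrow> (\<Sum>n<N. b (Suc n))) (at_left (1::real))"
    by (rule tendsto_eq_rhs, (rule tendsto_intros)+) simp
  have "(\<Sum>n<N. b (Suc n) * x ^ Suc n) \<le> 1" if x: "0 < x" "x < 1" for x :: real
  proof -
    have "0 \<le> sqrt x" using x by simp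
    then obtain w :: "complex ^ 'n" where w: "norm w = sqrt x" using vector_choose_size by metis
    then have wb: "w \<in> ball 0 1" using x by simp
    obtain r where r: "0 \<le> r" "r < 1" "\<phi> w w = complex_of_real r" using \<phi>_diag[OF wb] .
    have "(\<lambda>n. complex_of_real (b (Suc n) * x ^ Suc n)) sums complex_of_real r"
      using \<phi>_sums[OF wb wb] w x r by (simp add: cinner_self)
    then have s: "(\<lambda>n. b (Suc n) * x ^ Suc n) sums r" by (simp only: sums_of_real_iff)
    have "(\<Sum>n<N. b (Suc n) * x ^ Suc n) \<le> r"
      unfolding sums_unique[OF s]
      by (rule sum_le_suminf[OF sums_summable[OF s]]) (use b_nonneg x in auto)
    then show ?thesis using r by simp
  qed
  then show "\<forall>\<^sub>F x in at_left 1. (\<Sum>n<N. b (Suc n) * x ^ Suc n) \<le> 1"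
    unfolding eventually_at_left_field by (intro exI[of _ 0]) auto
qed simp

lemma summable_b: "summable (\<lambda>n. b (Suc n))"
  by (rule summableI_nonneg_bounded[OF b_nonneg sum_b_le_1])

lemma continuous_\<Phi>: "continuous_on (cball 0 1) \<Phi>"
proof -
  have "uniform_limit (cball 0 1) (\<lambda>N x. \<Sum>n<N. complex_of_real (b (Suc n)) * x ^ Suc n) \<Phi> sequentially"
    unfolding \<Phi>_def
  proof (rule Weierstrass_m_test[OF _ summable_b])
    fix n and x :: complex assume "x \<in> cball 0 1"
    then have "cmod x ^ Suc n \<le> 1" by (intro power_le_one) auto
    then show "cmod (complex_of_real (b (Suc n)) * x ^ Suc n) \<le> b (Suc n)"
      using b_nonneg[of n] by (simp add: norm_mult norm_power mult_left_le)
  qed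
  then show ?thesis
    by (rule uniform_limit_theorem[rotated])
      (simp, intro always_eventually allI continuous_intros)
qed

text \<open>Both arguments approach \<open>l\<close> independently and all values are compared with
  one number, so any two values of \<phi> near \<open>l\<close> are close, diagonal or not.\<close>

lemma \<phi>_near:
  assumes l: "l \<in> cball 0 1" and e: "e > 0"
  obtains d where "d > 0" "\<And>z w. z \<in> ball 0 1 \<Longrightarrow> w \<in> ball 0 1 \<Longrightarrow> dist z l < d \<Longrightarrow> dist w l < d \<Longrightarrow>
    cmod (\<phi> z w - \<Phi> (cinner l l)) < e"
proof -
  have ll: "cinner l l \<in> cball 0 1"
    using l by (simp add: cinner_self abs_square_le_1 norm_power)
  obtain d where d: "d > 0"
    "\<And>x. x \<in> cball 0 1 \<Longrightarrow> dist x (cinner l l) < d \<Longrightarrow> dist (\<Phi> x) (\<Phi> (cinner l l)) < e"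
    using continuous_\<Phi> ll e unfolding continuous_on_iff by metis
  show thesis
  proof (rule that[of "d / 2"])
    fix z w :: "complex ^ 'n"
    assume z: "z \<in> ball 0 1" and w: "w \<in> ball 0 1" and dz: "dist z l < d / 2" "dist w l < d / 2"
    have "cinner z w - cinner l l = cinner (z - l) w + cinner l (w - l)"
      by (simp add: cinner_diff_left cinner_diff_right)
    then have "cmod (cinner z w - cinner l l) \<le> norm (z - l) * norm w + norm l * norm (w - l)"
      by (metis cinner_le_norm norm_triangle_mono)
    also have "\<dots> \<le> norm (z - l) * 1 + 1 * norm (w - l)"
      using w l by (intro add_mono mult_mono) auto
    also have "\<dots> < d" using dz by (simp add: dist_norm)
    finally have "dist (cinner z w) (cinner l l) < d" by (simp add: dist_norm)
    moreover have "cinner z w \<in> cball 0 1" using cmod_cinner_less_1[OF z w] by simp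
    ultimately show "cmod (\<phi> z w - \<Phi> (cinner l l)) < e"
      using d(2)[of "cinner z w"] z w by (simp add: \<phi>_eq_\<Phi> dist_norm)
  qed (use d in simp)
qed

end


section \<open>Operator inequalities from the complete Pick property\<close>

locale cnp_rkhs = cnp_kernel k b + vv_rkhs "ball 0 1" k H ip
  for k :: "complex ^ 'n::finite \<Rightarrow> complex ^ 'n \<Rightarrow> complex" and b
    and H :: "(complex ^ 'n \<Rightarrow> 'e::chilbert_space) set" and ip
begin

definition \<phi>N :: "nat \<Rightarrow> complex ^ 'n \<Rightarrow> complex ^ 'n \<Rightarrow> complex" where
  "\<phi>N N u z = (\<Sum>n<N. complex_of_real (b (Suc n)) * cinner u z ^ Suc n)"

lemma finite_rank_psd_\<phi>N: "finite_rank_psd (\<phi>N N)"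
proof -
  have "finite_rank_psd (\<lambda>u z. complex_of_real (b (Suc n)) * cinner (u :: complex ^ 'n) z ^ Suc n)" for n
    by (intro finite_rank_psd_scale finite_rank_psd_power finite_rank_psd_cinner b_nonneg)
  then have "finite_rank_psd (\<lambda>u z. \<Sum>n<N. complex_of_real (b (Suc n)) * cinner (u :: complex ^ 'n) z ^ Suc n)"
    by (rule finite_rank_psd_sum)
  moreover have "\<phi>N N = (\<lambda>u z. \<Sum>n<N. complex_of_real (b (Suc n)) * cinner u z ^ Suc n)"
    by (simp add: fun_eq_iff \<phi>N_def)
  ultimately show ?thesis by simp
qed

lemma \<phi>N_tendsto: "u \<in> ball 0 1 \<Longrightarrow> z \<in> ball 0 1 \<Longrightarrow> (\<lambda>N. \<phi>N N u z) \<longlonglongrightarrow> \<phi> u z"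
  using \<phi>_sums[of u z] unfolding sums_def \<phi>N_def .

lemma qform_psd_lim:
  assumes "on_S xs" "\<And>N. finite_rank_psd (L N)"
    and "\<And>u z. u \<in> ball 0 1 \<Longrightarrow> z \<in> ball 0 1 \<Longrightarrow> (\<lambda>N. L N u z) \<longlonglongrightarrow> L' u z"
  shows "Re (qform L' xs) \<ge> 0"
proof (rule LIMSEQ_le_const)
  show "(\<lambda>N. Re (qform (L N) xs)) \<longlonglongrightarrow> Re (qform L' xs)"
    using qform_tendsto[of xs L L' sequentially] assms by (intro tendsto_intros) auto
qed (use qform_psd assms in blast)

text \<open>\<open>k (1 - \<phi>) = 1\<close> is positive semidefinite.\<close>

lemma qform_\<phi>_le:
  assumes "on_S xs" shows "Re (qform \<phi> xs) \<le> (nrm (klist xs))\<^sup>2"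
proof -
  define s where "s = (\<Sum>q\<leftarrow>xs. snd q)"
  have S: "fst q \<in> ball 0 1" if "q \<in> set xs" for q using assms that by (auto simp: on_S_def)
  have "qform (\<lambda>u z. 1 - \<phi> u z) xs = (\<Sum>q\<leftarrow>xs. \<Sum>r\<leftarrow>xs. cinner (snd r) (snd q))"
    unfolding qform_def inverse_k [symmetric]
    by (intro arg_cong[of _ _ sum_list] map_cong refl) (use S k_nz in simp)
  also have "\<dots> = cinner s s" by (simp only: s_def cinner_sum_list_right cinner_sum_list_left)
  finally have "Re (qform (\<lambda>u z. 1 - \<phi> u z) xs) \<ge> 0" by (simp add: cinner_self)
  then show ?thesis using assms by (simp add: qform_diff nrm_klist_sq)
qed

text \<open>In the order of positive semidefinite kernels, \<open>b 1 * cinner\<close> is at most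
  \<phi> because the other terms of the series are positive, and \<phi> times \<open>k\<close> is at
  most \<open>k\<close>. Hence even the sum over all coordinates obeys this bound.\<close>

lemma coord_klist_bound:
  assumes "on_S xs"
  shows "b 1 * (nrm (klist (kmul (\<lambda>z. z $ i) xs)))\<^sup>2 \<le> (nrm (klist xs))\<^sup>2"
proof -
  let ?b = "complex_of_real (b 1)"
  have "Re (qform (\<lambda>u z. \<phi> u z - ?b * cinner u z) xs) \<ge> 0"
  proof (rule qform_psd_lim[OF assms])
    have "finite_rank_psd (\<lambda>u z. complex_of_real (b (Suc (Suc n))) * cinner (u :: complex ^ 'n) z ^ Suc (Suc n))" for n
      by (intro finite_rank_psd_scale finite_rank_psd_power finite_rank_psd_cinner b_nonneg)
    then show "finite_rank_psd (\<lambda>u z. \<Sum>n<N. complex_of_real (b (Suc (Suc n)))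
        * cinner (u :: complex ^ 'n) z ^ Suc (Suc n))" for N
      by (rule finite_rank_psd_sum)
    fix u z :: "complex ^ 'n" assume uz: "u \<in> ball 0 1" "z \<in> ball 0 1"
    show "(\<lambda>N. \<Sum>n<N. complex_of_real (b (Suc (Suc n))) * cinner u z ^ Suc (Suc n))
        \<longlonglongrightarrow> \<phi> u z - ?b * cinner u z"
      using \<phi>_sums[OF uz] unfolding sums_def [symmetric]
      by (subst sums_Suc_iff[of "\<lambda>n. complex_of_real (b (Suc n)) * cinner u z ^ Suc n"]) simp
  qed
  then have le: "b 1 * Re (qform cinner xs) \<le> (nrm (klist xs))\<^sup>2"
    using qform_\<phi>_le[OF assms] by (simp add: qform_diff qform_cmult)
  have "qform cinner xs = (\<Sum>j\<in>UNIV. qform (\<lambda>u z. u $ j * cnj (z $ j)) xs)"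
    using qform_sum[of UNIV "\<lambda>j u z. u $ j * cnj (z $ j)" xs]
    by (simp add: cinner_vec_def [abs_def] cinner_complex_def)
  then have "Re (qform cinner xs) = (\<Sum>j\<in>UNIV. (nrm (klist (kmul (\<lambda>z. z $ j) xs)))\<^sup>2)"
    by (simp add: nrm_kmul_sq[OF assms])
  also have "\<dots> \<ge> (nrm (klist (kmul (\<lambda>z. z $ i) xs)))\<^sup>2"
    by (rule member_le_sum) auto
  finally have "b 1 * (nrm (klist (kmul (\<lambda>z. z $ i) xs)))\<^sup>2 \<le> b 1 * Re (qform cinner xs)"
    using b_1 by (intro mult_left_mono) auto
  then show ?thesis using le by (rule order_trans)
qed

lemma coord_bounded:
  assumes f: "f \<in> H"
  shows "pmul (\<lambda>z. z $ i) f \<in> H" "nrm (pmul (\<lambda>z. z $ i) f) \<le> sqrt (1 / b 1) * nrm f"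
proof -
  have b1: "b 1 > 0" using b_1 by simp
  have "nrm (klist (kmul (\<lambda>z. z $ i) xs)) \<le> sqrt (1 / b 1) * nrm (klist xs)" if xs: "on_S xs" for xs
  proof (rule power2_le_imp_le)
    show "(nrm (klist (kmul (\<lambda>z. z $ i) xs)))\<^sup>2 \<le> (sqrt (1 / b 1) * nrm (klist xs))\<^sup>2"
      using coord_klist_bound[OF xs, of i] b1 by (simp add: field_simps)
  qed (use xs b1 in simp)
  from pmul_bounded[OF _ this f] b1
  show "pmul (\<lambda>z. z $ i) f \<in> H" "nrm (pmul (\<lambda>z. z $ i) f) \<le> sqrt (1 / b 1) * nrm f" by simp_all
qed

text \<open>The Cauchy-Schwarz kernel inequality for \<Psi> would divide by
  \<open>\<phi> w w\<close>, which is 0 at \<open>w = 0\<close>. The Gram matrix of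
  \<open>finite_rank_psd_project\<close> avoids the division, and its factor
  \<open>2 - \<phi> w w\<close> is at least 1.\<close>

lemma \<phi>_klist_bound:
  assumes xs: "on_S xs" and w: "w \<in> ball 0 1"
  shows "nrm (klist (kmul (\<lambda>z. \<phi> z w) xs)) \<le> nrm (klist xs)"
proof (rule power2_le_imp_le)
  let ?P = "\<lambda>u z. \<phi> u w * cnj (\<phi> z w)"
  define Y where "Y = (nrm (klist (kmul (\<lambda>z. \<phi> z w) xs)))\<^sup>2"
  have "ip (klist (kmul (\<lambda>z. \<phi> z w) xs)) (klist (kmul (\<lambda>z. \<phi> z w) xs)) = qform ?P xs"
    by (rule ip_kmul[OF xs])
  then have E: "qform ?P xs = complex_of_real Y"
    using xs by (simp only: Y_def ip_self klist_in on_S_kmul)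
  obtain r where r: "r < 1" "\<phi> w w = complex_of_real r" using \<phi>_diag[OF w] .
  have "Re (qform (\<lambda>u z. \<phi> u z - (2 - \<phi> w w) * ?P u z) xs) \<ge> 0"
  proof (rule qform_psd_lim[OF xs finite_rank_psd_project[OF finite_rank_psd_\<phi>N]])
    show "(\<lambda>N. \<phi>N N u z - (2 - \<phi>N N w w) * (\<phi>N N u w * cnj (\<phi>N N z w)))
      \<longlonglongrightarrow> \<phi> u z - (2 - \<phi> w w) * ?P u z" if "u \<in> ball 0 1" "z \<in> ball 0 1" for u z
      by (intro tendsto_intros \<phi>N_tendsto w that)
  qed
  then have "(2 - r) * Y \<le> Re (qform \<phi> xs)"
    by (simp add: qform_diff qform_cmult E r)
  moreover have "1 * Y \<le> (2 - r) * Y" using r by (intro mult_right_mono) (auto simp: Y_def)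
  ultimately show "Y \<le> (nrm (klist xs))\<^sup>2" using qform_\<phi>_le[OF xs] by linarith
qed (use xs in simp)

lemma inverse_k_bounded:
  assumes f: "f \<in> H" and w: "w \<in> ball 0 1"
  shows "pmul (\<lambda>z. 1 / k z w) f \<in> H" "nrm (pmul (\<lambda>z. 1 / k z w) f) \<le> 2 * nrm f"
proof -
  let ?g = "pmul (\<lambda>z. \<phi> z w) f"
  have g: "?g \<in> H" "nrm ?g \<le> nrm f"
    using pmul_bounded[of 1 "\<lambda>z. \<phi> z w" f] \<phi>_klist_bound[OF _ w] f by auto
  have eq: "pmul (\<lambda>z. 1 / k z w) f = f - ?g"
    by (simp add: fun_eq_iff inverse_k scaleC_diff_left)
  show "pmul (\<lambda>z. 1 / k z w) f \<in> H" using f g by (simp only: eq Hdiff)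
  have "nrm (f - ?g) \<le> nrm f + nrm ?g"
    using nrm_triangle[of f "- ?g"] f g by (simp add: nrm_minus)
  then show "nrm (pmul (\<lambda>z. 1 / k z w) f) \<le> 2 * nrm f" using g by (simp only: eq)
qed

text \<open>Since \<open>k z 0 = 1\<close>, the right side is the constant \<open>d\<close> on the
  ball. Its norm does not depend on \<open>w\<close>, unlike that of \<open>kf w d\<close>.\<close>

lemma inverse_k_kf: "w \<in> ball 0 1 \<Longrightarrow> pmul (\<lambda>z. 1 / k z w) (kf w d) = kf 0 d"
  using k_nz k_0 by (auto simp: fun_eq_iff kf_def scaleC_scaleC)

text \<open>The kernel behind this inequality is
  \<open>1/k(u,w) + 1/k(w,z) = (1 - \<phi>(u,z)) + (1 - \<phi>(w,w)) + \<langle>\<Psi> u - \<Psi> w, \<Psi> z - \<Psi> w\<rangle>\<close>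
  where \<open>\<phi>\<close> is the Gram matrix of \<open>\<Psi>\<close>, and the first-order part of the last term is
  \<open>b\<^sub>1 \<langle>u - w, z - w\<rangle>\<close>.\<close>

lemma coord_klist_coercive:
  assumes xs: "on_S xs" and w: "w \<in> ball 0 1"
  shows "b 1 * (nrm (klist (kmul (\<lambda>z. z $ i - w $ i) xs)))\<^sup>2 \<le>
    2 * Re (ip (klist (kmul (\<lambda>z. 1 / k z w) xs)) (klist xs))"
proof -
  let ?b = "complex_of_real (b 1)"
  let ?C = "\<lambda>u z. cinner (u - w) (z - w)"
  let ?G = "\<lambda>u z. \<phi> u z - \<phi> u w - \<phi> w z + \<phi> w w"
  have "Re (qform (\<lambda>u z. ?G u z - ?b * ?C u z) xs) \<ge> 0"
  proof (rule qform_psd_lim[OF xs])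
    \<comment> \<open>The kernel of the n-th power, centred at \<open>w\<close>. For
      \<open>n = 1\<close> it is \<open>cinner (u - w) (z - w)\<close>, the term split off below;
      the sums therefore start at index 2.\<close>
    define c where "c n = (\<lambda>u z :: complex ^ 'n. cinner u z ^ n - cinner u w ^ n - cinner w z ^ n + cinner w w ^ n)" for n
    have "finite_rank_psd (\<lambda>u z. complex_of_real (b (Suc (Suc n))) * c (Suc (Suc n)) u z)" for n
      unfolding c_def
      by (intro finite_rank_psd_scale finite_rank_psd_center finite_rank_psd_power finite_rank_psd_cinner b_nonneg)
    then show "finite_rank_psd (\<lambda>u z. \<Sum>n<N. complex_of_real (b (Suc (Suc n))) * c (Suc (Suc n)) u z)" for N
      by (rule finite_rank_psd_sum)
    fix u z :: "complex ^ 'n" assume uz: "u \<in> ball 0 1" "z \<in> ball 0 1"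
    have "(\<lambda>n. complex_of_real (b (Suc n)) * c (Suc n) u z) sums ?G u z"
      using sums_add[OF sums_diff[OF sums_diff[OF \<phi>_sums[OF uz] \<phi>_sums[OF uz(1) w]] \<phi>_sums[OF w uz(2)]] \<phi>_sums[OF w w]]
      by (simp only: c_def right_diff_distrib distrib_left)
    moreover have "c 1 u z = ?C u z" by (simp add: c_def cinner_diff_left cinner_diff_right)
    ultimately show "(\<lambda>N. \<Sum>n<N. complex_of_real (b (Suc (Suc n))) * c (Suc (Suc n)) u z)
        \<longlonglongrightarrow> ?G u z - ?b * ?C u z"
      unfolding sums_def [symmetric]
      by (subst sums_Suc_iff[of "\<lambda>n. complex_of_real (b (Suc n)) * c (Suc n) u z"]) simp
  qed
  then have G: "b 1 * Re (qform ?C xs) \<le> Re (qform ?G xs)"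
    by (simp add: qform_diff qform_cmult)
  obtain r where r: "r < 1" "\<phi> w w = complex_of_real r" using \<phi>_diag[OF w] .
  have "qform (\<lambda>u z. 1 / k u w + 1 / k w z) xs = qform (\<lambda>u z. ((1 - \<phi> u z) + ?G u z) + (1 - \<phi> w w) * 1) xs"
    by (intro qform_cong xs) (simp add: inverse_k)
  also have "\<dots> = qform (\<lambda>u z. 1 - \<phi> u z) xs + qform ?G xs + (1 - \<phi> w w) * qform (\<lambda>u z. 1) xs"
    by (simp only: qform_add qform_cmult)
  also have "Re \<dots> \<ge> 0 + b 1 * Re (qform ?C xs) + 0"
  proof -
    have "Re (qform (\<lambda>u z. 1 - \<phi> u z) xs) \<ge> 0"
      using qform_\<phi>_le[OF xs] xs by (simp add: qform_diff nrm_klist_sq)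
    moreover have "Re ((1 - \<phi> w w) * qform (\<lambda>u z. 1) xs) \<ge> 0"
    proof -
      have "1 - \<phi> w w = complex_of_real (1 - r)" using r by simp
      then have "Re ((1 - \<phi> w w) * qform (\<lambda>u z. 1) xs) = (1 - r) * (nrm (klist xs))\<^sup>2"
        using xs by (simp only: Re_complex_of_real times_complex.simps Im_complex_of_real nrm_klist_sq)
      then show ?thesis using r by simp
    qed
    ultimately show ?thesis using G by simp
  qed
  finally have 1: "b 1 * Re (qform ?C xs) \<le> Re (qform (\<lambda>u z. 1 / k u w + 1 / k w z) xs)" by simp
  have "qform ?C xs = (\<Sum>j\<in>UNIV. qform (\<lambda>u z. (u $ j - w $ j) * cnj (z $ j - w $ j)) xs)"
    using qform_sum[of UNIV "\<lambda>j u z. (u $ j - w $ j) * cnj (z $ j - w $ j)" xs]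
    by (simp add: cinner_vec_def [abs_def] cinner_complex_def)
  then have "Re (qform ?C xs) = (\<Sum>j\<in>UNIV. (nrm (klist (kmul (\<lambda>z. z $ j - w $ j) xs)))\<^sup>2)"
    by (simp add: nrm_kmul_sq[OF xs])
  also have "\<dots> \<ge> (nrm (klist (kmul (\<lambda>z. z $ i - w $ i) xs)))\<^sup>2"
    by (rule member_le_sum) auto
  finally have 2: "b 1 * (nrm (klist (kmul (\<lambda>z. z $ i - w $ i) xs)))\<^sup>2 \<le> b 1 * Re (qform ?C xs)"
    using b_1 by simp
  have "ip (klist (kmul (\<lambda>z. 1 / k z w) xs)) (klist xs) = qform (\<lambda>u z. cnj (1 / k z w)) xs"
    using ip_kmul[OF xs, of "\<lambda>z. 1 / k z w" "\<lambda>_. 1"] by simp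
  also have "\<dots> = qform (\<lambda>u z. 1 / k w z) xs"
  proof (intro qform_cong xs)
    show "cnj (1 / k z w) = 1 / k w z" if "z \<in> ball 0 1" for z
      using k_commute[OF that w] by simp
  qed
  finally have 3: "ip (klist (kmul (\<lambda>z. 1 / k z w) xs)) (klist xs) = qform (\<lambda>u z. 1 / k w z) xs" .
  \<comment> \<open>The two summands of \<open>1 / k u w + 1 / k w z\<close> give conjugate forms,
    whence the factor 2 in the claim.\<close>
  have "ip (klist xs) (klist (kmul (\<lambda>z. 1 / k z w) xs)) = qform (\<lambda>u z. 1 / k u w) xs"
    using ip_kmul[OF xs, of "\<lambda>_. 1" "\<lambda>z. 1 / k z w"] by simp
  then have "qform (\<lambda>u z. 1 / k u w) xs = cnj (qform (\<lambda>u z. 1 / k w z) xs)"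
    using 3 ip_commute[of "klist xs" "klist (kmul (\<lambda>z. 1 / k z w) xs)"] xs by simp
  then have "Re (qform (\<lambda>u z. 1 / k u w) xs) = Re (qform (\<lambda>u z. 1 / k w z) xs)" by simp
  then show ?thesis using 1 2 3 by (simp add: qform_add)
qed

text \<open>Testing against \<open>h\<close> replaces the adjoint by an inner product. Both sides
  are then continuous in \<open>x\<close>, and the case of kernel sums suffices by density.\<close>

lemma coord_coercive:
  assumes x: "x \<in> H" and h: "h \<in> H" and w: "w \<in> ball 0 1"
  shows "b 1 * (cmod (ip (pmul (\<lambda>z. z $ i - w $ i) h) x))\<^sup>2 \<le>
    2 * Re (ip (pmul (\<lambda>z. 1 / k z w) x) x) * (nrm h)\<^sup>2"
proof -
  obtain Xs where Xs: "\<And>n. on_S (Xs n)" "(\<lambda>n. nrm (klist (Xs n) - x)) \<longlonglongrightarrow> 0"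
    by (rule klist_dense[OF x]) (rule that)
  let ?N = "pmul (\<lambda>z. 1 / k z w)"
  have ph: "pmul (\<lambda>z. z $ i - w $ i) h \<in> H"
  proof -
    have "pmul (\<lambda>z. z $ i - w $ i) h = pmul (\<lambda>z. z $ i) h - (w $ i) *\<^sub>C h"
      by (simp add: fun_eq_iff scaleC_diff_left)
    then show ?thesis using coord_bounded(1)[OF h] h by simp
  qed
  have XH: "klist (Xs n) \<in> H" for n using Xs by simp
  show ?thesis
  proof (rule LIMSEQ_le)
    show "(\<lambda>n. b 1 * (cmod (ip (pmul (\<lambda>z. z $ i - w $ i) h) (klist (Xs n))))\<^sup>2)
        \<longlonglongrightarrow> b 1 * (cmod (ip (pmul (\<lambda>z. z $ i - w $ i) h) x))\<^sup>2"
      using ip_tendsto_right[OF XH x ph Xs(2)] by (intro tendsto_intros)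
    have "(\<lambda>n. nrm (?N (klist (Xs n)) - ?N x)) \<longlonglongrightarrow> 0"
    proof (rule Lim_null_comparison)
      show "\<forall>\<^sub>F n in sequentially. norm (nrm (?N (klist (Xs n)) - ?N x)) \<le> 2 * nrm (klist (Xs n) - x)"
        using inverse_k_bounded[OF _ w] XH x
        by (intro always_eventually allI) (simp add: pmul_diff [symmetric])
      show "(\<lambda>n. 2 * nrm (klist (Xs n) - x)) \<longlonglongrightarrow> 0"
        using tendsto_mult_right_zero[OF Xs(2)] .
    qed
    then have "(\<lambda>n. ip (?N (klist (Xs n))) (klist (Xs n))) \<longlonglongrightarrow> ip (?N x) x"
      using inverse_k_bounded(1)[OF _ w] XH x Xs(2) by (intro ip_tendsto) auto
    then show "(\<lambda>n. 2 * Re (ip (?N (klist (Xs n))) (klist (Xs n))) * (nrm h)\<^sup>2)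
        \<longlonglongrightarrow> 2 * Re (ip (?N x) x) * (nrm h)\<^sup>2"
      by (intro tendsto_intros)
    have "b 1 * (cmod (ip (pmul (\<lambda>z. z $ i - w $ i) h) (klist xs)))\<^sup>2 \<le>
        2 * Re (ip (?N (klist xs)) (klist xs)) * (nrm h)\<^sup>2" if xs: "on_S xs" for xs
    proof -
      let ?y = "klist (kmul (\<lambda>z. z $ i - w $ i) xs)"
      have "(cmod (ip (pmul (\<lambda>z. z $ i - w $ i) h) (klist xs)))\<^sup>2 \<le> (nrm h * nrm ?y)\<^sup>2"
        unfolding ip_pmul_klist[OF h ph xs] using cauchy_schwarz[of h ?y] h xs
        by (intro power_mono) auto
      then have "b 1 * (cmod (ip (pmul (\<lambda>z. z $ i - w $ i) h) (klist xs)))\<^sup>2 \<le> b 1 * (nrm h * nrm ?y)\<^sup>2"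
        using b_1 by (intro mult_left_mono) auto
      also have "\<dots> = (b 1 * (nrm ?y)\<^sup>2) * (nrm h)\<^sup>2" by (simp add: power_mult_distrib)
      also have "\<dots> \<le> 2 * Re (ip (klist (kmul (\<lambda>z. 1 / k z w) xs)) (klist xs)) * (nrm h)\<^sup>2"
        using coord_klist_coercive[OF xs w, of i] by (intro mult_right_mono) auto
      also have "Re (ip (klist (kmul (\<lambda>z. 1 / k z w) xs)) (klist xs)) = Re (ip (?N (klist xs)) (klist xs))"
        using ip_pmul_klist[of "klist xs" "\<lambda>z. 1 / k z w" xs] inverse_k_bounded(1)[OF _ w] xs
          ip_commute[of "klist xs" "klist (kmul (\<lambda>z. 1 / k z w) xs)"] by simp
      finally show ?thesis .
    qed
    then show "\<exists>N. \<forall>n\<ge>N. b 1 * (cmod (ip (pmul (\<lambda>z. z $ i - w $ i) h) (klist (Xs n))))\<^sup>2 \<le>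
        2 * Re (ip (?N (klist (Xs n))) (klist (Xs n))) * (nrm h)\<^sup>2"
      using Xs(1) by blast
  qed
qed

end


section \<open>The last stage of the Koszul complex of a quotient\<close>

locale quotient_tuple =
  fixes H M :: "('x \<Rightarrow> 'e::complex_vector) set"
    and T :: "'n::{finite,linorder} \<Rightarrow> ('x \<Rightarrow> 'e) \<Rightarrow> 'x \<Rightarrow> 'e"
  assumes H: "csubspace H" and M: "csubspace M" and MH: "M \<subseteq> H"
    and T_H: "f \<in> H \<Longrightarrow> T i f \<in> H" and T_M: "f \<in> M \<Longrightarrow> T i f \<in> M"
    and T_add: "T i (f + g) = T i f + T i g" and T_scaleC: "T i (c *\<^sub>C f) = c *\<^sub>C T i f"
begin

abbreviation V :: "(complex, 'x \<Rightarrow> 'e) module" where "V \<equiv> fun_module H"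
abbreviation Q :: "(complex, ('x \<Rightarrow> 'e) set) module" where "Q \<equiv> quot_module V M"

definition coset :: "('x \<Rightarrow> 'e) \<Rightarrow> ('x \<Rightarrow> 'e) set" where
  "coset h = {m + h |m. m \<in> M}"

lemma V_simps [simp]:
  "carrier V = H" "zero V = 0" "add V f g = f + g" "smult V c f = c *\<^sub>C f"
  by (simp_all add: fun_module_def zero_fun_def plus_fun_def scaleC_fun_def)

lemma coset_eq: "M +>\<^bsub>V\<^esub> h = coset h"
  by (auto simp: a_r_coset_def' coset_def)

lemma mem_coset: "f \<in> coset h \<longleftrightarrow> f - h \<in> M"
  unfolding coset_def by (auto intro: exI[of _ "f - h"])

lemma coset_eq_iff: "coset h = coset h' \<longleftrightarrow> h - h' \<in> M"
proof
  assume "coset h = coset h'"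
  moreover have "h \<in> coset h" using M by (simp add: mem_coset csubspace_0)
  ultimately show "h - h' \<in> M" by (simp add: mem_coset)
next
  assume d: "h - h' \<in> M"
  have "f - h \<in> M \<longleftrightarrow> f - h' \<in> M" for f
    using csubspace_add[OF M _ d, of "f - h"] csubspace_diff[OF M _ d, of "f - h'"] by auto
  then show "coset h = coset h'" by (auto simp: mem_coset)
qed

lemma Q_carrier: "carrier Q = coset ` H"
  by (auto simp: quot_module_def A_RCOSETS_def' coset_eq)

lemma Q_zero: "zero Q = coset 0"
  by (simp add: quot_module_def coset_def)

lemma Q_add: "add Q (coset f) (coset g) = coset (f + g)"
proof -
  have "x \<in> coset (f + g) \<longleftrightarrow> (\<exists>u\<in>coset f. \<exists>v\<in>coset g. x = u + v)" for x
  proof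
    assume "x \<in> coset (f + g)"
    then show "\<exists>u\<in>coset f. \<exists>v\<in>coset g. x = u + v"
      using M by (intro bexI[of _ "x - g"] bexI[of _ g])
        (auto simp: mem_coset csubspace_0 algebra_simps)
  next
    assume "\<exists>u\<in>coset f. \<exists>v\<in>coset g. x = u + v"
    then obtain u v where "u - f \<in> M" "v - g \<in> M" "x = u + v" by (auto simp: mem_coset)
    then show "x \<in> coset (f + g)"
      using csubspace_add[OF M, of "u - f" "v - g"] by (simp add: mem_coset algebra_simps)
  qed
  then show ?thesis by (auto simp: quot_module_def set_add_def')
qed

lemma Union_coset:
  assumes "\<And>f g. P (f + g) = P f + P g" "\<And>f. f \<in> M \<Longrightarrow> P f \<in> M"
  shows "(\<Union>v\<in>coset h. coset (P v)) = coset (P h)"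
proof -
  have "coset (P v) = coset (P h)" if "v \<in> coset h" for v
    using assms(1)[of "v - h" h] assms(2)[of "v - h"] that
    by (simp add: coset_eq_iff mem_coset algebra_simps)
  moreover have "h \<in> coset h" using M by (simp add: mem_coset csubspace_0)
  ultimately show ?thesis by blast
qed

lemma Q_smult: "smult Q c (coset h) = coset (c *\<^sub>C h)"
  using Union_coset[of "\<lambda>v. c *\<^sub>C v" h] M
  by (simp add: quot_module_def coset_eq scaleC_add_right csubspace_scaleC)

lemma Q_map: "quot_map V M (T i) (coset h) = coset (T i h)"
  using Union_coset[of "T i" h] by (simp add: quot_map_def coset_eq T_add T_M)

text \<open>\<open>koszul\<close> takes its sums with \<open>finsum\<close> in the quotient, and
  expanding those requires the group laws.\<close>

sublocale Q: abelian_group Q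
proof (rule abelian_groupI)
  show "x \<oplus>\<^bsub>Q\<^esub> y \<in> carrier Q" if "x \<in> carrier Q" "y \<in> carrier Q" for x y
    using that H by (auto simp: Q_carrier Q_add csubspace_add)
  show "\<zero>\<^bsub>Q\<^esub> \<in> carrier Q" using H by (simp add: Q_carrier Q_zero csubspace_0)
  show "(x \<oplus>\<^bsub>Q\<^esub> y) \<oplus>\<^bsub>Q\<^esub> z = x \<oplus>\<^bsub>Q\<^esub> (y \<oplus>\<^bsub>Q\<^esub> z)"
    if "x \<in> carrier Q" "y \<in> carrier Q" "z \<in> carrier Q" for x y z
    using that by (auto simp: Q_carrier Q_add add.assoc)
  show "x \<oplus>\<^bsub>Q\<^esub> y = y \<oplus>\<^bsub>Q\<^esub> x" if "x \<in> carrier Q" "y \<in> carrier Q" for x y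
    using that by (auto simp: Q_carrier Q_add add.commute)
  show "\<zero>\<^bsub>Q\<^esub> \<oplus>\<^bsub>Q\<^esub> x = x" if "x \<in> carrier Q" for x
    using that by (auto simp: Q_carrier Q_add Q_zero)
  show "\<exists>y\<in>carrier Q. y \<oplus>\<^bsub>Q\<^esub> x = \<zero>\<^bsub>Q\<^esub>" if x: "x \<in> carrier Q" for x
  proof -
    obtain h where "h \<in> H" "x = coset h" using x by (auto simp: Q_carrier)
    then show ?thesis
      using H by (intro bexI[of _ "coset (- h)"]) (auto simp: Q_carrier Q_add Q_zero csubspace_minus)
  qed
qed

lemma Q_minus:
  assumes "f \<in> H" "g \<in> H" shows "coset f \<ominus>\<^bsub>Q\<^esub> coset g = coset (f - g)"
proof -
  have "\<ominus>\<^bsub>Q\<^esub> coset g = coset (- g)"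
    by (rule Q.minus_equality) (use assms H in \<open>auto simp: Q_carrier Q_add Q_zero csubspace_minus\<close>)
  then show ?thesis by (simp add: a_minus_def Q_add)
qed

lemma Q_finsum:
  assumes "finite I" "\<And>i. i \<in> I \<Longrightarrow> g i \<in> H"
  shows "(\<Oplus>\<^bsub>Q\<^esub>i\<in>I. coset (g i)) = coset (sum g I)"
  using assms
proof (induction I rule: finite_induct)
  case empty
  then show ?case by (simp add: Q_zero zero_fun_def)
next
  case (insert i I)
  then show ?case by (subst Q.finsum_insert) (auto simp: Q_carrier Q_add)
qed

definition T' :: "complex ^ 'n::{finite,linorder} \<Rightarrow> 'n \<Rightarrow> ('x \<Rightarrow> 'e) set \<Rightarrow> ('x \<Rightarrow> 'e) set" where
  "T' \<zeta> i v = quot_map V M (T i) v \<ominus>\<^bsub>Q\<^esub> (\<zeta> $ i) \<odot>\<^bsub>Q\<^esub> v"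

lemma T'_coset: "h \<in> H \<Longrightarrow> T' \<zeta> i (coset h) = coset (T i h - (\<zeta> $ i) *\<^sub>C h)"
  using H by (simp add: T'_def Q_map Q_smult Q_minus T_H csubspace_scaleC)

lemma koszul_coset:
  assumes g: "\<And>J. g J \<in> H"
  shows "koszul Q (T' \<zeta>) (\<lambda>J. coset (g J)) I =
    coset (\<Sum>i\<in>I. ((- 1) ^ card {j\<in>I. j < i}) *\<^sub>C (T i (g (I - {i})) - (\<zeta> $ i) *\<^sub>C g (I - {i})))"
  unfolding koszul_def
proof (subst Q_finsum [symmetric])
  show "((- 1) ^ card {j\<in>I. j < i}) *\<^sub>C (T i (g (I - {i})) - (\<zeta> $ i) *\<^sub>C g (I - {i})) \<in> H" for i
    using H g by (intro csubspace_scaleC csubspace_diff T_H) auto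
qed (simp_all add: T'_coset g Q_smult)

text \<open>Elements of the top degree are always cycles, so exactness there is surjectivity of the row.\<close>

lemma row_surjective:
  assumes \<zeta>: "\<zeta> \<notin> taylor_spectrum Q (\<lambda>i. quot_map V M (T i))" and h: "h \<in> H"
  obtains g where "\<And>i. g i \<in> H" "h - (\<Sum>i\<in>UNIV. T i (g i) - (\<zeta> $ i) *\<^sub>C g i) \<in> M"
proof -
  have exact: "{x \<in> UNIV \<rightarrow> carrier Q. koszul Q (T' \<zeta>) x = (\<lambda>_. \<zero>\<^bsub>Q\<^esub>)} =
      koszul Q (T' \<zeta>) ` (UNIV \<rightarrow> carrier Q)"
    using \<zeta> by (simp add: taylor_spectrum_def taylor_nonsingular_def T'_def [abs_def])
  define x where "x J = (if J = UNIV then h else 0)" for J :: "'n set"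
  have xH: "x J \<in> H" for J using h H by (simp add: x_def csubspace_0)
  have T0: "T i 0 = 0" for i using T_scaleC[of i 0 0] by simp
  have "koszul Q (T' \<zeta>) (\<lambda>J. coset (x J)) = (\<lambda>_. \<zero>\<^bsub>Q\<^esub>)"
  proof
    fix I :: "'n set"
    \<comment> \<open>A set with \<open>i\<close> removed is never the full index set, the only
      place where \<open>x\<close> may be nonzero.\<close>
    have "x (I - {i}) = 0" for i by (auto simp: x_def)
    then show "koszul Q (T' \<zeta>) (\<lambda>J. coset (x J)) I = \<zero>\<^bsub>Q\<^esub>"
      unfolding koszul_coset[of x \<zeta> I, OF xH] by (simp add: T0 Q_zero)
  qed
  moreover have "(\<lambda>J. coset (x J)) \<in> UNIV \<rightarrow> carrier Q" using xH by (auto simp: Q_carrier)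
  ultimately have "(\<lambda>J. coset (x J)) \<in> koszul Q (T' \<zeta>) ` (UNIV \<rightarrow> carrier Q)"
    unfolding exact [symmetric] by blast
  then obtain y where y: "y \<in> UNIV \<rightarrow> carrier Q" "(\<lambda>J. coset (x J)) = koszul Q (T' \<zeta>) y" by blast
  have "\<forall>J. \<exists>g. g \<in> H \<and> y J = coset g" using y(1) by (auto simp: Q_carrier Pi_def)
  then obtain G where G: "\<And>J. G J \<in> H" "\<And>J. y J = coset (G J)" by metis
  have yG: "y = (\<lambda>J. coset (G J))" using G by auto
  \<comment> \<open>The signs of the top Koszul map; they are absorbed into the preimages.\<close>
  define c :: "'n \<Rightarrow> complex" where "c i = (- 1) ^ card {j\<in>UNIV. j < i}" for i
  have "coset (x UNIV) = koszul Q (T' \<zeta>) y UNIV" using y(2) by metis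
  also have "\<dots> = coset (\<Sum>i\<in>UNIV. c i *\<^sub>C (T i (G (UNIV - {i})) - (\<zeta> $ i) *\<^sub>C G (UNIV - {i})))"
    unfolding yG koszul_coset[of G \<zeta> UNIV, OF G(1)] c_def ..
  also have "(\<Sum>i\<in>UNIV. c i *\<^sub>C (T i (G (UNIV - {i})) - (\<zeta> $ i) *\<^sub>C G (UNIV - {i}))) =
      (\<Sum>i\<in>UNIV. T i (c i *\<^sub>C G (UNIV - {i})) - (\<zeta> $ i) *\<^sub>C (c i *\<^sub>C G (UNIV - {i})))"
    by (simp add: T_scaleC scaleC_diff_right scaleC_scaleC mult.commute)
  finally show thesis
    using G(1) H by (intro that[of "\<lambda>i. c i *\<^sub>C G (UNIV - {i})"])
      (auto simp: x_def coset_eq_iff csubspace_scaleC)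
qed

end


section \<open>Inner multipliers\<close>

lemma norm_cinner_self: "cmod (cinner x x) = (norm x)\<^sup>2"
  by (simp add: cinner_self norm_power)

lemma norm_scaleC: "norm (c *\<^sub>C x) = cmod c * norm (x :: 'a::chilbert_space)"
proof -
  interpret chilbert_on "UNIV :: 'a set" cinner by (rule chilbert_on_UNIV)
  show ?thesis using nrm_scaleC[of x c] by (simp add: hnorm_cinner)
qed

lemma bounded_linear_scaleC: "bounded_linear (\<lambda>x :: 'a::chilbert_space. c *\<^sub>C x)"
  by (rule bounded_linear_intro[of _ "cmod c"])
    (simp_all add: scaleC_add_right scaleR_scaleC scaleC_scaleC norm_scaleC mult.commute)

locale cnp_inner_multiplier =
  D: cnp_rkhs k b HD ipD + E: cnp_rkhs k b HE ipE
  for k :: "complex ^ 'n::finite \<Rightarrow> complex ^ 'n \<Rightarrow> complex" and b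
    and HD :: "(complex ^ 'n \<Rightarrow> 'd::chilbert_space) set" and ipD
    and HE :: "(complex ^ 'n \<Rightarrow> 'e::chilbert_space) set" and ipE +
  fixes \<theta> :: "complex ^ 'n \<Rightarrow> 'e \<Rightarrow>\<^sub>L 'd" and M
  assumes inner: "inner_multiplier (ball 0 1) HE ipE HD ipD \<theta>"
    and closed: "D.closed_in M" and M_eq: "M = mult_op \<theta> ` HE"
begin

abbreviation A :: "(complex ^ 'n \<Rightarrow> 'e) \<Rightarrow> complex ^ 'n \<Rightarrow> 'd" where "A \<equiv> mult_op \<theta>"

lemma \<theta>_scaleC: "z \<in> ball 0 1 \<Longrightarrow> \<theta> z (c *\<^sub>C x) = c *\<^sub>C \<theta> z x"
  using inner by (simp add: inner_multiplier_def multiplier_def)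

lemma A_in: "f \<in> HE \<Longrightarrow> A f \<in> HD"
  using inner by (simp add: inner_multiplier_def multiplier_def)

lemma M_sub: "M \<subseteq> HD" and M_csub: "csubspace M"
  using closed by (simp_all add: D.closed_in_def)

lemma A_apply: "A f z = \<theta> z (f z)"
  by (simp add: mult_op_def)

lemma A_add: "A (f + g) = A f + A g" and A_diff: "A (f - g) = A f - A g"
  by (simp_all add: fun_eq_iff A_apply blinfun.add_right blinfun.diff_right)

lemma A_pmul: "f \<in> HE \<Longrightarrow> A (pmul p f) = pmul p (A f)"
proof
  fix z assume f: "f \<in> HE"
  show "A (pmul p f) z = pmul p (A f) z"
    \<comment> \<open>Outside the ball \<open>\<theta> z\<close> need not be complex-linear, but
      there \<open>f\<close> is 0.\<close>
    using E.vanish_outside[OF f, of z] \<theta>_scaleC[of z]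
    by (cases "z \<in> ball 0 1") (auto simp: A_apply)
qed

lemma A_scaleC: "f \<in> HE \<Longrightarrow> A (c *\<^sub>C f) = c *\<^sub>C A f"
  using A_pmul[of f "\<lambda>_. c"] by (simp add: pmul_def scaleC_fun_def)

lemma A_bounded: obtains C where "\<And>f. f \<in> HE \<Longrightarrow> D.nrm (A f) \<le> C * E.nrm f"
  using inner unfolding inner_multiplier_def multiplier_def by blast

section \<open>The partial isometry and the projection to its range\<close>

definition kerA :: "(complex ^ 'n \<Rightarrow> 'e) set" where "kerA = {f \<in> HE. A f = 0}"

lemma closed_kerA: "E.closed_in kerA"
  unfolding E.closed_in_def
proof (intro conjI allI impI)
  show "kerA \<subseteq> HE" by (auto simp: kerA_def)
  have "A 0 = 0" by (simp add: fun_eq_iff A_apply)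
  then show "csubspace kerA" by (auto simp: kerA_def csubspace_def A_add A_scaleC)
  fix X f assume X: "(\<forall>n. X n \<in> kerA) \<and> f \<in> HE \<and> (\<lambda>n. E.nrm (X n - f)) \<longlonglongrightarrow> 0"
  obtain C where C: "\<And>f. f \<in> HE \<Longrightarrow> D.nrm (A f) \<le> C * E.nrm f"
    by (rule A_bounded) (rule that)
  have "D.nrm (A f) \<le> C * E.nrm (X n - f)" for n
  proof -
    have "A (f - X n) = A f" using X by (simp add: A_diff kerA_def)
    moreover have "X n \<in> HE" "f \<in> HE" using X by (auto simp: kerA_def)
    ultimately show ?thesis using C[of "f - X n"] by (simp add: E.nrm_diff_commute)
  qed
  moreover have "(\<lambda>n. C * E.nrm (X n - f)) \<longlonglongrightarrow> 0"
    using X tendsto_mult_right_zero by blast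
  ultimately have "D.nrm (A f) \<le> 0" by (intro LIMSEQ_le_const) auto
  then have "D.nrm (A f) = 0" using D.nrm_nonneg[OF A_in, of f] X by linarith
  then show "f \<in> kerA" using X by (simp add: kerA_def D.nrm_eq_0 A_in)
qed

definition perp :: "(complex ^ 'n \<Rightarrow> 'e) \<Rightarrow> bool" where
  "perp f \<longleftrightarrow> f \<in> HE \<and> (\<forall>g\<in>kerA. ipE f g = 0)"

lemma perp_decomposition:
  assumes f: "f \<in> HE" obtains g where "perp g" "A g = A f" "f - g \<in> kerA"
proof -
  obtain q where q: "q \<in> kerA" "\<And>m. m \<in> kerA \<Longrightarrow> ipE m (f - q) = 0"
    by (rule E.projection[OF closed_kerA f]) (rule that)
  have qE: "q \<in> HE" using q by (simp add: kerA_def)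
  have "ipE (f - q) m = 0" if "m \<in> kerA" for m
    using q(2)[OF that] E.ip_commute[of "f - q" m] that f qE by (simp add: kerA_def)
  then have "perp (f - q)" using f qE by (simp add: perp_def)
  moreover have "A (f - q) = A f" using q by (simp add: A_diff kerA_def)
  ultimately show thesis using that q by simp
qed

lemma isometric_on_perp: "perp f \<Longrightarrow> D.nrm (A f) = E.nrm f"
proof -
  assume f: "perp f"
  have "ipE f g = 0" if "g \<in> HE" "A g = (\<lambda>_. 0)" for g
    using f that by (simp add: perp_def kerA_def zero_fun_def)
  then show ?thesis
    using inner f unfolding inner_multiplier_def partial_isometry_def perp_def by blast
qed

text \<open>Polarisation on the orthogonal complement of the kernel; the kernel part of
  \<open>f\<close> contributes to neither side.\<close>

lemma isometry:
  assumes y: "perp y" and f: "f \<in> HE" shows "ipD (A y) (A f) = ipE y f"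
proof -
  obtain g where g: "perp g" "A g = A f" "f - g \<in> kerA" using perp_decomposition[OF f] .
  have H: "y \<in> HE" "g \<in> HE" using y g by (auto simp: perp_def)
  have Re: "Re (ipD (A y) (A u)) = Re (ipE y u)" if u: "perp u" for u
  proof -
    have uH: "u \<in> HE" using u by (simp add: perp_def)
    have "perp (y + u)" using y u by (auto simp: perp_def kerA_def E.hs.ip_add_left)
    then have "(D.nrm (A y + A u))\<^sup>2 = (E.nrm (y + u))\<^sup>2"
      using isometric_on_perp by (metis A_add)
    then show ?thesis
      using isometric_on_perp[OF y] isometric_on_perp[OF u] H uH A_in
      by (simp add: D.nrm_add_sq E.nrm_add_sq)
  qed
  have "perp (\<i> *\<^sub>C g)" using g by (auto simp: perp_def kerA_def E.hs.ip_scaleC_left)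
  from Re[OF this] have "Im (ipD (A y) (A g)) = Im (ipE y g)"
    using H A_in by (simp add: A_scaleC D.ip_scaleC_right E.ip_scaleC_right)
  then have "ipD (A y) (A g) = ipE y g" using Re[OF g(1)] by (simp add: complex_eq_iff)
  moreover have "ipE y (f - g) = 0" using y g(3) by (simp add: perp_def)
  then have "ipE y f = ipE y g" using f H by (simp add: E.ip_diff_right)
  ultimately show ?thesis using g(2) by simp
qed

text \<open>\<open>g\<close> is the projection of \<open>k\<^sub>w d\<close> to the orthogonal complement of \<open>M\<close>, and
  \<open>t = \<theta>(w)\<^sup>* d\<close>. As \<open>P\<^sub>M = M\<^sub>\<theta> M\<^sub>\<theta>\<^sup>*\<close> and \<open>M\<^sub>\<theta>\<^sup>* k\<^sub>w d = k\<^sub>w \<theta>(w)\<^sup>* d\<close>, the projection to \<open>M\<close> is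
  \<open>k\<^sub>w \<theta> \<theta>(w)\<^sup>* d\<close>.\<close>

definition model :: "complex ^ 'n \<Rightarrow> 'd \<Rightarrow> (complex ^ 'n \<Rightarrow> 'd) \<Rightarrow> 'e \<Rightarrow> bool" where
  "model w d g t \<longleftrightarrow> g \<in> HD \<and> (\<forall>m\<in>M. ipD m g = 0) \<and> D.kf w d - g \<in> M \<and>
    (\<forall>e. cinner (\<theta> w e) d = cinner e t) \<and>
    (\<forall>z\<in>ball 0 1. (D.kf w d - g) z = k z w *\<^sub>C \<theta> z t)"

lemma model_ex:
  assumes w: "w \<in> ball 0 1" shows "\<exists>g t. model w d g t"
proof -
  obtain p where p: "p \<in> M" "\<And>m. m \<in> M \<Longrightarrow> ipD m (D.kf w d - p) = 0"
    by (rule D.projection[OF closed D.kf_in[OF w]]) (rule that)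
  obtain f where f: "f \<in> HE" "p = A f" using p M_eq by auto
  obtain y where y: "perp y" "A y = p" using perp_decomposition[OF f(1)] f(2) by metis
  have yH: "y \<in> HE" using y by (simp add: perp_def)
  have pH: "p \<in> HD" using p M_sub by auto
  have yz: "cinner (y z) e = k z w * cinner d (\<theta> w e)" if z: "z \<in> ball 0 1" for z e
  proof -
    let ?f = "E.kf z e"
    have fE: "?f \<in> HE" using z by simp
    have fM: "A ?f \<in> M" using fE M_eq by auto
    then have fD: "A ?f \<in> HD" using M_sub by auto
    have "cinner (y z) e = ipE y ?f" using E.ip_kf[OF yH z] by simp
    also have "\<dots> = ipD p (A ?f)" using isometry[OF y(1) fE] y(2) by simp
    also have "\<dots> = cnj (ipD (A ?f) p)" by (rule D.ip_commute[OF pH fD])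
    also have "ipD (A ?f) p = ipD (A ?f) (D.kf w d)"
      using p(2)[OF fM] fD pH w by (simp add: D.ip_diff_right)
    also have "\<dots> = cinner (\<theta> w (?f w)) d" using D.ip_kf[OF fD w] by (simp add: A_apply)
    also have "\<dots> = k w z * cinner (\<theta> w e) d"
      using w by (simp add: E.kf_apply \<theta>_scaleC cinner_scaleC_left)
    finally show ?thesis
      using D.k_commute[OF w z] cinner_commute[of d "\<theta> w e"] by simp
  qed
  have "cnj (k w 0) = k 0 w" using D.k_commute[OF w, of 0] by simp
  then have k0: "k 0 w = 1" using D.k_0[OF w] by simp
  \<comment> \<open>As \<open>k 0 w = 1\<close>, the value of \<open>y\<close> at the origin is the
    adjoint vector \<open>\<theta>(w)\<^sup>* d\<close>, obtained without a separate construction of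
    the adjoint.\<close>
  have t: "cinner (y 0) e = cinner d (\<theta> w e)" for e using yz[of 0 e] k0 by simp
  have "y z = k z w *\<^sub>C y 0" if "z \<in> ball 0 1" for z
    by (rule cinner_ext) (simp add: yz[OF that] cinner_scaleC_left t)
  then have "\<forall>z\<in>ball 0 1. p z = k z w *\<^sub>C \<theta> z (y 0)"
    using y(2) A_apply[of y] \<theta>_scaleC by metis
  moreover have "cinner (\<theta> w e) d = cinner e (y 0)" for e
    using t[of e] by (metis cinner_commute)
  ultimately have "model w d (D.kf w d - p) (y 0)"
    using p pH w by (simp add: model_def)
  then show ?thesis by blast
qed

text \<open>\<open>g\<close> is orthogonal to \<open>M\<close>, so \<open>g'\<close> may be replaced
  by the full kernel function at \<open>z\<close>, which evaluates \<open>g\<close>.\<close>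

lemma model_ip_right:
  assumes "model w d g t" "model z d' g' t'" "w \<in> ball 0 1" "z \<in> ball 0 1"
  shows "ipD g g' = cinner (g z) d'"
proof -
  have g: "g \<in> HD" "g' \<in> HD" "D.kf z d' - g' \<in> M" "\<And>m. m \<in> M \<Longrightarrow> ipD m g = 0"
    using assms by (auto simp: model_def)
  have "ipD (D.kf z d' - g') g = 0" using g by simp
  then have "ipD g (D.kf z d' - g') = 0"
    using D.ip_commute[of g "D.kf z d' - g'"] g M_sub by auto
  then show ?thesis using g assms(4) by (simp add: D.ip_diff_right D.ip_kf)
qed

text \<open>The value \<open>g z\<close> is \<open>k z w *\<^sub>C (d - \<theta> z t)\<close>. Its
  inner product with \<open>d\<close> is \<open>ipD g g'\<close>, and dividing by
  \<open>k z w\<close> produces the factor \<open>1 - \<phi> z w\<close>.\<close>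

lemma model_gram:
  assumes m: "model w d g t" "model z d g' t'" and w: "w \<in> ball 0 1" "z \<in> ball 0 1"
  shows "cinner t t' = cinner d d - (1 - D.\<phi> z w) * ipD g g'"
proof -
  have "g z = k z w *\<^sub>C (d - \<theta> z t)"
  proof -
    have "(D.kf w d - g) z = k z w *\<^sub>C \<theta> z t" using m(1) w(2) by (simp add: model_def)
    then show ?thesis using w by (simp add: D.kf_apply scaleC_diff_right algebra_simps)
  qed
  then have "ipD g g' = k z w * (cinner d d - cinner (\<theta> z t) d)"
    using model_ip_right[OF m w] by (simp add: cinner_scaleC_left cinner_diff_left)
  moreover have "cinner (\<theta> z t) d = cinner t t'" using m(2) by (simp add: model_def)
  ultimately show ?thesis
    using D.k_nz[OF w(2,1)] by (simp add: D.\<phi>_def)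
qed

text \<open>\<open>M\<close> is the range of \<open>A\<close>, which commutes with scalar
  multiplication operators, and these preserve \<open>HE\<close>.\<close>

lemma N_in_M: "w \<in> ball 0 1 \<Longrightarrow> m \<in> M \<Longrightarrow> pmul (\<lambda>z. 1 / k z w) m \<in> M"
proof -
  assume w: "w \<in> ball 0 1" and "m \<in> M"
  then obtain f where f: "f \<in> HE" "m = A f" using M_eq by auto
  then have "pmul (\<lambda>z. 1 / k z w) m = A (pmul (\<lambda>z. 1 / k z w) f)" by (simp add: A_pmul)
  then show ?thesis using E.inverse_k_bounded(1)[OF f(1) w] M_eq by blast
qed

lemma nrm_kf_0: "D.nrm (D.kf 0 d) = norm d"
proof -
  have "complex_of_real ((D.nrm (D.kf 0 d))\<^sup>2) = complex_of_real ((norm d)\<^sup>2)"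
    using D.nrm_kf_sq[of 0 d] D.k_0[of 0] by (simp add: cinner_self)
  then show ?thesis by (simp only: of_real_eq_iff power2_eq_iff_nonneg D.nrm_nonneg D.kf_in
        norm_ge_zero centre_in_ball zero_less_one)
qed

end


section \<open>Points outside the spectrum\<close>

locale cnp_inner_multiplier_row = cnp_inner_multiplier k b HD ipD HE ipE \<theta> M
  for k :: "complex ^ 'n::finite \<Rightarrow> complex ^ 'n \<Rightarrow> complex" and b
    and HD :: "(complex ^ 'n \<Rightarrow> 'd::chilbert_space) set" and ipD
    and HE :: "(complex ^ 'n \<Rightarrow> 'e::chilbert_space) set" and ipE \<theta> M +
  fixes l :: "complex ^ 'n"
  assumes l: "l \<in> cball 0 1"
    and row: "h \<in> HD \<Longrightarrow> \<exists>g. (\<forall>i. g i \<in> HD) \<and>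
      h - (\<Sum>i\<in>UNIV. pmul (\<lambda>z. z $ i - l $ i) (g i)) \<in> M"
begin

lemma coord_shift: "pmul (\<lambda>z. z $ i - a) f = pmul (\<lambda>z. z $ i) f - a *\<^sub>C f"
  by (simp add: fun_eq_iff scaleC_diff_left)

lemma coord_shift_in: "f \<in> HD \<Longrightarrow> pmul (\<lambda>z. z $ i - a) f \<in> HD"
  using D.coord_bounded(1) by (simp add: coord_shift)

text \<open>The bound \<open>\<parallel>(M\<^sub>z\<^sub>i - w\<^sub>i)\<^sup>* x\<parallel> \<le> r\<close> is stated through inner products, so that no adjoint is needed.\<close>

definition adjoint_row_below :: "complex ^ 'n \<Rightarrow> real \<Rightarrow> bool" where
  "adjoint_row_below w C \<longleftrightarrow> (\<forall>x\<in>HD. (\<forall>m\<in>M. ipD m x = 0) \<longrightarrow> (\<forall>r\<ge>0.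
    (\<forall>i. \<forall>h\<in>HD. cmod (ipD (pmul (\<lambda>z. z $ i - w $ i) h) x) \<le> r * D.nrm h) \<longrightarrow> D.nrm x \<le> C * r))"

lemma adjoint_row_belowD:
  assumes "adjoint_row_below w C" "x \<in> HD" "\<forall>m\<in>M. ipD m x = 0"
    "\<And>i h. h \<in> HD \<Longrightarrow> cmod (ipD (pmul (\<lambda>z. z $ i - w $ i) h) x) \<le> r * D.nrm h" "r \<ge> 0"
  shows "D.nrm x \<le> C * r"
  using assms unfolding adjoint_row_below_def by blast

text \<open>Take all \<open>x\<close> orthogonal to \<open>M\<close> with adjoint row at most 1.
  Writing \<open>h\<close> by \<open>row\<close> as a combination modulo \<open>M\<close> bounds
  \<open>ipD h x\<close> over all such \<open>x\<close>, so uniform boundedness bounds their norms;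
  scaling gives the rest.\<close>

lemma bounded_below:
  obtains C where "C > 0" "adjoint_row_below l C"
proof -
  let ?P = "\<lambda>i. pmul (\<lambda>z. z $ i - l $ i)"
  define X where "X = {x \<in> HD. (\<forall>m\<in>M. ipD m x = 0) \<and>
    (\<forall>i. \<forall>h\<in>HD. cmod (ipD (?P i h) x) \<le> D.nrm h)}"
  have "\<exists>C. \<forall>x\<in>X. D.nrm x \<le> C"
  proof (rule D.uniform_boundedness)
    show "X \<subseteq> HD" by (auto simp: X_def)
    fix h assume h: "h \<in> HD"
    obtain g where g: "\<And>i. g i \<in> HD" "h - (\<Sum>i\<in>UNIV. ?P i (g i)) \<in> M" using row[OF h] by blast
    let ?s = "\<Sum>i\<in>UNIV. ?P i (g i)"
    have s: "?s \<in> HD" using g by (intro D.Hsum coord_shift_in)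
    have "cmod (ipD h x) \<le> (\<Sum>i\<in>UNIV. D.nrm (g i))" if x: "x \<in> X" for x
    proof -
      have xH: "x \<in> HD" using x by (simp add: X_def)
      have "ipD (h - ?s) x = 0" using x g(2) by (simp add: X_def)
      then have "ipD h x = ipD ?s x" using h s xH by (simp add: D.ip_diff_left)
      also have "\<dots> = (\<Sum>i\<in>UNIV. ipD (?P i (g i)) x)"
        using g xH by (intro D.ip_sum_left coord_shift_in) auto
      also have "cmod \<dots> \<le> (\<Sum>i\<in>UNIV. D.nrm (g i))"
        using x g by (intro sum_norm_le) (auto simp: X_def)
      finally show ?thesis .
    qed
    then show "\<exists>B. \<forall>x\<in>X. cmod (ipD h x) \<le> B" by blast
  qed
  then obtain C0 where C0: "\<And>x. x \<in> X \<Longrightarrow> D.nrm x \<le> C0" by blast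
  define C where "C = \<bar>C0\<bar> + 1"
  have C: "C > 0" by (simp add: C_def)
  have pos: "D.nrm x \<le> C * r" if x: "x \<in> HD" "\<forall>m\<in>M. ipD m x = 0"
    "\<And>i h. h \<in> HD \<Longrightarrow> cmod (ipD (?P i h) x) \<le> r * D.nrm h" "r > 0" for x r
  proof -
    let ?y = "complex_of_real (1 / r) *\<^sub>C x"
    have "?y \<in> X"
      unfolding X_def
    proof (intro CollectI conjI ballI allI)
      show "ipD m ?y = 0" if "m \<in> M" for m
        using x(1,2) that M_sub by (auto simp: D.ip_scaleC_right)
      show "cmod (ipD (?P i h) ?y) \<le> D.nrm h" if h: "h \<in> HD" for i h
        using x(1,4) x(3)[OF h, of i] coord_shift_in[OF h]
        by (simp add: D.ip_scaleC_right norm_divide field_simps)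
    qed (use x in simp)
    then have "D.nrm ?y \<le> C" using C0[of ?y] by (simp add: C_def)
    then show ?thesis using x by (simp add: D.nrm_scaleC norm_divide field_simps)
  qed
  show thesis
  proof (rule that[OF C], unfold adjoint_row_below_def, intro ballI allI impI)
    fix x r assume x: "x \<in> HD" "\<forall>m\<in>M. ipD m x = 0" and r: "0 \<le> r"
      and "\<forall>i. \<forall>h\<in>HD. cmod (ipD (?P i h) x) \<le> r * D.nrm h"
    then have bd: "cmod (ipD (?P i h) x) \<le> r * D.nrm h" if "h \<in> HD" for i h using that by blast
    show "D.nrm x \<le> C * r"
    \<comment> \<open>Scaling by \<open>1 / r\<close> excludes \<open>r = 0\<close>, so the bound is
      applied to \<open>r + e / C\<close>.\<close>
    proof (rule field_le_epsilon)
      fix e :: real assume e: "e > 0"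
      have "D.nrm x \<le> C * (r + e / C)"
      proof (rule pos[OF x(1,2)])
        show "r + e / C > 0" using r e C by (simp add: add_nonneg_pos)
        fix i h assume h: "h \<in> HD"
        have "0 \<le> e / C * D.nrm h" using e C h by simp
        then show "cmod (ipD (?P i h) x) \<le> (r + e / C) * D.nrm h"
          using bd[OF h, of i] by (simp add: distrib_right)
      qed
      then show "D.nrm x \<le> C * r + e" using C by (simp add: distrib_left)
    qed
  qed
qed

text \<open>Replacing \<open>l\<close> by \<open>w\<close> changes each adjoint by at most
  \<open>dist w l\<close> in norm. For distance below \<open>1 / (2 * C)\<close> half of
  \<open>D.nrm x\<close> can be absorbed, at the price of doubling the constant.\<close>

lemma bounded_below_near:
  obtains \<delta> C where "\<delta> > 0" "C > 0" "\<And>w. dist w l < \<delta> \<Longrightarrow> adjoint_row_below w C"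
proof -
  obtain C where C: "C > 0" "adjoint_row_below l C" by (rule bounded_below)
  have main: "D.nrm x \<le> 2 * C * r" if d: "dist w l < 1 / (2 * C)" and x: "x \<in> HD" "\<forall>m\<in>M. ipD m x = 0"
      and r: "\<And>i h. h \<in> HD \<Longrightarrow> cmod (ipD (pmul (\<lambda>z. z $ i - w $ i) h) x) \<le> r * D.nrm h" "r \<ge> 0"
    for w x r
  proof -
    have "D.nrm x \<le> C * (r + dist w l * D.nrm x)"
    proof (rule adjoint_row_belowD[OF C(2) x])
      fix i h assume h: "h \<in> HD"
      have "pmul (\<lambda>z. z $ i - l $ i) h = pmul (\<lambda>z. z $ i - w $ i) h + (w $ i - l $ i) *\<^sub>C h"
        by (simp add: fun_eq_iff flip: scaleC_add_left)
      then have "ipD (pmul (\<lambda>z. z $ i - l $ i) h) x =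
          ipD (pmul (\<lambda>z. z $ i - w $ i) h) x + (w $ i - l $ i) * ipD h x"
        using h x coord_shift_in[OF h] by (simp only: D.hs.ip_add_left D.hs.ip_scaleC_left D.Hscale)
      then have "cmod (ipD (pmul (\<lambda>z. z $ i - l $ i) h) x) \<le>
          cmod (ipD (pmul (\<lambda>z. z $ i - w $ i) h) x) + cmod (w $ i - l $ i) * cmod (ipD h x)"
        by (metis norm_mult norm_triangle_ineq)
      also have "\<dots> \<le> r * D.nrm h + dist w l * (D.nrm h * D.nrm x)"
      proof (intro add_mono mult_mono r h D.cauchy_schwarz x)
        show "cmod (w $ i - l $ i) \<le> dist w l"
          using Finite_Cartesian_Product.norm_nth_le[of "w - l" i] by (simp add: dist_norm)
      qed auto
      finally show "cmod (ipD (pmul (\<lambda>z. z $ i - l $ i) h) x) \<le> (r + dist w l * D.nrm x) * D.nrm h"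
        by (simp add: algebra_simps)
    qed (use r x in simp)
    moreover have "C * (dist w l * D.nrm x) \<le> 1 / 2 * D.nrm x"
    proof -
      have "C * dist w l \<le> 1 / 2" using d C by (simp add: field_simps)
      then have "C * dist w l * D.nrm x \<le> 1 / 2 * D.nrm x" using x by (intro mult_right_mono) auto
      then show ?thesis by (simp add: mult.assoc)
    qed
    ultimately show "D.nrm x \<le> 2 * C * r" by (simp add: distrib_left)
  qed
  show thesis
    by (rule that[of "1 / (2 * C)" "2 * C"])
      (use C main in \<open>auto simp: adjoint_row_below_def\<close>)
qed

lemma model_bounded:
  obtains \<delta> C where "\<delta> > 0" "C > 0"
    "\<And>w d g t. w \<in> ball 0 1 \<Longrightarrow> dist w l < \<delta> \<Longrightarrow> model w d g t \<Longrightarrow> D.nrm g \<le> C * norm d"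
proof -
  obtain \<delta> C where C: "\<delta> > 0" "C > 0" "\<And>w. dist w l < \<delta> \<Longrightarrow> adjoint_row_below w C"
    by (rule bounded_below_near) (rule that)
  have b1: "b 1 > 0" using D.b_1 by simp
  \<comment> \<open>\<open>2 / b 1\<close> comes from \<open>coord_coercive\<close>, and
    \<open>C\<^sup>2\<close> from squaring the lower bound of the adjoint row.\<close>
  define K where "K = C\<^sup>2 * (2 / b 1)"
  have K: "K > 0" using C b1 by (simp add: K_def)
  show thesis
  proof (rule that[OF C(1) K])
    fix w d g t assume w: "w \<in> ball 0 1" "dist w l < \<delta>" and m: "model w d g t"
    let ?N = "pmul (\<lambda>z. 1 / k z w)"
    have g: "g \<in> HD" "\<forall>m\<in>M. ipD m g = 0" "D.kf w d - g \<in> M" using m by (auto simp: model_def)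
    have Ng: "?N g \<in> HD" using D.inverse_k_bounded(1) g w by blast
    define R where "R = Re (ipD (?N g) g)"
    have "?N (D.kf w d - g) \<in> M" using N_in_M w g by blast
    then have "ipD (D.kf 0 d - ?N g) g = 0"
      using g w by (simp add: pmul_diff D.inverse_k_kf)
    then have "ipD (?N g) g = ipD (D.kf 0 d) g"
      using g Ng by (simp add: D.ip_diff_left)
    then have Rle: "R \<le> norm d * D.nrm g"
      using D.Re_ip_le[of "D.kf 0 d" g] g by (simp add: R_def nrm_kf_0)
    show "D.nrm g \<le> K * norm d"
    proof (cases "D.nrm g = 0")
      case True
      then show ?thesis using K by simp
    next
      case False
      then have gpos: "D.nrm g > 0" using D.nrm_nonneg[OF g(1)] by linarith
      have co: "b 1 * (cmod (ipD (pmul (\<lambda>z. z $ i - w $ i) h) g))\<^sup>2 \<le> 2 * R * (D.nrm h)\<^sup>2"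
        if "h \<in> HD" for i h
        using D.coord_coercive[OF g(1) that w(1)] by (simp add: R_def)
      have "0 \<le> b 1 * (cmod (ipD (pmul (\<lambda>z. z $ i - w $ i) g) g))\<^sup>2" for i using b1 by simp
      then have "0 \<le> 2 * R * (D.nrm g)\<^sup>2" using co[OF g(1)] order_trans by blast
      \<comment> \<open>Coercivity tested at \<open>h = g\<close> gives this sign, without which the
        square root below would carry no information.\<close>
      then have R0: "R \<ge> 0" using gpos by (simp add: zero_le_mult_iff)
      have "D.nrm g \<le> C * sqrt (2 / b 1 * R)"
      proof (rule adjoint_row_belowD[OF C(3)[OF w(2)] g(1,2)])
        fix i h assume h: "h \<in> HD"
        show "cmod (ipD (pmul (\<lambda>z. z $ i - w $ i) h) g) \<le> sqrt (2 / b 1 * R) * D.nrm h"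
        proof (rule power2_le_imp_le)
          show "(cmod (ipD (pmul (\<lambda>z. z $ i - w $ i) h) g))\<^sup>2 \<le> (sqrt (2 / b 1 * R) * D.nrm h)\<^sup>2"
            using co[OF h, of i] b1 R0 by (simp add: field_simps)
        qed (use R0 b1 h in simp)
      qed (use R0 b1 in simp)
      then have "(D.nrm g)\<^sup>2 \<le> (C * sqrt (2 / b 1 * R))\<^sup>2" using g by (intro power_mono) auto
      also have "\<dots> = K * R" using R0 b1 by (simp add: K_def power_mult_distrib)
      also have "\<dots> \<le> K * (norm d * D.nrm g)" using K Rle by (intro mult_left_mono) auto
      finally have "D.nrm g * D.nrm g \<le> (K * norm d) * D.nrm g" by (simp add: power2_eq_square mult_ac)
      then show ?thesis using gpos by simp
    qed
  qed
qed

lemma adjoint_cauchy: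
  assumes e: "e > 0"
  obtains \<delta> where "\<delta> > 0" "\<And>z w d g t g' t'. z \<in> ball 0 1 \<Longrightarrow> w \<in> ball 0 1 \<Longrightarrow> dist z l < \<delta> \<Longrightarrow>
    dist w l < \<delta> \<Longrightarrow> model w d g t \<Longrightarrow> model z d g' t' \<Longrightarrow> norm (t' - t) \<le> e * norm d"
proof -
  obtain \<delta> C where C: "\<delta> > 0" "C > 0"
    "\<And>w d g t. w \<in> ball 0 1 \<Longrightarrow> dist w l < \<delta> \<Longrightarrow> model w d g t \<Longrightarrow> D.nrm g \<le> C * norm d"
    by (rule model_bounded) (rule that)
  \<comment> \<open>Three error terms of size \<open>2 * e' * (C * norm d)\<^sup>2\<close> then add
    up to \<open>(e * norm d)\<^sup>2\<close>.\<close>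
  define e' where "e' = e\<^sup>2 / (6 * C\<^sup>2)"
  have e': "e' > 0" using e C by (simp add: e'_def)
  obtain \<delta>' where \<delta>': "\<delta>' > 0" "\<And>z w. z \<in> ball 0 1 \<Longrightarrow> w \<in> ball 0 1 \<Longrightarrow> dist z l < \<delta>' \<Longrightarrow> dist w l < \<delta>' \<Longrightarrow>
    cmod (D.\<phi> z w - D.\<Phi> (cinner l l)) < e'"
    by (rule D.\<phi>_near[OF l e']) (rule that)
  show thesis
  proof (rule that[of "min \<delta> \<delta>'"])
    fix z w d g t g' t'
    assume zw: "z \<in> ball 0 1" "w \<in> ball 0 1" and near: "dist z l < min \<delta> \<delta>'" "dist w l < min \<delta> \<delta>'"
      and m: "model w d g t" "model z d g' t'"
    let ?q = "\<lambda>z w. 1 - D.\<phi> z w"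
    have gH: "g \<in> HD" "g' \<in> HD" using m by (auto simp: model_def)
    have gb: "D.nrm g \<le> C * norm d" "D.nrm g' \<le> C * norm d"
      using C(3)[OF zw(2) _ m(1)] C(3)[OF zw(1) _ m(2)] near by auto
    have qd: "cmod (?q u v - ?q w w) \<le> 2 * e'" if "u \<in> {z, w}" "v \<in> {z, w}" for u v
    proof -
      have "cmod (D.\<phi> u v - D.\<Phi> (cinner l l)) < e'" "cmod (D.\<phi> w w - D.\<Phi> (cinner l l)) < e'"
        using that zw near by (auto intro!: \<delta>'(2))
      then have "cmod ((D.\<phi> w w - D.\<Phi> (cinner l l)) - (D.\<phi> u v - D.\<Phi> (cinner l l))) \<le> 2 * e'"
        using norm_triangle_ineq4[of "D.\<phi> w w - D.\<Phi> (cinner l l)" "D.\<phi> u v - D.\<Phi> (cinner l l)"] by linarith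
      then show ?thesis by simp
    qed
    have ib: "cmod (ipD u v) \<le> (C * norm d)\<^sup>2" if "u \<in> {g, g'}" "v \<in> {g, g'}" for u v
    proof -
      have "cmod (ipD u v) \<le> D.nrm u * D.nrm v" using that gH by (intro D.cauchy_schwarz) auto
      also have "\<dots> \<le> (C * norm d) * (C * norm d)" using that gb gH C by (intro mult_mono) auto
      finally show ?thesis by (simp add: power2_eq_square)
    qed
    have qi: "cmod ((?q u v - ?q w w) * ipD x y) \<le> 2 * e' * (C * norm d)\<^sup>2"
      if "u \<in> {z, w}" "v \<in> {z, w}" "x \<in> {g, g'}" "y \<in> {g, g'}" for u v x y
      unfolding norm_mult using qd[OF that(1,2)] ib[OF that(3,4)] e' by (intro mult_mono) auto
    obtain r where r: "r < 1" "D.\<phi> w w = complex_of_real r" using D.\<phi>_diag[OF zw(2)] .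
    let ?x = "(?q z z - ?q w w) * ipD g' g'" and ?y = "(?q w z - ?q w w) * ipD g' g"
      and ?z = "(?q z w - ?q w w) * ipD g g'"
    have nd: "ipD (g' - g) (g' - g) = complex_of_real ((D.nrm (g' - g))\<^sup>2)"
      using gH by (intro D.ip_self) simp
    have "cinner (t' - t) (t' - t) = cinner t' t' - cinner t' t - cinner t t' + cinner t t"
      by (simp add: cinner_diff_left cinner_diff_right)
    \<comment> \<open>All four Gram entries are compared with the coefficient at
      \<open>(w, w)\<close>, so that the common part collects into one square with a favourable
      sign.\<close>
    also have "\<dots> = - (?q w w * ipD (g' - g) (g' - g)) - ?x + ?y + ?z"
      unfolding model_gram[OF m zw(2,1)] model_gram[OF m(2,1) zw] model_gram[OF m(1,1) zw(2,2)]
        model_gram[OF m(2,2) zw(1,1)]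
      using gH by (simp add: D.ip_simps algebra_simps)
    finally have eq: "cinner (t' - t) (t' - t) = complex_of_real (- ((1 - r) * (D.nrm (g' - g))\<^sup>2)) - ?x + ?y + ?z"
      unfolding nd r(2) by simp
    have "(norm (t' - t))\<^sup>2 = Re (cinner (t' - t) (t' - t))" by (simp add: cinner_self)
    also have "\<dots> = - ((1 - r) * (D.nrm (g' - g))\<^sup>2) - Re ?x + Re ?y + Re ?z"
      unfolding eq by (simp only: plus_complex.simps minus_complex.simps Re_complex_of_real)
    also have "\<dots> \<le> 0 + 2 * e' * (C * norm d)\<^sup>2 + 2 * e' * (C * norm d)\<^sup>2 + 2 * e' * (C * norm d)\<^sup>2"
    proof -
      have Re_le: "- Re c \<le> B" "Re c \<le> B" if "cmod c \<le> B" for c B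
        using abs_Re_le_cmod[of c] that by linarith+
      have "(1 - r) * (D.nrm (g' - g))\<^sup>2 \<ge> 0" using r by simp
      moreover have "- Re ?x \<le> 2 * e' * (C * norm d)\<^sup>2" by (rule Re_le, rule qi) simp_all
      moreover have "Re ?y \<le> 2 * e' * (C * norm d)\<^sup>2" by (rule Re_le, rule qi) simp_all
      moreover have "Re ?z \<le> 2 * e' * (C * norm d)\<^sup>2" by (rule Re_le, rule qi) simp_all
      ultimately show ?thesis by linarith
    qed
    also have "\<dots> = (e * norm d)\<^sup>2" using C by (simp add: e'_def field_simps)
    finally have "(norm (t' - t))\<^sup>2 \<le> (e * norm d)\<^sup>2" .
    then show "norm (t' - t) \<le> e * norm d" by (rule power2_le_imp_le) (simp add: less_imp_le[OF e])
  next
    show "min \<delta> \<delta>' > 0" using C(1) \<delta>'(1) by simp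
  qed
qed

lemma \<theta>_cauchy:
  assumes e: "e > 0"
  obtains \<delta> where "\<delta> > 0" "\<And>z w. z \<in> ball 0 1 \<Longrightarrow> w \<in> ball 0 1 \<Longrightarrow> dist z l < \<delta> \<Longrightarrow>
    dist w l < \<delta> \<Longrightarrow> norm (\<theta> z - \<theta> w) \<le> e"
proof -
  obtain \<delta> where \<delta>: "\<delta> > 0" "\<And>z w d g t g' t'. z \<in> ball 0 1 \<Longrightarrow> w \<in> ball 0 1 \<Longrightarrow> dist z l < \<delta> \<Longrightarrow>
    dist w l < \<delta> \<Longrightarrow> model w d g t \<Longrightarrow> model z d g' t' \<Longrightarrow> norm (t' - t) \<le> e * norm d"
    by (rule adjoint_cauchy[OF e]) (rule that)
  show thesis
  proof (rule that[OF \<delta>(1)])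
    fix z w assume zw: "z \<in> ball 0 1" "w \<in> ball 0 1" and near: "dist z l < \<delta>" "dist w l < \<delta>"
    show "norm (\<theta> z - \<theta> w) \<le> e"
    proof (rule norm_blinfun_bound)
      fix x
      \<comment> \<open>Testing the adjoints at this very vector turns \<open>cinner d d\<close>
        into \<open>cinner x (t' - t)\<close>, which carries the adjoint estimate over to the
        operator norm.\<close>
      define d where "d = blinfun_apply (\<theta> z - \<theta> w) x"
      obtain g t where m: "model w d g t" using model_ex[OF zw(2)] by blast
      obtain g' t' where m': "model z d g' t'" using model_ex[OF zw(1)] by blast
      have "cinner d d = cinner (\<theta> z x) d - cinner (\<theta> w x) d"
        by (simp add: d_def blinfun.diff_left cinner_diff_left)
      also have "\<dots> = cinner x (t' - t)"
        using m m' by (simp add: model_def cinner_diff_right)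
      finally have "(norm d)\<^sup>2 \<le> norm x * norm (t' - t)"
        using cinner_le_norm[of x "t' - t"] by (metis norm_cinner_self)
      also have "\<dots> \<le> norm x * (e * norm d)"
        using \<delta>(2)[OF zw near m m'] by (intro mult_left_mono) auto
      finally have "norm d * norm d \<le> (e * norm x) * norm d" by (simp add: power2_eq_square mult_ac)
      then have "norm d \<le> e * norm x" using e by (cases "norm d = 0") auto
      then show "norm (blinfun_apply (\<theta> z - \<theta> w) x) \<le> e * norm x" by (simp add: d_def)
    qed (use e in simp)
  qed
qed

lemma limit_exists: "\<exists>L. (\<theta> \<longlongrightarrow> L) (at l within ball 0 1)"
proof -
  have "l \<in> closure (ball 0 1)" using l by simp
  then obtain w where w: "\<And>n. w n \<in> ball 0 1" "w \<longlonglongrightarrow> l" unfolding closure_sequential by blast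
  have wl: "\<exists>N. \<forall>n\<ge>N. dist (w n) l < \<delta>" if "\<delta> > 0" for \<delta>
    using w(2) that unfolding lim_sequentially by blast
  have "Cauchy (\<lambda>n. \<theta> (w n))"
  proof (rule metric_CauchyI)
    fix e :: real assume "e > 0"
    then have "e / 2 > 0" by simp
    then obtain \<delta> where \<delta>: "\<delta> > 0" "\<And>z w. z \<in> ball 0 1 \<Longrightarrow> w \<in> ball 0 1 \<Longrightarrow> dist z l < \<delta> \<Longrightarrow>
      dist w l < \<delta> \<Longrightarrow> norm (\<theta> z - \<theta> w) \<le> e / 2"
      by (rule \<theta>_cauchy) (rule that)
    obtain N where "\<forall>n\<ge>N. dist (w n) l < \<delta>" using wl[OF \<delta>(1)] by blast
    then have "\<forall>m\<ge>N. \<forall>n\<ge>N. norm (\<theta> (w m) - \<theta> (w n)) \<le> e / 2" using \<delta>(2) w by blast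
    moreover have "e / 2 < e" using \<open>e > 0\<close> by simp
    ultimately show "\<exists>N. \<forall>m\<ge>N. \<forall>n\<ge>N. dist (\<theta> (w m)) (\<theta> (w n)) < e"
      unfolding dist_norm by (meson le_less_trans)
  qed
  then obtain L where L: "(\<lambda>n. \<theta> (w n)) \<longlonglongrightarrow> L" using Cauchy_convergent convergent_def by blast
  \<comment> \<open>The sequence only supplies the candidate \<open>L\<close>; the Cauchy estimate
    holds for all pairs of points near \<open>l\<close> and upgrades this to the full limit.\<close>
  have "(\<theta> \<longlongrightarrow> L) (at l within ball 0 1)"
    unfolding Lim_within
  proof (intro allI impI)
    fix e :: real assume "e > 0"
    then have "e / 2 > 0" by simp
    then obtain \<delta> where \<delta>: "\<delta> > 0" "\<And>z w. z \<in> ball 0 1 \<Longrightarrow> w \<in> ball 0 1 \<Longrightarrow> dist z l < \<delta> \<Longrightarrow>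
      dist w l < \<delta> \<Longrightarrow> norm (\<theta> z - \<theta> w) \<le> e / 2"
      by (rule \<theta>_cauchy) (rule that)
    obtain N where N: "\<forall>n\<ge>N. dist (w n) l < \<delta>" using wl[OF \<delta>(1)] by blast
    obtain N' where N': "\<forall>n\<ge>N'. dist (\<theta> (w n)) L < e / 2"
      using L \<open>e / 2 > 0\<close> unfolding lim_sequentially by blast
    define n where "n = max N N'"
    have "dist (\<theta> z) L < e" if z: "z \<in> ball 0 1" "dist z l < \<delta>" for z
    proof -
      have "dist (\<theta> z) (\<theta> (w n)) \<le> e / 2"
        unfolding dist_norm using N z w by (intro \<delta>(2)) (auto simp: n_def)
      moreover have "dist (\<theta> (w n)) L < e / 2" using N' by (simp add: n_def)
      ultimately show ?thesis using dist_triangle[of "\<theta> z" L "\<theta> (w n)"] by linarith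
    qed
    then show "\<exists>d>0. \<forall>x\<in>ball 0 1. 0 < dist x l \<and> dist x l < d \<longrightarrow> dist (\<theta> x) L < e"
      using \<delta>(1) by blast
  qed
  then show ?thesis ..
qed

text \<open>Split \<open>D.kf z d\<close> into \<open>g\<close> and \<open>p\<close> in
  \<open>M\<close>. The adjoint of each \<open>M\<^sub>z\<^sub>i - z\<^sub>i\<close> kills the sum,
  so the adjoint row at \<open>g\<close> is controlled by \<open>p\<close>, and with it
  \<open>g\<close> itself.\<close>

lemma adjoint_bounded_below:
  obtains \<delta> K where "\<delta> > 0" "K > 0"
    "\<And>z d g t. z \<in> ball 0 1 \<Longrightarrow> dist z l < \<delta> \<Longrightarrow> model z d g t \<Longrightarrow> norm d \<le> K * norm t"
proof -
  obtain \<delta> C where C: "\<delta> > 0" "C > 0" "\<And>w. dist w l < \<delta> \<Longrightarrow> adjoint_row_below w C"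
    by (rule bounded_below_near) (rule that)
  \<comment> \<open>Bounds the norm of multiplication by \<open>u $ i - z $ i\<close>: the root for
    the coordinate, and 1 for \<open>z $ i\<close>.\<close>
  define B where "B = sqrt (1 / b 1) + 1"
  have B: "B > 0" using D.b_1 by (simp add: B_def add_nonneg_pos)
  define K where "K = C * B + 1"
  have K: "K > 0" using C B by (simp add: K_def add_pos_pos)
  show thesis
  proof (rule that[OF C(1) K])
    fix z d g t assume z: "z \<in> ball 0 1" "dist z l < \<delta>" and m: "model z d g t"
    define p where "p = D.kf z d - g"
    have g: "g \<in> HD" "\<forall>m\<in>M. ipD m g = 0" "p \<in> M" using m by (auto simp: model_def p_def)
    have p: "p \<in> HD" using g M_sub by auto
    have "D.nrm g \<le> C * (B * D.nrm p)"
    proof (rule adjoint_row_belowD[OF C(3)[OF z(2)] g(1,2)])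
      fix i h assume h: "h \<in> HD"
      let ?h = "pmul (\<lambda>u. u $ i - z $ i) h"
      have hH: "?h \<in> HD" using coord_shift_in[OF h] .
      have "ipD ?h (D.kf z d) = 0" using D.ip_kf[OF hH z(1)] by simp
      then have "ipD ?h g = - ipD ?h p"
        using hH g z by (simp add: p_def D.ip_diff_right)
      then have "cmod (ipD ?h g) \<le> D.nrm ?h * D.nrm p"
        using D.cauchy_schwarz[OF hH p] by simp
      also have "\<dots> \<le> (B * D.nrm h) * D.nrm p"
      proof (rule mult_right_mono)
        have "D.nrm ?h \<le> D.nrm (pmul (\<lambda>u. u $ i) h) + D.nrm (- ((z $ i) *\<^sub>C h))"
          unfolding coord_shift using D.nrm_triangle[of "pmul (\<lambda>u. u $ i) h" "- ((z $ i) *\<^sub>C h)"]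
            D.coord_bounded(1)[OF h] h by simp
        also have "\<dots> \<le> sqrt (1 / b 1) * D.nrm h + 1 * D.nrm h"
        proof (intro add_mono D.coord_bounded h)
          have "cmod (z $ i) \<le> 1"
            using Finite_Cartesian_Product.norm_nth_le[of z i] z by simp
          then show "D.nrm (- ((z $ i) *\<^sub>C h)) \<le> 1 * D.nrm h"
            using h by (simp add: D.nrm_minus D.nrm_scaleC mult_left_le_one_le)
        qed
        finally show "D.nrm ?h \<le> B * D.nrm h" by (simp add: B_def distrib_right)
      qed (use p in simp)
      finally show "cmod (ipD ?h g) \<le> B * D.nrm p * D.nrm h" by (simp add: mult_ac)
    qed (use B p in simp)
    moreover have "D.nrm (D.kf z d) \<le> D.nrm g + D.nrm p"
      using D.nrm_triangle[OF g(1) p] by (simp add: p_def)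
    ultimately have "D.nrm (D.kf z d) \<le> K * D.nrm p" by (simp add: K_def algebra_simps)
    then have le: "(D.nrm (D.kf z d))\<^sup>2 \<le> (K * D.nrm p)\<^sup>2" using z by (intro power_mono) auto
    obtain r where r: "r \<ge> 1" "k z z = complex_of_real r" using D.k_diag[OF z(1)] by blast
    have "complex_of_real ((D.nrm (D.kf z d))\<^sup>2) = complex_of_real (r * (norm d)\<^sup>2)"
      using D.nrm_kf_sq[OF z(1), of d] r by (simp add: cinner_self)
    then have nk: "(D.nrm (D.kf z d))\<^sup>2 = r * (norm d)\<^sup>2" by (simp only: of_real_eq_iff)
    have "complex_of_real ((D.nrm p)\<^sup>2) = ipD p p" using p by (simp add: D.ip_self)
    also have "\<dots> = ipD p (D.kf z d)"
      using g p z by (simp add: p_def D.ip_diff_right)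
    also have "\<dots> = k z z * cinner (\<theta> z t) d"
      using m z p by (simp add: D.ip_kf model_def p_def cinner_scaleC_left)
    also have "cinner (\<theta> z t) d = cinner t t" using m by (simp add: model_def)
    finally have "complex_of_real ((D.nrm p)\<^sup>2) = complex_of_real (r * (norm t)\<^sup>2)"
      using r by (simp add: cinner_self)
    then have np: "(D.nrm p)\<^sup>2 = r * (norm t)\<^sup>2" by (simp only: of_real_eq_iff)
    \<comment> \<open>The possibly large factor \<open>r = k z z\<close> occurs in the squared norms
      of both \<open>D.kf z d\<close> and \<open>p\<close>, and cancels.\<close>
    have "r * (norm d)\<^sup>2 \<le> r * (K * norm t)\<^sup>2"
      using le nk np by (simp add: power_mult_distrib mult_ac)
    then have "(norm d)\<^sup>2 \<le> (K * norm t)\<^sup>2" using r by (simp add: mult_le_cancel_left)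
    then show "norm d \<le> K * norm t" by (rule power2_le_imp_le) (use K in simp)
  qed
qed

text \<open>The lower bound of the adjoints passes to the adjoint of \<open>L\<close>, and an
  operator whose adjoint is bounded below is onto.\<close>

lemma limit_surj:
  assumes L: "(\<theta> \<longlongrightarrow> L) (at l within ball 0 1)"
  shows "surj (blinfun_apply L)"
proof -
  have nontriv: "at l within ball 0 1 \<noteq> bot"
    using l by (simp add: trivial_limit_within islimpt_ball)
  \<comment> \<open>The operator type gives only real linearity, while the Riesz argument for the
    adjoint needs complex linearity.\<close>
  have L_scaleC: "L (c *\<^sub>C x) = c *\<^sub>C L x" for c x
  proof (rule tendsto_unique[OF nontriv])
    show "((\<lambda>z. \<theta> z (c *\<^sub>C x)) \<longlongrightarrow> L (c *\<^sub>C x)) (at l within ball 0 1)"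
      using L by (intro tendsto_intros)
    have "((\<lambda>z. c *\<^sub>C \<theta> z x) \<longlongrightarrow> c *\<^sub>C L x) (at l within ball 0 1)"
      using L by (intro bounded_linear.tendsto[OF bounded_linear_scaleC] tendsto_intros)
    then show "((\<lambda>z. \<theta> z (c *\<^sub>C x)) \<longlongrightarrow> c *\<^sub>C L x) (at l within ball 0 1)"
      by (rule Lim_transform_eventually) (auto simp: eventually_at_filter \<theta>_scaleC)
  qed
  interpret UE: chilbert_on "UNIV :: 'e set" cinner by (rule chilbert_on_UNIV)
  have adj_ex: "\<exists>t. \<forall>x. cinner (L x) d = cinner x t" for d
  proof -
    define G where "G = range (\<lambda>x. (x, cinner (L x) d))"
    obtain t where t: "\<And>x c. (x, c) \<in> G \<Longrightarrow> c = cinner x t"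
    proof (rule UE.riesz_graph[of G "norm L * norm d"])
      show "cmod c \<le> norm L * norm d * hnorm cinner x" if "(x, c) \<in> G" for x c
      proof -
        have "cmod (cinner (L x) d) \<le> norm (L x) * norm d" by (rule cinner_le_norm)
        also have "\<dots> \<le> (norm L * norm x) * norm d" by (intro mult_right_mono norm_blinfun) simp
        finally show ?thesis using that by (auto simp: G_def hnorm_cinner mult_ac)
      qed
    qed (auto simp: G_def blinfun.add_right L_scaleC cinner_add_left cinner_scaleC_left)
    have "cinner (L x) d = cinner x t" for x by (rule t) (simp add: G_def)
    then show ?thesis by blast
  qed
  obtain \<delta> K where K: "\<delta> > 0" "K > 0"
    "\<And>z d g t. z \<in> ball 0 1 \<Longrightarrow> dist z l < \<delta> \<Longrightarrow> model z d g t \<Longrightarrow> norm d \<le> K * norm t"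
    by (rule adjoint_bounded_below) (rule that)
  \<comment> \<open>Choose \<open>z\<close> with \<open>\<theta> z\<close> within
    \<open>1 / (2 * K)\<close> of \<open>L\<close>. The adjoint vectors then differ by at most
    \<open>norm d / (2 * K)\<close>, which costs half of \<open>norm d\<close>.\<close>
  have below: "norm d \<le> 2 * K * norm t" if t: "\<And>x. cinner (L x) d = cinner x t" for d t
  proof -
    have "\<forall>\<^sub>F z in at l within ball 0 1. dist (\<theta> z) L < 1 / (2 * K)"
      using L K by (intro tendstoD) auto
    moreover have "\<forall>\<^sub>F z in at l within ball 0 1. dist z l < \<delta>"
      using K(1) by (auto simp: eventually_at)
    moreover have "\<forall>\<^sub>F z in at l within ball 0 1. z \<in> ball 0 1"
      by (simp add: eventually_at_filter)
    ultimately have "\<forall>\<^sub>F z in at l within ball 0 1. dist (\<theta> z) L < 1 / (2 * K) \<and> dist z l < \<delta> \<and> z \<in> ball 0 1"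
      by (intro eventually_conj)
    then obtain z where z: "dist (\<theta> z) L < 1 / (2 * K)" "dist z l < \<delta>" "z \<in> ball 0 1"
      using eventually_happens'[OF nontriv] by blast
    obtain g s where m: "model z d g s" using model_ex[OF z(3)] by blast
    have "cinner (s - t) (s - t) = cinner (\<theta> z (s - t)) d - cinner (L (s - t)) d"
      using m t[of "s - t"] by (simp add: model_def cinner_diff_right)
    also have "\<dots> = cinner (blinfun_apply (\<theta> z - L) (s - t)) d"
      by (simp add: blinfun.diff_left cinner_diff_left)
    finally have "(norm (s - t))\<^sup>2 \<le> norm (blinfun_apply (\<theta> z - L) (s - t)) * norm d"
      using cinner_le_norm[of "blinfun_apply (\<theta> z - L) (s - t)" d]
      by (metis norm_cinner_self)
    also have "\<dots> \<le> (norm (\<theta> z - L) * norm (s - t)) * norm d"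
      by (intro mult_right_mono norm_blinfun) simp
    also have "\<dots> \<le> (1 / (2 * K) * norm (s - t)) * norm d"
      using z(1) by (intro mult_right_mono) (auto simp: dist_norm)
    finally have *: "norm (s - t) * norm (s - t) \<le> (norm d / (2 * K)) * norm (s - t)"
      by (simp add: power2_eq_square mult_ac)
    have "norm (s - t) \<le> norm d / (2 * K)"
    proof (cases "s = t")
      case False
      then show ?thesis by (intro mult_right_le_imp_le[OF *]) simp
    qed (use K in simp)
    moreover have "norm s \<le> norm t + norm (s - t)" using norm_triangle_ineq[of t "s - t"] by simp
    ultimately have "K * norm s \<le> K * (norm t + norm d / (2 * K))" using K by (intro mult_left_mono) auto
    also have "\<dots> = K * norm t + norm d / 2" using K by (simp add: field_simps)
    finally show ?thesis using K(3)[OF z(3,2) m] by simp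
  qed
  have "\<exists>x. y = L x" for y
  proof -
    \<comment> \<open>The functional sending the adjoint value \<open>t\<close> of \<open>d\<close>
      to \<open>cinner d y\<close>, on the range of the adjoint; \<open>below\<close> makes it
      bounded. The vector that represents it is a preimage of \<open>y\<close>.\<close>
    define G where "G = {(t, cinner d y) |t d. \<forall>x. cinner (L x) d = cinner x t}"
    obtain x where x: "\<And>t c. (t, c) \<in> G \<Longrightarrow> c = cinner t x"
    proof (rule UE.riesz_graph[of G "2 * K * norm y"])
      show "(0, 0) \<in> G" unfolding G_def by (auto intro!: exI[of _ 0])
      show "(t + t', c + c') \<in> G" if "(t, c) \<in> G" "(t', c') \<in> G" for t c t' c'
      proof -
        obtain d d' where "\<forall>x. cinner (L x) d = cinner x t" "\<forall>x. cinner (L x) d' = cinner x t'"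
          "c = cinner d y" "c' = cinner d' y" using \<open>(t, c) \<in> G\<close> \<open>(t', c') \<in> G\<close> by (auto simp: G_def)
        then show ?thesis unfolding G_def
          by (auto simp: cinner_add_left cinner_add_right intro!: exI[of _ "d + d'"])
      qed
      show "(a *\<^sub>C t, a * c) \<in> G" if "(t, c) \<in> G" for a t c
      proof -
        obtain d where "\<forall>x. cinner (L x) d = cinner x t" "c = cinner d y"
          using \<open>(t, c) \<in> G\<close> by (auto simp: G_def)
        then show ?thesis unfolding G_def
          by (auto simp: cinner_scaleC_left cinner_scaleC_right intro!: exI[of _ "a *\<^sub>C d"])
      qed
      show "cmod c \<le> 2 * K * norm y * hnorm cinner t" if "(t, c) \<in> G" for t c
      proof -
        obtain d where d: "\<And>x. cinner (L x) d = cinner x t" "c = cinner d y"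
          using \<open>(t, c) \<in> G\<close> by (auto simp: G_def)
        have "cmod c \<le> norm d * norm y" unfolding d(2) by (rule cinner_le_norm)
        also have "\<dots> \<le> (2 * K * norm t) * norm y" using below[OF d(1)] by (intro mult_right_mono) auto
        finally show ?thesis by (simp add: hnorm_cinner mult_ac)
      qed
    qed (use K in auto)
    have "cinner y d = cinner (L x) d" for d
    proof -
      obtain t where t: "\<forall>x. cinner (L x) d = cinner x t" using adj_ex by blast
      then have "(t, cinner d y) \<in> G" by (auto simp: G_def)
      from x[OF this] have "cnj (cinner d y) = cnj (cinner t x)" by simp
      then show ?thesis using t by (metis cinner_commute)
    qed
    then show ?thesis using cinner_ext by blast
  qed
  then show ?thesis by (auto simp: surj_def)
qed

end


text \<open>Links the Koszul complex to the analysis: what is extracted from \<open>l\<close> being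
  outside the spectrum is surjectivity of the row modulo \<open>M\<close>.\<close>

lemma outside_taylor_spectrum:
  fixes k :: "complex ^ 'n::{finite,linorder} \<Rightarrow> complex ^ 'n::{finite,linorder} \<Rightarrow> complex"
  assumes inner: "cnp_inner_multiplier k b HD ipD HE ipE \<theta> M"
    and M: "\<forall>i. \<forall>f\<in>M. coord_mult i f \<in> M" and l: "l \<in> cball 0 1"
    and ns: "l \<notin> taylor_spectrum (quot_module (fun_module HD) M)
      (\<lambda>i. quot_map (fun_module HD) M (coord_mult i))"
  shows "cnp_inner_multiplier_row k b HD ipD HE ipE \<theta> M l"
proof -
  interpret cnp_inner_multiplier k b HD ipD HE ipE \<theta> M by (rule inner)
  have coord: "coord_mult i = pmul (\<lambda>z. z $ i)" for i :: 'n
    by (simp add: fun_eq_iff coord_mult_def)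
  interpret T: quotient_tuple HD M coord_mult
  proof
    show "csubspace HD" by (rule D.csub)
    show "coord_mult i f \<in> HD" if "f \<in> HD" for i f
      unfolding coord using D.coord_bounded(1) that .
    show "coord_mult i f \<in> M" if "f \<in> M" for i f
      using M that by blast
    show "coord_mult i (f + g) = coord_mult i f + coord_mult i g" for i f g
      by (simp add: fun_eq_iff coord_mult_def scaleC_add_right)
    show "coord_mult i (c *\<^sub>C f) = c *\<^sub>C coord_mult i f" for i c f
      by (simp add: fun_eq_iff coord_mult_def scaleC_scaleC mult.commute)
  qed (fact M_csub M_sub)+
  show ?thesis
  proof unfold_locales
    fix h assume h: "h \<in> HD"
    obtain g where g: "\<And>i. g i \<in> HD"
      "h - (\<Sum>i\<in>UNIV. coord_mult i (g i) - (l $ i) *\<^sub>C g i) \<in> M"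
      by (rule T.row_surjective[OF ns h]) (rule that)
    have eq: "coord_mult i (g i) - (l $ i) *\<^sub>C g i = pmul (\<lambda>z. z $ i - l $ i) (g i)" for i
      by (simp add: fun_eq_iff coord_mult_def scaleC_diff_left)
    show "\<exists>g. (\<forall>i. g i \<in> HD) \<and> h - (\<Sum>i\<in>UNIV. pmul (\<lambda>z. z $ i - l $ i) (g i)) \<in> M"
      using g unfolding eq by blast
  qed (rule l)
qed

theorem theoremB:
  fixes k :: "complex ^ 'n::{finite,linorder} \<Rightarrow> complex ^ 'n::{finite,linorder} \<Rightarrow> complex"
    and HD M :: "(complex ^ 'n::{finite,linorder} \<Rightarrow> 'd::chilbert_space) set"
    and ipD :: "(complex ^ 'n::{finite,linorder} \<Rightarrow> 'd) \<Rightarrow> (complex ^ 'n::{finite,linorder} \<Rightarrow> 'd) \<Rightarrow> complex"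
    and HE :: "(complex ^ 'n::{finite,linorder} \<Rightarrow> 'e::chilbert_space) set"
    and ipE :: "(complex ^ 'n::{finite,linorder} \<Rightarrow> 'e) \<Rightarrow> (complex ^ 'n::{finite,linorder} \<Rightarrow> 'e) \<Rightarrow> complex"
    and \<theta> :: "complex ^ 'n::{finite,linorder} \<Rightarrow> 'e \<Rightarrow>\<^sub>L 'd"
  assumes "regular_uinv_cnp_kernel k"
    and "vv_rkhs (ball 0 1) k HD ipD"
    and "vv_rkhs (ball 0 1) k HE ipE"
    and "cfinite_dim TYPE('d)"
    and "closed_fun_subspace HD ipD M"
    and "\<forall>i. \<forall>f\<in>M. coord_mult i f \<in> M"
    and "inner_multiplier (ball 0 1) HE ipE HD ipD \<theta>"
    and "M = mult_op \<theta> ` HE"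
  shows "E_set \<theta> \<union> F_set \<theta> \<subseteq>
    taylor_spectrum (quot_module (fun_module HD) M)
      (\<lambda>i. quot_map (fun_module HD) M (coord_mult i))"
proof
  fix l assume "l \<in> E_set \<theta> \<union> F_set \<theta>"
  then have l: "l \<in> cball 0 1"
    and bad: "(\<exists>L. (\<theta> \<longlongrightarrow> L) (at l within ball 0 1) \<and> \<not> surj (blinfun_apply L)) \<or>
      \<not> (\<exists>L. (\<theta> \<longlongrightarrow> L) (at l within ball 0 1))"
    by (auto simp: E_set_def F_set_def)
  obtain b where b: "cnp_kernel k b" by (rule regular_cnp_kernel[OF assms(1)])
  have D: "cnp_rkhs k b HD ipD" and E: "cnp_rkhs k b HE ipE"
    using b assms(2,3) by (simp_all add: cnp_rkhs_def)
  have "cnp_inner_multiplier k b HD ipD HE ipE \<theta> M"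
    unfolding cnp_inner_multiplier_def cnp_inner_multiplier_axioms_def
    using D E assms(5,7,8) vv_rkhs.closed_in_iff[OF assms(2)] by blast
  note row = outside_taylor_spectrum[OF this assms(6) l]
  show "l \<in> taylor_spectrum (quot_module (fun_module HD) M)
      (\<lambda>i. quot_map (fun_module HD) M (coord_mult i))"
    using bad cnp_inner_multiplier_row.limit_exists[OF row] cnp_inner_multiplier_row.limit_surj[OF row]
    by blast
qed

end
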